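(* There exists an infinite number of gordian unlinks.
   Context: A curve $\gamma:[0,s]\to\mathbb R^3$ is called $\kappa$-constrained ($\kappa>0$) if it is an embedded arc-length parametrised curve that is $C^1$ and piecewise $C^2$ (the second derivative fails to exist at finitely many points at most) with $\|\gamma''(t)\|\le\kappa$ wherever $\gamma''(t)$ is defined. For a loop ($\gamma(0)=\gamma(s)$) the same conditions are understood on the closed curve, i.e. the image is homeomorphic to $S^1$ and is $C^1$ as a closed curve. Knots are images of $\kappa$-constrained loops; here $\kappa=1$. Radius of thickness of a knot $\gamma$: $\tau(\gamma)=\min\{R_1(\gamma),\tfrac12R_2(\gamma)\}$, where $R_1(\gamma)$ is the minimum radius of curvature (the reciprocal of the maximal curvature) and $R_2(\gamma)$ is the minimum of $\|p-q\|$ over all pairs of distinct points $p,q\in\gamma$ such that the chord $pq$ is orthogonal to the tangent vectors of $\gamma$ at $p$ and at $q$. Thin link of thickness $d\in[1,2)$: a finite collection of pairwise disjoint $1$-constrained knots (the components), each with $\tau\ge d/2$, such that the open tubular neighbourhoods of radius $d/2$ of distinct components are disjoint. A thin isotopy is a continuous one-parameter family (in the $C^1$ sense) of thin links of the same thickness $d$ in which the length of each component is constant. Gordian unlink: a thin link, of some thickness $d\in[1,2)$, with at least two components, each of which is an unknot, which is (ambient) isotopic to the trivial link in the usual topological sense, but which cannot be disentangled by a thin isotopy: it is not the case that for every $R>0$ there is a thin isotopy starting at it and ending at a link whose components have pairwise disjoint $R$-neighbourhoods. *)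

theory Defs
  imports "HOL-Analysis.Analysis"
begin

definition tangent :: "real \<Rightarrow> (real \<Rightarrow> real^3) \<Rightarrow> real \<Rightarrow> real^3" where
  "tangent s \<gamma> t = vector_derivative \<gamma> (at t within {0..s})"

text \<open>
  Derivatives are taken within \<open>{0..s}\<close>, hence are one-sided at the endpoints; the closed
  curve is \<open>C\<^sup>1\<close> because the two one-sided tangents agree.  \<open>piecewise_C1_differentiable_on\<close>,
  applied to the tangent, says that \<open>\<gamma>''\<close> exists and is continuous off a finite set.
\<close>
definition constrained_loop :: "real \<Rightarrow> real \<Rightarrow> (real \<Rightarrow> real^3) \<Rightarrow> bool" where
  "constrained_loop \<kappa> s \<gamma> \<longleftrightarrow>
     0 < s \<and> \<gamma> 0 = \<gamma> s \<and> inj_on \<gamma> {0..<s} \<and>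
     \<gamma> differentiable_on {0..s} \<and>
     continuous_on {0..s} (tangent s \<gamma>) \<and>
     tangent s \<gamma> 0 = tangent s \<gamma> s \<and>
     (\<forall>t\<in>{0..s}. norm (tangent s \<gamma> t) = 1) \<and>
     tangent s \<gamma> piecewise_C1_differentiable_on {0..s} \<and>
     (\<forall>t\<in>{0..s}. tangent s \<gamma> differentiable (at t within {0..s}) \<longrightarrow>
        norm (vector_derivative (tangent s \<gamma>) (at t within {0..s})) \<le> \<kappa>)"

text \<open>
  For constrained loops the suprema and infima below are over nonempty sets bounded on the
  relevant side.  The maximal curvature is a supremum because \<open>\<gamma>''\<close> may jump; it is positive
  for a closed curve.
\<close>
definition max_curvature :: "real \<Rightarrow> (real \<Rightarrow> real^3) \<Rightarrow> real" where
  "max_curvature s \<gamma> =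
     Sup {norm (vector_derivative (tangent s \<gamma>) (at t within {0..s})) | t.
            t \<in> {0..s} \<and> tangent s \<gamma> differentiable (at t within {0..s})}"

definition R1 :: "real \<Rightarrow> (real \<Rightarrow> real^3) \<Rightarrow> real" where
  "R1 s \<gamma> = 1 / max_curvature s \<gamma>"

definition R2 :: "real \<Rightarrow> (real \<Rightarrow> real^3) \<Rightarrow> real" where
  "R2 s \<gamma> =
     Inf {norm (\<gamma> a - \<gamma> b) | a b.
            a \<in> {0..s} \<and> b \<in> {0..s} \<and> \<gamma> a \<noteq> \<gamma> b \<and>
            (\<gamma> a - \<gamma> b) \<bullet> tangent s \<gamma> a = 0 \<and>
            (\<gamma> a - \<gamma> b) \<bullet> tangent s \<gamma> b = 0}"

definition thickness_radius :: "real \<Rightarrow> (real \<Rightarrow> real^3) \<Rightarrow> real" where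
  "thickness_radius s \<gamma> = min (R1 s \<gamma>) (R2 s \<gamma> / 2)"

text \<open>
  A knot is a point set, the image of a constrained loop, and a link is the set of its
  components.  The arc-length parametrisation of a knot is unique up to the choice of a base
  point and a direction, neither of which affects the thickness radius.
\<close>
definition thick_knot :: "real \<Rightarrow> (real^3) set \<Rightarrow> bool" where
  "thick_knot r K \<longleftrightarrow>
     (\<exists>s \<gamma>. constrained_loop 1 s \<gamma> \<and> K = \<gamma> ` {0..s} \<and> r \<le> thickness_radius s \<gamma>)"

definition tube :: "real \<Rightarrow> (real^3) set \<Rightarrow> (real^3) set" where
  "tube r K = (\<Union>p\<in>K. ball p r)"

definition disjoint_tubes :: "real \<Rightarrow> (real^3) set set \<Rightarrow> bool" where
  "disjoint_tubes r L \<longleftrightarrow> pairwise (\<lambda>K K'. disjnt (tube r K) (tube r K')) L"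

definition thin_link :: "real \<Rightarrow> (real^3) set set \<Rightarrow> bool" where
  "thin_link d L \<longleftrightarrow>
     d \<in> {1..<2} \<and> finite L \<and> pairwise disjnt L \<and>
     (\<forall>K\<in>L. thick_knot (d/2) K) \<and> disjoint_tubes (d/2) L"

text \<open>
  The moving components are indexed by the components \<open>K\<close> of the initial link.  All loops
  \<open>h K u\<close> are parametrised by arc length on the same interval \<open>{0..l K}\<close>, so the length of each
  component is constant.  Continuity in \<open>u\<close> is with respect to the \<open>C\<^sup>1\<close> norm.
\<close>
definition thin_isotopy :: "real \<Rightarrow> (real^3) set set \<Rightarrow> (real^3) set set \<Rightarrow> bool" where
  "thin_isotopy d L L' \<longleftrightarrow>
     (\<exists>(l :: (real^3) set \<Rightarrow> real) (h :: (real^3) set \<Rightarrow> real \<Rightarrow> real \<Rightarrow> real^3).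
        (\<forall>K\<in>L. \<forall>u\<in>{0..1}.
           constrained_loop 1 (l K) (h K u) \<and>
           uniform_limit {0..l K} (h K) (h K u) (at u within {0..1}) \<and>
           uniform_limit {0..l K} (\<lambda>v. tangent (l K) (h K v)) (tangent (l K) (h K u))
             (at u within {0..1})) \<and>
        (\<forall>u\<in>{0..1}.
           inj_on (\<lambda>K. h K u ` {0..l K}) L \<and>
           thin_link d ((\<lambda>K. h K u ` {0..l K}) ` L)) \<and>
        (\<forall>K\<in>L. h K 0 ` {0..l K} = K) \<and>
        (\<lambda>K. h K 1 ` {0..l K}) ` L = L')"

definition ambient_isotopic :: "(real^3) set set \<Rightarrow> (real^3) set set \<Rightarrow> bool" where
  "ambient_isotopic L L' \<longleftrightarrow>
     (\<exists>f. homotopic_with_canon (\<lambda>h. \<exists>g. homeomorphism UNIV UNIV h g) UNIV UNIV id f \<and>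
          (`) f ` L = L')"

text \<open>Unit circles in the plane \<open>z = 0\<close> bounding disjoint discs, centred at \<open>(3 i, 0, 0)\<close>.\<close>
definition planar_circle :: "nat \<Rightarrow> (real^3) set" where
  "planar_circle i = {x. x $ 3 = 0 \<and> dist x (vector [3 * real i, 0, 0]) = 1}"

definition trivial_link :: "nat \<Rightarrow> (real^3) set set" where
  "trivial_link n = planar_circle ` {..<n}"

definition unknot :: "(real^3) set \<Rightarrow> bool" where
  "unknot K \<longleftrightarrow> ambient_isotopic {K} (trivial_link 1)"

definition unlink :: "(real^3) set set \<Rightarrow> bool" where
  "unlink L \<longleftrightarrow> ambient_isotopic L (trivial_link (card L))"

definition thinly_disentangled :: "real \<Rightarrow> (real^3) set set \<Rightarrow> bool" where
  "thinly_disentangled d L \<longleftrightarrow> (\<forall>R>0. \<exists>L'. thin_isotopy d L L' \<and> disjoint_tubes R L')"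

definition gordian_unlink :: "(real^3) set set \<Rightarrow> bool" where
  "gordian_unlink L \<longleftrightarrow>
     (\<exists>d. thin_link d L \<and> 2 \<le> card L \<and> (\<forall>K\<in>L. unknot K) \<and> unlink L \<and>
          \<not> thinly_disentangled d L)"

text \<open>Isotopic at some common thickness; this is the identification used when counting links.\<close>
definition thinly_isotopic :: "(real^3) set set \<Rightarrow> (real^3) set set \<Rightarrow> bool" where
  "thinly_isotopic L L' \<longleftrightarrow> (\<exists>d. thin_isotopy d L L')"

end

theory Submission
  imports Defs
begin

text \<open>
  The links have two components. One is a stadium \<open>A\<close>, the boundary of the unit neighbourhood of a
  segment of length one in a horizontal plane; its length is \<open>2 * \<pi> + 2\<close>. The other is a
  peanut-shaped curve \<open>B\<close> in the vertical plane through that segment. The neck of the peanut passes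
  through the stadium and crosses its plane at the two ends of the segment. The thickness is
  \<open>d = 1\<close>, and the pair is tight: the two strands of the neck are at distance exactly one, and the
  stadium is as short as possible around them.

  The obstruction is rigidity of this tight position. The two components keep distance at least one
  from each other. If therefore a line meets \<open>A\<close>, a strand of \<open>B\<close>,
  another strand of \<open>B\<close> and \<open>A\<close> again in this order, then \<open>A\<close> has length at least
  \<open>2 * \<pi> + 2 * \<rho>\<close>, where \<open>\<rho>\<close> is the distance of the two points on \<open>B\<close>: it has to make a quarter
  turn outside a unit ball four times and to cover the distance \<open>\<rho>\<close> twice (\<open>half_turn_time\<close>).
  Distant strands of a curve of thickness one are at distance at least one (\<open>strands_apart\<close>), so
  \<open>\<rho> \<ge> 1\<close>. The length of \<open>A\<close> is constant under a thin isotopy, so equality holds throughout, and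
  in the equality case \<open>A\<close> is a stadium tight around two points of \<open>B\<close> (\<open>half_turn_rigid\<close>,
  \<open>gripped_of_line\<close>).

  It remains to see that such a line cannot get lost. In the tight position the line is a zero of a
  map with surjective derivative, and by Brouwer's theorem it survives small perturbations
  (\<open>transversal_zero_persists\<close>). So the set of times at which \<open>A\<close> is tight around \<open>B\<close> is open as
  well as closed (\<open>gripped_open\<close>, \<open>gripped_persists\<close>). The components stay at distance one for
  ever. The fact that an isotopy may use any arc-length parametrisation is harmless, since length and
  tangent lines are determined by the point set (\<open>constrained_loop_length_unique\<close>,
  \<open>unit_speed_loop_tangent_unique\<close>).

  Topologically the link is trivial: for a peanut with small bulbs the stadium can be lifted over
  the upper bulb if thickness is ignored, and this motion and the subsequent rounding of the curves
  are compositions of maps that are affine on all lines parallel to a coordinate axis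
  (\<open>unlinking_isotopy\<close>). Infinitely many classes arise by varying the radius of the arcs of the
  peanut, because its length changes with the radius.
\<close>

section \<open>Unit-speed parametrisations of loops\<close>

text \<open>
  Both curves of the construction are glued from arcs, and the derivative at the joints is not
  available by differentiating a formula. The fundamental theorem of calculus tolerates finitely many
  exceptions, so the function is an integral of the continuous candidate derivative everywhere.
\<close>

lemma has_vector_derivative_of_continuous:
  fixes f f' :: "real \<Rightarrow> 'a::banach"
  assumes S: "finite S" and f: "continuous_on {a..b} f" and f': "continuous_on {a..b} f'"
    and d: "\<And>x. x \<in> {a<..<b} - S \<Longrightarrow> (f has_vector_derivative f' x) (at x)"
    and x: "x \<in> {a..b}"
  shows "(f has_vector_derivative f' x) (at x within {a..b})"
proof -
  have *: "f u = f a + integral {a..u} f'" if "u \<in> {a..b}" for u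
  proof -
    have "(f' has_integral f u - f a) {a..u}"
    proof (rule fundamental_theorem_of_calculus_interior_strong[OF S])
      show "a \<le> u" using that by simp
      show "continuous_on {a..u} f"
        using f by (rule continuous_on_subset) (use that in auto)
    qed (use d that in auto)
    then show ?thesis by (simp add: integral_unique)
  qed
  have "((\<lambda>u. f a + integral {a..u} f') has_vector_derivative f' x) (at x within {a..b})"
    using integral_has_vector_derivative[OF f' x] by (auto intro!: derivative_eq_intros)
  then show ?thesis by (rule has_vector_derivative_transform[OF x, rotated]) (rule *)
qed

lemma norm_diff_le_of_derivative_bound:
  fixes f :: "real \<Rightarrow> 'a::banach"
  assumes S: "finite S" and f: "continuous_on {a..b} f" and "a \<le> b" "0 \<le> \<kappa>"
    and d: "\<And>x. x \<in> {a<..<b} - S \<Longrightarrow> (f has_vector_derivative f' x) (at x)"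
    and n: "\<And>x. x \<in> {a<..<b} - S \<Longrightarrow> norm (f' x) \<le> \<kappa>"
  shows "norm (f b - f a) \<le> \<kappa> * (b - a)"
proof -
  have "(f' has_integral f b - f a) {a..b}"
    by (rule fundamental_theorem_of_calculus_interior_strong[OF S]) (use assms in auto)
  then have "norm (f b - f a) \<le> \<kappa> * measure lborel (cbox a b)"
    using has_integral_bound_spike_finite[of \<kappa> "S \<union> {a, b}" f' "f b - f a" a b] n assms
    by (auto simp: less_le)
  then show ?thesis using \<open>a \<le> b\<close> by simp
qed

text \<open>
  The curvature bound is only assumed off finitely many parameters; continuity of the tangent turns
  it into a Lipschitz bound on the whole parameter interval.
\<close>

lemma constrained_tangent_lipschitz:
  assumes "constrained_loop \<kappa> s \<gamma>" "0 \<le> \<kappa>" "a \<in> {0..s}" "b \<in> {0..s}"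
  shows "norm (tangent s \<gamma> b - tangent s \<gamma> a) \<le> \<kappa> * \<bar>b - a\<bar>"
proof -
  have *: "norm (tangent s \<gamma> b - tangent s \<gamma> a) \<le> \<kappa> * (b - a)"
    if "a \<in> {0..s}" "b \<in> {0..s}" "a \<le> b" for a b
  proof -
    let ?T = "tangent s \<gamma>"
    obtain S where S: "finite S" "?T C1_differentiable_on ({0..s} - S)"
      using assms(1) unfolding constrained_loop_def piecewise_C1_differentiable_on_def by auto
    obtain D where D: "\<And>x. x \<in> {0..s} - S \<Longrightarrow> (?T has_vector_derivative D x) (at x)"
      using S(2) unfolding C1_differentiable_on_def by blast
    have n: "norm (D x) \<le> \<kappa>" if "x \<in> {a<..<b} - S" for x
    proof -
      have x: "x \<in> {0..s} - S" using that \<open>a \<in> _\<close> \<open>b \<in> _\<close> by auto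
      have dd: "(?T has_vector_derivative D x) (at x within {0..s})"
        using D[OF x] by (rule has_vector_derivative_at_within)
      then have "?T differentiable (at x within {0..s})"
        by (rule differentiableI_vector)
      moreover have "vector_derivative ?T (at x within {0..s}) = D x"
        using vector_derivative_within_cbox[of 0 s x ?T "D x"] dd x assms(1)
        by (auto simp: constrained_loop_def)
      ultimately show ?thesis using assms(1) x unfolding constrained_loop_def by auto
    qed
    show ?thesis
    proof (rule norm_diff_le_of_derivative_bound[OF S(1) _ \<open>a \<le> b\<close> assms(2), of _ D])
      show "continuous_on {a..b} ?T"
        using assms(1) unfolding constrained_loop_def
        by (meson continuous_on_subset atLeastatMost_subset_iff atLeastAtMost_iff that)
    qed (use D n that in auto)
  qed
  show ?thesis
  proof (cases "a \<le> b")
    case True then show ?thesis using *[of a b] assms by auto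
  next
    case False then show ?thesis using *[of b a] assms by (auto simp: norm_minus_commute)
  qed
qed

text \<open>
  A loop is turned into a periodic curve on the whole line, so that no argument has to treat the base
  point separately.
\<close>

definition periodic_ext :: "real \<Rightarrow> (real \<Rightarrow> 'a) \<Rightarrow> real \<Rightarrow> 'a" where
  "periodic_ext s f t = f (s * frac (t / s))"

lemma periodic_ext_shift:
  assumes "0 < s"
  shows "periodic_ext s f (t + of_int k * s) = periodic_ext s f t"
proof -
  have "(t + of_int k * s) / s = t / s + of_int k" using assms by (simp add: add_divide_distrib)
  moreover have "frac (t / s + of_int k) = frac (t / s)" by (simp add: frac_def)
  ultimately show ?thesis by (simp add: periodic_ext_def)
qed

lemma periodic_ext_period:
  assumes "0 < s"
  shows "periodic_ext s f (t + s) = periodic_ext s f t" "periodic_ext s f (t - s) = periodic_ext s f t"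
  using periodic_ext_shift[OF assms, of f t 1] periodic_ext_shift[OF assms, of f t "-1"] by auto

lemma periodic_ext_arg:
  assumes "0 < s" shows "s * frac (t / s) \<in> {0..<s}"
  using assms frac_lt_1[of "t / s"] by (simp add: frac_ge_0)

lemma periodic_ext_eq:
  assumes "0 < s" "f 0 = f s" "t \<in> {0..s}"
  shows "periodic_ext s f t = f t"
proof (cases "t = s")
  case False
  then have "frac (t / s) = t / s" using assms by (subst frac_eq) auto
  then show ?thesis using assms by (simp add: periodic_ext_def)
qed (use assms in \<open>simp add: periodic_ext_def\<close>)

lemma real_mod_period:
  fixes t s :: real
  assumes "0 < s" shows "\<exists>k::int. t + of_int k * s \<in> {0..<s}"
proof -
  have "t + of_int (- \<lfloor>t / s\<rfloor>) * s = s * frac (t / s)"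
    using assms by (simp add: frac_def field_simps)
  then show ?thesis using periodic_ext_arg[OF assms, of t] by metis
qed

lemma continuous_on_periodic_ext:
  fixes f :: "real \<Rightarrow> 'a::topological_space"
  assumes s: "0 < s" and f: "continuous_on {0..s} f" "f 0 = f s"
  shows "continuous_on UNIV (periodic_ext s f)"
proof -
  let ?P = "periodic_ext s f"
  have c0: "continuous_on {0..s} ?P"
    using f(1) by (rule continuous_on_eq) (use periodic_ext_eq s f in metis)
  have c1: "continuous_on {-s..0} ?P"
  proof (rule continuous_on_eq)
    show "continuous_on {-s..0} (\<lambda>t. f (t + s))"
      by (rule continuous_on_compose2[OF f(1)]) (auto intro!: continuous_intros)
    show "f (t + s) = ?P t" if "t \<in> {-s..0}" for t
      using periodic_ext_eq[OF s f(2), of "t + s"] periodic_ext_period[OF s, of f t] that by auto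
  qed
  have "{-s..s} = {-s..0} \<union> {0..s}" using s by auto
  then have c: "continuous_on {-s..s} ?P" using continuous_on_closed_Un[OF _ _ c1 c0] by auto
  have "isCont ?P t" for t
  proof -
    obtain k :: int where k: "t + of_int k * s \<in> {0..<s}" using real_mod_period[OF s] by blast
    then have "isCont ?P (t + of_int k * s)"
      using continuous_on_interior[OF c, of "t + of_int k * s"] s by auto
    then have "isCont (\<lambda>t. ?P (t + of_int k * s)) t"
      by (rule isCont_o2[of t "\<lambda>t. t + of_int k * s", rotated]) (intro continuous_intros)
    then show ?thesis by (simp only: periodic_ext_shift[OF s])
  qed
  then show ?thesis by (simp add: continuous_at_imp_continuous_on)
qed

text \<open>
  The properties of the periodic extension that the geometric arguments use. The last assumption says
  that the loop is simple.
\<close>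

locale unit_speed_loop =
  fixes l :: real and P T :: "real \<Rightarrow> real^3"
  assumes period_pos: "0 < l"
    and der: "\<And>t. (P has_vector_derivative T t) (at t)"
    and contT: "continuous_on UNIV T"
    and unit: "\<And>t. norm (T t) = 1"
    and perP: "\<And>t k. P (t + of_int k * l) = P t"
    and perT: "\<And>t k. T (t + of_int k * l) = T t"
    and injP: "\<And>t t'. P t = P t' \<Longrightarrow> \<exists>k::int. t' = t + of_int k * l"

lemma unit_speed_loop_periodic_ext:
  assumes C: "constrained_loop \<kappa> s \<gamma>"
  shows "unit_speed_loop s (periodic_ext s \<gamma>) (periodic_ext s (tangent s \<gamma>))"
proof
  let ?P = "periodic_ext s \<gamma>" and ?T = "periodic_ext s (tangent s \<gamma>)"
  show s: "0 < s" using C by (simp add: constrained_loop_def)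
  have g: "continuous_on {0..s} \<gamma>" "\<gamma> 0 = \<gamma> s" "continuous_on {0..s} (tangent s \<gamma>)"
     "tangent s \<gamma> 0 = tangent s \<gamma> s" "inj_on \<gamma> {0..<s}"
    using C by (auto simp: constrained_loop_def differentiable_imp_continuous_on)
  have diff: "\<gamma> differentiable_on {0..s}" using C by (simp add: constrained_loop_def)
  show cT: "continuous_on UNIV ?T" by (rule continuous_on_periodic_ext[OF s g(3,4)])
  have cP: "continuous_on UNIV ?P" by (rule continuous_on_periodic_ext[OF s g(1,2)])
  show "?P (t + of_int k * s) = ?P t" "?T (t + of_int k * s) = ?T t" for t k
    by (rule periodic_ext_shift[OF s])+
  show "norm (?T t) = 1" for t
    using C periodic_ext_arg[OF s, of t] unfolding periodic_ext_def constrained_loop_def by auto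
  have dg: "(\<gamma> has_vector_derivative tangent s \<gamma> t) (at t)" if "t \<in> {0<..<s}" for t
  proof -
    have "(\<gamma> has_vector_derivative tangent s \<gamma> t) (at t within {0..s})"
      using diff that unfolding tangent_def differentiable_on_def
      by (simp flip: vector_derivative_works)
    then show ?thesis using that by (auto simp: at_within_Icc_at)
  qed
  have d0: "(?P has_vector_derivative ?T t) (at t)" if "t \<in> {0<..<s}" for t
  proof -
    have "?T t = tangent s \<gamma> t" using periodic_ext_eq[of s "tangent s \<gamma>" t] s g that by auto
    then show ?thesis
      using dg[OF that] that periodic_ext_eq[of s \<gamma>, OF s g(2)]
      by (auto intro!: has_vector_derivative_transform_within_open[of \<gamma> _ t "{0<..<s}" ?P])
  qed
  have shift: "(?P has_vector_derivative ?T t) (at t)"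
    if "(?P has_vector_derivative ?T (t + of_int k * s)) (at (t + of_int k * s))" for t k
  proof -
    have "((?P \<circ> (\<lambda>t. t + of_int k * s)) has_vector_derivative 1 *\<^sub>R ?T (t + of_int k * s)) (at t)"
      by (rule vector_diff_chain_at) (use that in \<open>auto intro!: derivative_eq_intros\<close>)
    moreover have "?P \<circ> (\<lambda>t. t + of_int k * s) = ?P"
      by (simp add: fun_eq_iff periodic_ext_shift[OF s] del: of_int_mult)
    ultimately show ?thesis by (simp only: periodic_ext_shift[OF s] scaleR_one)
  qed
  have d1: "(?P has_vector_derivative ?T t) (at t)" if "t \<in> {-s<..<s}" for t
  proof -
    have "(?P has_vector_derivative ?T t) (at t within {-s..s})"
    proof (rule has_vector_derivative_of_continuous[of "{0}"])
      fix x assume "x \<in> {-s<..<s} - {0}"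
      then have "x \<in> {0<..<s} \<or> x + of_int 1 * s \<in> {0<..<s}" by auto
      then show "(?P has_vector_derivative ?T x) (at x)" using d0 shift by blast
    qed (use that cT cP in \<open>auto intro: continuous_on_subset\<close>)
    then show ?thesis using that by (auto simp: at_within_Icc_at)
  qed
  show "(?P has_vector_derivative ?T t) (at t)" for t
  proof -
    obtain k :: int where k: "t + of_int k * s \<in> {0..<s}" using real_mod_period[OF s] by blast
    then show ?thesis using shift d1[of "t + of_int k * s"] s by auto
  qed
  show "\<exists>k::int. t' = t + of_int k * s" if "?P t = ?P t'" for t t'
  proof -
    have "s * frac (t / s) = s * frac (t' / s)"
      using that g(5) periodic_ext_arg[OF s] unfolding periodic_ext_def inj_on_def by blast
    then have "t' / s = t / s + of_int (\<lfloor>t' / s\<rfloor> - \<lfloor>t / s\<rfloor>)" using s by (simp add: frac_def)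
    moreover have "t' = t' / s * s" "t = t / s * s" using s by auto
    ultimately have "t' = t + of_int (\<lfloor>t' / s\<rfloor> - \<lfloor>t / s\<rfloor>) * s" by (metis distrib_right)
    then show ?thesis by (rule exI)
  qed
qed

lemma periodic_ext_range:
  assumes "0 < s" "f 0 = f s" shows "range (periodic_ext s f) = f ` {0..s}"
proof
  show "range (periodic_ext s f) \<subseteq> f ` {0..s}"
  proof
    fix x assume "x \<in> range (periodic_ext s f)"
    then obtain t where "x = f (s * frac (t / s))" by (auto simp: periodic_ext_def)
    moreover have "s * frac (t / s) \<in> {0..s}" 
      using periodic_ext_arg[OF assms(1), of t]
      unfolding atLeastLessThan_iff atLeastAtMost_iff by linarith
    ultimately show "x \<in> f ` {0..s}" by (metis imageI)
  qed
  show "f ` {0..s} \<subseteq> range (periodic_ext s f)"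
  proof
    fix x assume "x \<in> f ` {0..s}"
    then obtain t where t: "t \<in> {0..s}" "x = f t" by blast
    then have "x = periodic_ext s f t" using periodic_ext_eq[of s f t] assms by simp
    then show "x \<in> range (periodic_ext s f)" by (rule range_eqI)
  qed
qed

text \<open>
  An interval that is no longer than a period contains at most one translate of the base point in
  its interior, so two applications of the bound on one period suffice.
\<close>

lemma periodic_ext_lipschitz:
  fixes f :: "real \<Rightarrow> 'a::real_normed_vector"
  assumes s: "0 < s" and f: "f 0 = f s"
    and L: "\<And>a b. a \<in> {0..s} \<Longrightarrow> b \<in> {0..s} \<Longrightarrow> norm (f b - f a) \<le> \<kappa> * \<bar>b - a\<bar>"
    and ab: "a \<le> b" "b \<le> a + s"
  shows "norm (periodic_ext s f b - periodic_ext s f a) \<le> \<kappa> * (b - a)"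
proof -
  let ?P = "periodic_ext s f"
  have one: "norm (?P b - ?P a) \<le> \<kappa> * (b - a)"
    if "a \<le> b" "of_int k * s \<le> a" "b \<le> of_int k * s + s" for a b k
  proof -
    have "?P a = f (a - of_int k * s)" "?P b = f (b - of_int k * s)"
      using periodic_ext_shift[OF s, of f a "-k"] periodic_ext_shift[OF s, of f b "-k"]
        periodic_ext_eq[OF s f] that by auto
    then show ?thesis using L[of "a - of_int k * s" "b - of_int k * s"] that by auto
  qed
  define k where "k = \<lfloor>a / s\<rfloor>"
  define c where "c = of_int k * s + s"
  have "of_int k \<le> a / s" "a / s < of_int k + 1" unfolding k_def by linarith+
  then have k: "of_int k * s \<le> a" "a < c" using s by (auto simp: c_def field_simps)
  show ?thesis
  proof (cases "b \<le> c")
    case True then show ?thesis using one[of a b k] k ab by (auto simp: c_def)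
  next
    case False
    have "norm (?P b - ?P c) \<le> \<kappa> * (b - c)"
      using one[of c b "k + 1"] False ab k by (auto simp: c_def algebra_simps)
    moreover have "norm (?P c - ?P a) \<le> \<kappa> * (c - a)" using one[of a c k] k by (auto simp: c_def)
    ultimately show ?thesis
      using norm_triangle_ineq[of "?P b - ?P c" "?P c - ?P a"] by (auto simp: algebra_simps)
  qed
qed

section \<open>Curves outside a unit ball\<close>

lemma has_real_derivative_inner_right:
  fixes v :: "real \<Rightarrow> 'a::real_inner"
  assumes "(v has_vector_derivative v') (at t within S)"
  shows "((\<lambda>t. e \<bullet> v t) has_real_derivative e \<bullet> v') (at t within S)"
  using bounded_linear.has_vector_derivative[OF bounded_linear_inner_right assms, of e]
  by (simp add: has_real_derivative_iff_has_vector_derivative)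

lemma has_real_derivative_norm_square:
  fixes v :: "real \<Rightarrow> 'a::real_inner"
  assumes "(v has_vector_derivative v') (at t within S)"
  shows "((\<lambda>t. v t \<bullet> v t) has_real_derivative 2 * (v t \<bullet> v')) (at t within S)"
  using bounded_bilinear.has_vector_derivative[OF bounded_bilinear_inner assms assms]
  by (simp add: has_real_derivative_iff_has_vector_derivative inner_commute)

lemma has_real_derivative_norm:
  fixes v :: "real \<Rightarrow> 'a::real_inner"
  assumes "(v has_vector_derivative v') (at t within S)" "v t \<noteq> 0"
  shows "((\<lambda>t. norm (v t)) has_real_derivative (v t \<bullet> v') / norm (v t)) (at t within S)"
proof -
  have "((\<lambda>t. sqrt (v t \<bullet> v t)) has_real_derivative 2 * (v t \<bullet> v') * (inverse (sqrt (v t \<bullet> v t)) / 2))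
     (at t within S)"
    using DERIV_chain[OF DERIV_real_sqrt has_real_derivative_norm_square[OF assms(1)]] assms(2)
    by (simp add: o_def mult.commute)
  then show ?thesis by (simp add: norm_eq_sqrt_inner field_simps)
qed

text \<open>
  Outside the unit ball a unit-speed curve has angular speed at most one. The estimate is the
  Cauchy-Schwarz inequality for the component of \<open>v'\<close> orthogonal to \<open>v\<close> and the component of \<open>e\<close>
  orthogonal to \<open>v\<close>.
\<close>

lemma angular_speed:
  fixes e v v' :: "'a::real_inner"
  assumes "norm e = 1" "1 \<le> norm v" "norm v' \<le> 1"
  shows "((e \<bullet> v') * norm v - (e \<bullet> v) * ((v \<bullet> v') / norm v))\<^sup>2 / (norm v ^ 2)\<^sup>2
     \<le> 1 - ((e \<bullet> v) / norm v)\<^sup>2"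
proof -
  define n where "n = norm v"
  have n: "n \<ge> 1" "v \<bullet> v = n\<^sup>2" using assms by (auto simp: n_def power2_norm_eq_inner)
  define w where "w = n\<^sup>2 *\<^sub>R v' - (v \<bullet> v') *\<^sub>R v"
  define g where "g = e - ((e \<bullet> v) / n\<^sup>2) *\<^sub>R v"
  have vw: "v \<bullet> w = 0" by (simp add: w_def inner_simps n)
  then have gw: "g \<bullet> w = e \<bullet> w" by (simp add: g_def inner_simps)
  have v': "v' \<bullet> v' \<le> 1" using assms(3) by (simp add: norm_le_square)
  have "w \<bullet> w = n\<^sup>2 * n\<^sup>2 * (v' \<bullet> v') - n\<^sup>2 * (v \<bullet> v')\<^sup>2"
    using n(2) by (simp add: w_def inner_simps inner_commute power2_eq_square algebra_simps)
  also have "\<dots> \<le> n\<^sup>2 * n\<^sup>2"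
    using mult_left_mono[OF v', of "n\<^sup>2 * n\<^sup>2"] by (smt (verit) zero_le_mult_iff zero_le_power2 mult_cancel_left2)
  finally have ww: "w \<bullet> w \<le> n\<^sup>2 * n\<^sup>2" .
  have gg: "g \<bullet> g = 1 - ((e \<bullet> v) / n)\<^sup>2"
    using assms(1) n by (simp add: g_def inner_simps inner_commute norm_eq_1 power2_eq_square field_simps)
  have "(e \<bullet> w)\<^sup>2 \<le> (g \<bullet> g) * (w \<bullet> w)"
    using Cauchy_Schwarz_ineq[of g w] gw by simp
  also have "\<dots> \<le> (g \<bullet> g) * (n\<^sup>2 * n\<^sup>2)" using ww by (intro mult_left_mono) auto
  finally have *: "(e \<bullet> w)\<^sup>2 \<le> (1 - ((e \<bullet> v) / n)\<^sup>2) * (n\<^sup>2 * n\<^sup>2)" by (simp only: gg)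
  have "(e \<bullet> v') * n - (e \<bullet> v) * ((v \<bullet> v') / n) = (e \<bullet> w) / n"
    using n by (simp add: w_def inner_simps field_simps power2_eq_square)
  then have "((e \<bullet> v') * n - (e \<bullet> v) * ((v \<bullet> v') / n))\<^sup>2 / (n ^ 2)\<^sup>2 = (e \<bullet> w)\<^sup>2 / (n\<^sup>2 * n\<^sup>2) / n\<^sup>2"
    using n by (simp add: power2_eq_square)
  also have "\<dots> \<le> (1 - ((e \<bullet> v) / n)\<^sup>2) / n\<^sup>2"
    using * n by (intro divide_right_mono) (auto simp: pos_divide_le_eq)
  also have "\<dots> \<le> (1 - ((e \<bullet> v) / n)\<^sup>2) / 1"
    using n gg[symmetric] by (intro divide_left_mono) auto
  finally show ?thesis by (simp add: n_def)
qed

text \<open>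
  A curve of speed at most one that avoids the unit ball cannot turn, as seen from the centre, by
  more than the elapsed time. The angle to the initial direction is the arc cosine of an inner
  product \<open>f\<close>, and the arc cosine is not differentiable at the ends of its domain. Shrinking \<open>f\<close> to
  \<open>m * f\<close> with \<open>m < 1\<close> stays away from these ends and keeps the speed bound, and the claim
  follows as \<open>m\<close> tends to one.
\<close>

lemma inner_ge_cos_outside_unit_ball:
  fixes v :: "real \<Rightarrow> 'a::real_inner"
  assumes ab: "a \<le> b" "b - a \<le> pi"
    and d: "\<And>t. t \<in> {a..b} \<Longrightarrow> (v has_vector_derivative v' t) (at t within {a..b})"
    and n: "\<And>t. t \<in> {a..b} \<Longrightarrow> 1 \<le> norm (v t)"
    and n': "\<And>t. t \<in> {a..b} \<Longrightarrow> norm (v' t) \<le> 1"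
  shows "norm (v a) * norm (v b) * cos (b - a) \<le> v a \<bullet> v b"
proof -
  define e where "e = v a /\<^sub>R norm (v a)"
  have va: "norm (v a) > 0" "norm (v b) > 0" using n[of a] n[of b] ab by auto
  then have e: "norm e = 1" by (simp add: e_def)
  define f where "f t = (e \<bullet> v t) / norm (v t)" for t
  define f' where "f' t = ((e \<bullet> v' t) * norm (v t) - (e \<bullet> v t) * ((v t \<bullet> v' t) / norm (v t))) / (norm (v t) ^ 2)" for t
  have df: "(f has_real_derivative f' t) (at t within {a..b})" if "t \<in> {a..b}" for t
  proof -
    have "v t \<noteq> 0" using n[OF that] by auto
    then show ?thesis
      unfolding f_def f'_def
      using DERIV_divide[OF has_real_derivative_inner_right[OF d[OF that], of e]
        has_real_derivative_norm[OF d[OF that]]]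
      by (simp add: power2_eq_square)
  qed
  have f1: "\<bar>f t\<bar> \<le> 1" if "t \<in> {a..b}" for t
    using Cauchy_Schwarz_ineq2[of e "v t"] n[OF that] e by (simp add: f_def abs_divide divide_le_eq_1)
  have f2: "(f' t)\<^sup>2 \<le> 1 - (f t)\<^sup>2" if "t \<in> {a..b}" for t
    using angular_speed[OF e n[OF that] n'[OF that]] by (simp add: f_def f'_def power_divide)
  have fa: "f a = 1" using va by (simp add: f_def e_def power2_norm_eq_inner[symmetric] power2_eq_square field_simps)
  have key: "arccos (m * f b) \<le> arccos m + (b - a)" if l: "0 < m" "m < 1" for m
  proof -
    have lf: "\<bar>m * f t\<bar> < 1" if "t \<in> {a..b}" for t
    proof -
      have "\<bar>m * f t\<bar> \<le> m * 1" using f1[OF that] l by (simp add: abs_mult mult_left_mono)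
      then show ?thesis using l by simp
    qed
    define D where "D t = m * f' t * inverse (- sqrt (1 - (m * f t)\<^sup>2))" for t
    have dd: "((\<lambda>t. arccos (m * f t)) has_vector_derivative D t) (at t within {a..b})" if "t \<in> {a..b}" for t
      unfolding D_def has_real_derivative_iff_has_vector_derivative[symmetric]
      using df[OF that] lf[OF that] by (auto intro!: derivative_eq_intros simp: abs_less_iff)
    have nD: "norm (D t) \<le> 1" if "t \<in> {a..b}" for t
    proof -
      have "(m * f' t)\<^sup>2 \<le> m\<^sup>2 * (1 - (f t)\<^sup>2)" using f2[OF that] by (simp add: power_mult_distrib mult_left_mono)
      also have "\<dots> \<le> 1 - (m * f t)\<^sup>2" using l by (simp add: power_mult_distrib algebra_simps power_le_one)
      finally have "\<bar>m * f' t\<bar> \<le> sqrt (1 - (m * f t)\<^sup>2)" by (rule real_le_rsqrt[of "\<bar>m * f' t\<bar>", simplified])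
      moreover have "sqrt (1 - (m * f t)\<^sup>2) > 0" using lf[OF that] by (simp add: abs_square_less_1)
      ultimately show ?thesis by (simp add: D_def abs_mult field_simps)
    qed
    have "norm (arccos (m * f b) - arccos (m * f a)) \<le> 1 * (b - a)"
    proof (rule norm_diff_le_of_derivative_bound[of "{}"])
      show "continuous_on {a..b} (\<lambda>t. arccos (m * f t))"
        unfolding continuous_on_eq_continuous_within by (intro ballI has_vector_derivative_continuous[OF dd])
      show "((\<lambda>t. arccos (m * f t)) has_vector_derivative D t) (at t)" if "t \<in> {a<..<b} - {}" for t
        using dd[of t] that by (simp add: at_within_Icc_at)
    qed (use ab nD in auto)
    then show ?thesis using fa by simp
  qed
  have fb: "\<bar>f b\<bar> \<le> 1" using f1 ab by simp
  have "arccos (f b) \<le> b - a"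
  proof (rule tendsto_le[of "at_left (1::real)"])
    have ev: "\<forall>\<^sub>F l in at_left (1::real). l \<in> {0<..<1}" using eventually_at_left_real[of 0 1] by simp
    show "\<forall>\<^sub>F l in at_left 1. arccos (l * f b) \<le> arccos l + (b - a)"
      using ev by (auto elim!: eventually_mono intro: key)
    show "((\<lambda>l. arccos (l * f b)) \<longlongrightarrow> arccos (f b)) (at_left 1)"
    proof (rule continuous_on_tendsto_compose[OF continuous_on_arccos'])
      show "((\<lambda>l. l * f b) \<longlongrightarrow> f b) (at_left 1)" by (auto intro!: tendsto_eq_intros)
      show "\<forall>\<^sub>F l in at_left 1. l * f b \<in> {-1..1}"
        using ev
      proof eventually_elim
        case (elim l)
        then have "\<bar>l * f b\<bar> \<le> 1" using fb by (simp add: abs_mult mult_le_one)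
        then show ?case by (simp add: abs_le_iff)
      qed
    qed (use fb in \<open>auto simp: abs_le_iff\<close>)
    have "((\<lambda>l::real. arccos l) \<longlongrightarrow> arccos 1) (at_left 1)"
      by (rule continuous_on_tendsto_compose[OF continuous_on_arccos'])
         (use ev in \<open>auto elim!: eventually_mono\<close>)
    then show "((\<lambda>l. arccos l + (b - a)) \<longlongrightarrow> b - a) (at_left 1)"
      by (auto intro!: tendsto_eq_intros)
  qed auto
  then have "cos (b - a) \<le> cos (arccos (f b))"
    using ab fb arccos_bounded[of "f b"] by (intro cos_monotone_0_pi_le) (auto simp: abs_le_iff)
  then have "cos (b - a) \<le> f b" using fb by (simp add: abs_le_iff)
  then show ?thesis using va by (simp add: f_def e_def field_simps)
qed


lemma quarter_turn_time:
  fixes v :: "real \<Rightarrow> 'a::real_inner"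
  assumes ab: "a \<le> b" "v a \<bullet> v b = 0"
    and d: "\<And>t. t \<in> {a..b} \<Longrightarrow> (v has_vector_derivative v' t) (at t within {a..b})"
    and n: "\<And>t. t \<in> {a..b} \<Longrightarrow> 1 \<le> norm (v t)"
    and n': "\<And>t. t \<in> {a..b} \<Longrightarrow> norm (v' t) \<le> 1"
  shows "pi / 2 \<le> b - a"
proof (rule ccontr)
  assume c: "\<not> ?thesis"
  then have "norm (v a) * norm (v b) * cos (b - a) \<le> 0"
    using inner_ge_cos_outside_unit_ball[OF ab(1) _ d n n'] ab pi_gt_zero by auto
  moreover have "0 < cos (b - a)" using c ab by (intro cos_gt_zero_pi) auto
  moreover have "norm (v a) > 0" "norm (v b) > 0" using n[of a] n[of b] ab by auto
  ultimately show False by (simp add: mult_le_0_iff)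
qed

text \<open>
  The equality case. Both angles, from the start and to the end, are forced to be as large as
  possible at every time, so the direction runs along a great circle. The curve then has angular
  speed one and hence radius at most one, and it stays on the unit sphere.
\<close>

lemma quarter_turn_rigid:
  fixes v :: "real \<Rightarrow> 'a::real_inner"
  assumes ab: "b - a = pi / 2" "v a \<bullet> v b = 0" and t: "t \<in> {a..b}"
    and d: "\<And>t. t \<in> {a..b} \<Longrightarrow> (v has_vector_derivative v' t) (at t within {a..b})"
    and n: "\<And>t. t \<in> {a..b} \<Longrightarrow> 1 \<le> norm (v t)"
    and n': "\<And>t. t \<in> {a..b} \<Longrightarrow> norm (v' t) \<le> 1"
  defines "e \<equiv> v a /\<^sub>R norm (v a)" and "f \<equiv> v b /\<^sub>R norm (v b)"
  shows "v t = cos (t - a) *\<^sub>R e + sin (t - a) *\<^sub>R f"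
proof -
  have abl: "a < b" using ab pi_gt_zero by linarith
  have pos: "norm (v t) > 0" if "t \<in> {a..b}" for t using n[OF that] by linarith
  have ef: "e \<bullet> e = 1" "f \<bullet> f = 1" "e \<bullet> f = 0" "f \<bullet> e = 0"
    using pos[of a] pos[of b] abl ab(2)
    by (simp_all add: e_def f_def power2_norm_eq_inner[symmetric] inner_commute power2_eq_square)
  have dir: "v t = norm (v t) *\<^sub>R (cos (t - a) *\<^sub>R e + sin (t - a) *\<^sub>R f)" if t: "t \<in> {a..b}" for t
  proof -
    define w where "w = v t /\<^sub>R norm (v t)"
    have w: "w \<bullet> w = 1" using pos[OF t] by (simp add: w_def power2_norm_eq_inner[symmetric] power2_eq_square)
    have "norm (v a) * norm (v t) * cos (t - a) \<le> v a \<bullet> v t"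
      by (rule inner_ge_cos_outside_unit_ball[where v' = v'])
         (use t ab n n' pi_gt_zero in \<open>auto intro: has_vector_derivative_within_subset[OF d]\<close>)
    then have 1: "cos (t - a) \<le> e \<bullet> w"
      using pos[OF t] pos[of a] abl by (simp add: e_def w_def field_simps)
    have "norm (v t) * norm (v b) * cos (b - t) \<le> v t \<bullet> v b"
      by (rule inner_ge_cos_outside_unit_ball[where v' = v'])
         (use t ab n n' pi_gt_zero in \<open>auto intro: has_vector_derivative_within_subset[OF d]\<close>)
    moreover have "cos (b - t) = sin (t - a)"
    proof -
      have "b - t = pi / 2 - (t - a)" using ab by simp
      then show ?thesis by (simp only: cos_sin_eq) simp
    qed
    ultimately have 2: "sin (t - a) \<le> f \<bullet> w"
      using pos[OF t] pos[of b] abl by (simp add: f_def w_def inner_commute field_simps)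
    define c s where "c = cos (t - a)" and "s = sin (t - a)"
    have cs: "0 \<le> c" "0 \<le> s" "c\<^sup>2 + s\<^sup>2 = 1"
      using t ab by (auto simp: c_def s_def intro!: cos_ge_zero sin_ge_zero)
    \<comment> \<open>The distance between unit vectors is controlled by their inner product, here at least 1.\<close>
    have "(w - (c *\<^sub>R e + s *\<^sub>R f)) \<bullet> (w - (c *\<^sub>R e + s *\<^sub>R f))
        = w \<bullet> w - 2 * (c * (e \<bullet> w) + s * (f \<bullet> w)) + (c\<^sup>2 + s\<^sup>2)"
      using ef by (simp add: inner_simps inner_commute power2_eq_square algebra_simps)
    also have "\<dots> = 2 - 2 * (c * (e \<bullet> w) + s * (f \<bullet> w))" using w cs by simp
    also have "\<dots> \<le> 2 - 2 * (c * c + s * s)"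
      using mult_left_mono[OF 1[folded c_def] cs(1)] mult_left_mono[OF 2[folded s_def] cs(2)] by simp
    also have "\<dots> = 0" using cs by (simp add: power2_eq_square)
    finally have "(norm (w - (c *\<^sub>R e + s *\<^sub>R f)))\<^sup>2 \<le> 0" by (simp only: power2_norm_eq_inner)
    then have "w = c *\<^sub>R e + s *\<^sub>R f" by simp
    moreover have "v t = norm (v t) *\<^sub>R w" using pos[OF t] by (simp add: w_def)
    ultimately show ?thesis by (simp only: c_def s_def)
  qed
  have le: "norm (v t) \<le> 1" if t: "t \<in> {a<..<b}" for t
  proof -
    have ti: "t \<in> {a..b}" using t by auto
    have at: "at t within {a..b} = at t" using t by (simp add: at_within_Icc_at)
    \<comment> \<open>the angular velocity of \<open>v\<close> times its radius, computed from the coordinates along \<open>e\<close> and \<open>f\<close>\<close>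
    define g where "g u = (f \<bullet> v u) * cos (t - a) - (e \<bullet> v u) * sin (t - a)" for u
    have "(g has_real_derivative (f \<bullet> v' t) * cos (t - a) - (e \<bullet> v' t) * sin (t - a)) (at t)"
      unfolding g_def
      using has_real_derivative_inner_right[OF d[OF ti], of e] has_real_derivative_inner_right[OF d[OF ti], of f]
      by (auto intro!: derivative_eq_intros simp: at)
    moreover have "(g has_real_derivative norm (v t)) (at t)"
    proof (rule has_field_derivative_transform_within_open)
      have nd: "((\<lambda>u. norm (v u)) has_real_derivative (v t \<bullet> v' t) / norm (v t)) (at t)"
        using has_real_derivative_norm[OF d[OF ti]] pos[OF ti] at by auto
      show "((\<lambda>u. norm (v u) * sin (u - t)) has_real_derivative norm (v t)) (at t)"
        using nd by (auto intro!: derivative_eq_intros)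
      show "norm (v u) * sin (u - t) = g u" if "u \<in> {a<..<b}" for u
      proof -
        have "f \<bullet> v u = norm (v u) * sin (u - a)" "e \<bullet> v u = norm (v u) * cos (u - a)"
          using arg_cong[OF dir[of u], of "\<lambda>x. f \<bullet> x"] arg_cong[OF dir[of u], of "\<lambda>x. e \<bullet> x"] that
          by (auto simp: inner_simps ef)
        moreover have "u - t = (u - a) - (t - a)" by simp
        ultimately show ?thesis by (simp only: g_def sin_diff) (simp add: algebra_simps)
      qed
    qed (use t in auto)
    ultimately have "norm (v t) = v' t \<bullet> (cos (t - a) *\<^sub>R f - sin (t - a) *\<^sub>R e)"
      using DERIV_unique by (fastforce simp: inner_simps inner_commute mult.commute)
    also have "\<dots> \<le> norm (v' t) * norm (cos (t - a) *\<^sub>R f - sin (t - a) *\<^sub>R e)" by (rule norm_cauchy_schwarz)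
    also have "norm (cos (t - a) *\<^sub>R f - sin (t - a) *\<^sub>R e) = 1"
      by (simp add: norm_eq_1 inner_simps ef power2_eq_square[symmetric])
    finally show ?thesis using n'[OF ti] by simp
  qed
  have "norm (v t) = 1"
  proof -
    have "continuous_on {a..b} (\<lambda>t. norm (v t))"
      unfolding continuous_on_eq_continuous_within
      by (intro ballI continuous_norm has_vector_derivative_continuous[OF d])
    then have "norm (v t) \<le> 1" 
      using continuous_le_on_closure[of "{a<..<b}" "\<lambda>t. norm (v t)" t 1] t le abl by simp
    then show ?thesis using n[OF t] by simp
  qed
  then show ?thesis using dir[OF t] by simp
qed

section \<open>Persistence of transversal zeros\<close>

text \<open>
  A zero at which the derivative is onto survives perturbations that are small in the uniform norm
  only. With a linear right inverse \<open>K\<close> of the derivative, the map \<open>y \<mapsto> y - \<Psi> (x0 + K y)\<close> sends a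
  small ball into itself, and a fixed point given by Brouwer's theorem is a zero of \<open>\<Psi>\<close>.
\<close>

lemma transversal_zero_persists:
  fixes \<Phi> :: "'a::euclidean_space \<Rightarrow> 'b::euclidean_space"
  assumes d: "(\<Phi> has_derivative J) (at x0)" and s: "surj J" and z: "\<Phi> x0 = 0" and "0 < \<delta>"
  shows "\<exists>\<epsilon>>0. \<forall>\<Psi>. continuous_on UNIV \<Psi> \<longrightarrow> (\<forall>x\<in>cball x0 \<delta>. norm (\<Psi> x - \<Phi> x) \<le> \<epsilon>) \<longrightarrow>
     (\<exists>x\<in>cball x0 \<delta>. \<Psi> x = 0)"
proof -
  have "linear J" using d has_derivative_linear by blast
  then obtain K where K: "linear K" "J \<circ> K = id" using linear_surjective_right_inverse[OF _ s] by blast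
  obtain k where k: "k > 0" "\<And>y. norm (K y) \<le> k * norm y"
    using linear_bounded_pos[OF K(1)] by (auto simp: mult.commute)
  obtain r where r: "r > 0" "\<And>x. norm (x - x0) < r \<Longrightarrow> norm (\<Phi> x - \<Phi> x0 - J (x - x0)) \<le> 1 / (2 * k) * norm (x - x0)"
    using d[unfolded has_derivative_at_alt] k(1)
    by (metis divide_pos_pos mult_pos_pos zero_less_numeral zero_less_one)
  define \<rho> where "\<rho> = min \<delta> (r / 2) / k"
  have \<rho>: "\<rho> > 0" "k * \<rho> \<le> \<delta>" "k * \<rho> < r" using k r \<open>0 < \<delta>\<close> by (auto simp: \<rho>_def)
  show ?thesis
  proof (intro exI[of _ "\<rho> / 2"] conjI allI impI)
    fix \<Psi> :: "'a \<Rightarrow> 'b"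
    assume c: "continuous_on UNIV \<Psi>" and close: "\<forall>x\<in>cball x0 \<delta>. norm (\<Psi> x - \<Phi> x) \<le> \<rho> / 2"
    have Ky: "norm (K y) \<le> k * \<rho>" if "norm y \<le> \<rho>" for y
      using k(2)[of y] that k(1) by (meson mult_left_mono less_imp_le order_trans)
    have in_ball: "x0 + K y \<in> cball x0 \<delta>" if "norm y \<le> \<rho>" for y
      using Ky[OF that] \<rho> by (simp add: dist_norm)
    define g where "g y = y - \<Psi> (x0 + K y)" for y
    have "g y \<in> cball 0 \<rho>" if "norm y \<le> \<rho>" for y
    proof -
      have "norm (\<Phi> (x0 + K y) - y) \<le> 1 / (2 * k) * norm (K y)"
        using r(2)[of "x0 + K y"] Ky[OF that] \<rho> z fun_cong[OF K(2), of y] by simp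
      also have "\<dots> \<le> 1 / (2 * k) * (k * \<rho>)" using Ky[OF that] k(1) by (intro mult_left_mono) auto
      finally have "norm (\<Phi> (x0 + K y) - y) \<le> \<rho> / 2" using k(1) by simp
      moreover have "norm (\<Psi> (x0 + K y) - \<Phi> (x0 + K y)) \<le> \<rho> / 2" using close in_ball[OF that] by blast
      ultimately have "norm (\<Psi> (x0 + K y) - y) \<le> \<rho>"
        using norm_triangle_ineq[of "\<Psi> (x0 + K y) - \<Phi> (x0 + K y)" "\<Phi> (x0 + K y) - y"] by simp
      then show ?thesis by (simp add: g_def norm_minus_commute)
    qed
    moreover have "continuous_on (cball 0 \<rho>) g"
      unfolding g_def
      by (intro continuous_intros continuous_on_compose2[OF c] linear_continuous_on)
         (use K(1) in \<open>auto simp: linear_linear\<close>)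
    ultimately obtain y where "y \<in> cball 0 \<rho>" "g y = y"
      using brouwer[of "cball 0 \<rho>" g] \<rho>(1) by auto
    then show "\<exists>x\<in>cball x0 \<delta>. \<Psi> x = 0" using in_ball by (auto simp: g_def intro!: bexI[of _ "x0 + K y"])
  qed (use \<rho> in auto)
qed

section \<open>Invariance of length and tangent lines\<close>

context unit_speed_loop begin

lemma contP: "continuous_on S P"
  by (meson UNIV_I continuous_on_subset der has_vector_derivative_continuous
      continuous_at_imp_continuous_on top_greatest)

lemma period1: "P (t + l) = P t" "T (t + l) = T t" "P (t - l) = P t" "T (t - l) = T t"
  using perP[of t 1] perT[of t 1] perP[of t "-1"] perT[of t "-1"] by auto

lemma der_shift: "((\<lambda>y. P (s + y)) has_vector_derivative T (s + y)) (at y within S)"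
proof -
  have "((P \<circ> (\<lambda>y. s + y)) has_vector_derivative 1 *\<^sub>R T (s + y)) (at y)"
    by (rule vector_diff_chain_at) (auto intro!: derivative_eq_intros der)
  then show ?thesis by (simp add: o_def has_vector_derivative_at_within)
qed

end

text \<open>
  Two unit-speed parametrisations of the same simple closed curve differ by a change of parameter
  with derivative \<open>1\<close> or \<open>-1\<close>. The point \<open>P' 0\<close> is left out because the change of parameter jumps
  there. Its continuity is compactness of the curve; its differentiability comes from comparing the
  two curves through the coordinate in the direction of the tangent.
\<close>

lemma unit_speed_loop_reparametrisation:
  assumes "unit_speed_loop l P T" "unit_speed_loop l' P' T'" "range P = range P'"
  defines "D \<equiv> {0<..<l} - P -` {P' 0}"
  obtains \<phi> \<phi>' where "\<And>t. t \<in> D \<Longrightarrow> \<phi> t \<in> {0<..<l'}" "\<And>t. t \<in> D \<Longrightarrow> P' (\<phi> t) = P t"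
    "\<And>t. t \<in> D \<Longrightarrow> (\<phi> has_real_derivative \<phi>' t) (at t)"
    "\<And>t. t \<in> D \<Longrightarrow> T t = \<phi>' t *\<^sub>R T' (\<phi> t)" "\<And>t. t \<in> D \<Longrightarrow> \<bar>\<phi>' t\<bar> = 1" "open D"
proof -
  interpret A: unit_speed_loop l P T by fact
  interpret B: unit_speed_loop l' P' T' by fact
  have "\<exists>r\<in>{0<..<l'}. P' r = P t" if "t \<in> D" for t
  proof -
    obtain r where r: "P t = P' r" using assms(3) by (metis rangeE rangeI)
    obtain k :: int where k: "r + of_int k * l' \<in> {0..<l'}" using real_mod_period[OF B.period_pos] by blast
    have "P' (r + of_int k * l') = P t" using r B.perP by simp
    moreover have "r + of_int k * l' \<noteq> 0" using calculation that by (auto simp: D_def)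
    ultimately show ?thesis using k by (intro bexI[of _ "r + of_int k * l'"]) auto
  qed
  then obtain \<phi> where \<phi>: "\<And>t. t \<in> D \<Longrightarrow> \<phi> t \<in> {0<..<l'}" "\<And>t. t \<in> D \<Longrightarrow> P' (\<phi> t) = P t" by metis
  have openD: "open D"
    unfolding D_def by (intro open_Diff closed_vimage A.contP) auto
  have cont: "isCont \<phi> t" if t: "t \<in> D" for t
  proof -
    have "\<forall>\<^sub>F y in at t. dist (\<phi> y) (\<phi> t) < e" if "e > 0" for e
    proof -
      define C where "C = {0..l'} - ball (\<phi> t) e"
      have "compact (P' ` C)"
        unfolding C_def by (intro compact_continuous_image B.contP compact_diff) auto
      then have "closed (P' ` C)" by (rule compact_imp_closed)
      moreover have "P t \<notin> P' ` C"
      proof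
        assume "P t \<in> P' ` C"
        then obtain r where r: "r \<in> {0..l'}" "r \<notin> ball (\<phi> t) e" "P' r = P' (\<phi> t)" 
          using \<phi>[OF t] by (auto simp: C_def)
        obtain k :: int where k: "\<phi> t = r + of_int k * l'" using B.injP[OF r(3)] by blast
        have "\<bar>of_int k * l'\<bar> < 1 * l'" using \<phi>[OF t] r k by auto
        then have "k = 0" using B.period_pos by (simp add: abs_mult)
        then show False using k r(2) \<open>e > 0\<close> by simp
      qed
      moreover have "isCont P t" using A.contP[of UNIV] by (simp add: continuous_on_eq_continuous_at)
      ultimately have "\<forall>\<^sub>F y in at t. P y \<in> - P' ` C"
        using topological_tendstoD[of P "P t" "at t" "- P' ` C"] by (auto simp: isCont_def)
      moreover have "\<forall>\<^sub>F y in at t. y \<in> D" using openD t by (simp add: eventually_at_in_open')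
      ultimately show ?thesis
      proof eventually_elim
        case (elim y)
        then have "\<phi> y \<notin> C" using \<phi>(2)[of y] by (metis ComplD imageI)
        then show ?case using \<phi>(1)[OF elim(2)] by (auto simp: C_def dist_commute)
      qed
    qed
    then show ?thesis by (simp add: isCont_def tendsto_iff)
  qed
  define \<phi>' where "\<phi>' t = T t \<bullet> T' (\<phi> t)" for t
  have d: "(\<phi> has_real_derivative \<phi>' t) (at t)" if t: "t \<in> D" for t
  proof -
    define \<tau> where "\<tau> = T' (\<phi> t)"
    have m: "((\<lambda>r. \<tau> \<bullet> P' r) has_real_derivative 1) (at (\<phi> t))"
      using has_real_derivative_inner_right[OF B.der[of "\<phi> t"], of \<tau>] B.unit[of "\<phi> t"]
      by (simp add: \<tau>_def norm_eq_1)
    obtain g where g: "\<And>z. \<tau> \<bullet> P' z - \<tau> \<bullet> P' (\<phi> t) = g z * (z - \<phi> t)" "isCont g (\<phi> t)" "g (\<phi> t) = 1"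
      using m unfolding CARAT_DERIV by blast
    have gc: "((\<lambda>y. g (\<phi> y)) \<longlongrightarrow> 1) (at t)"
      using isCont_o2[OF cont[OF t] g(2)] g(3) by (simp add: isCont_def)
    have "((\<lambda>y. (\<tau> \<bullet> P y - \<tau> \<bullet> P t) / (y - t)) \<longlongrightarrow> \<tau> \<bullet> T t) (at t)"
      using has_real_derivative_inner_right[OF A.der[of t], of \<tau>] by (simp add: has_field_derivative_iff)
    then have "((\<lambda>y. (\<tau> \<bullet> P y - \<tau> \<bullet> P t) / (y - t) / g (\<phi> y)) \<longlongrightarrow> \<tau> \<bullet> T t / 1) (at t)"
      by (intro tendsto_divide gc) auto
    moreover have "\<forall>\<^sub>F y in at t. (\<tau> \<bullet> P y - \<tau> \<bullet> P t) / (y - t) / g (\<phi> y) = (\<phi> y - \<phi> t) / (y - t)"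
    proof -
      have "\<forall>\<^sub>F y in at t. g (\<phi> y) > 0" using gc by (rule order_tendstoD) simp
      moreover have "\<forall>\<^sub>F y in at t. y \<in> D" using openD t by (simp add: eventually_at_in_open')
      ultimately show ?thesis
      proof eventually_elim
        case (elim y)
        have "\<tau> \<bullet> P y - \<tau> \<bullet> P t = g (\<phi> y) * (\<phi> y - \<phi> t)"
          using g(1)[of "\<phi> y"] \<phi>(2)[OF t] \<phi>(2)[OF elim(2)] by simp
        then show ?case using elim by simp
      qed
    qed
    ultimately have "((\<lambda>y. (\<phi> y - \<phi> t) / (y - t)) \<longlongrightarrow> \<tau> \<bullet> T t) (at t)"
      using tendsto_cong by fastforce
    then show ?thesis by (simp add: has_field_derivative_iff \<phi>'_def \<tau>_def inner_commute)
  qed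
  have TT: "T t = \<phi>' t *\<^sub>R T' (\<phi> t)" if t: "t \<in> D" for t
  proof -
    have "((P' \<circ> \<phi>) has_vector_derivative \<phi>' t *\<^sub>R T' (\<phi> t)) (at t)"
      by (rule vector_diff_chain_at) (use d[OF t] B.der in \<open>auto simp: has_real_derivative_iff_has_vector_derivative\<close>)
    moreover have "((P' \<circ> \<phi>) has_vector_derivative T t) (at t)"
      using A.der[of t] t openD \<phi>(2) 
      by (auto intro!: has_vector_derivative_transform_within_open[of P _ t D])
    ultimately show ?thesis by (rule vector_derivative_unique_at[symmetric])
  qed
  have abs1: "\<bar>\<phi>' t\<bar> = 1" if t: "t \<in> D" for t
  proof -
    have "norm (T t) = \<bar>\<phi>' t\<bar> * norm (T' (\<phi> t))" using TT[OF t] by simp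
    then show ?thesis by (simp add: A.unit B.unit)
  qed
  show ?thesis using that \<phi> d TT abs1 openD by blast
qed

text \<open>
  A change of parameter with derivative of absolute value one preserves Lebesgue measure.
\<close>

lemma unit_speed_loop_length_le:
  assumes "unit_speed_loop l P T" "unit_speed_loop l' P' T'" "range P = range P'"
  shows "l \<le> l'"
proof -
  interpret A: unit_speed_loop l P T by fact
  interpret B: unit_speed_loop l' P' T' by fact
  define D where "D = {0<..<l} - P -` {P' 0}"
  obtain \<phi> \<phi>' where \<phi>: "\<And>t. t \<in> D \<Longrightarrow> \<phi> t \<in> {0<..<l'}" "\<And>t. t \<in> D \<Longrightarrow> P' (\<phi> t) = P t"
    and d: "\<And>t. t \<in> D \<Longrightarrow> (\<phi> has_real_derivative \<phi>' t) (at t)"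
    and abs1: "\<And>t. t \<in> D \<Longrightarrow> \<bar>\<phi>' t\<bar> = 1" and openD: "open D"
    unfolding D_def by (rule unit_speed_loop_reparametrisation[OF assms]) blast
  have inj: "t = t'" if tt: "t \<in> {0<..<l}" "t' \<in> {0<..<l}" "P t = P t'" for t t'
  proof -
    obtain k :: int where k: "t' = t + of_int k * l" using A.injP[OF tt(3)] by blast
    have "\<bar>of_int k * l\<bar> < 1 * l" using tt k by auto
    then have "k = 0" using A.period_pos by (simp add: abs_mult)
    then show ?thesis using k by simp
  qed
  have injD: "inj_on \<phi> D"
  proof (rule inj_onI)
    fix t t' assume t: "t \<in> D" "t' \<in> D" "\<phi> t = \<phi> t'"
    then have "P t = P t'" using \<phi>(2)[of t] \<phi>(2)[of t'] by simp
    then show "t = t'" using t by (intro inj) (auto simp: D_def)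
  qed
  have fin: "finite ({0<..<l} \<inter> P -` {P' 0})"
  proof -
    have "{0<..<l} \<inter> P -` {P' 0} \<subseteq> {t}" if "t \<in> {0<..<l} \<inter> P -` {P' 0}" for t
      using inj[of _ t] that by auto
    then show ?thesis by (metis all_not_in_conv finite.emptyI finite_insert finite_subset)
  qed
  have one: "((\<lambda>x. 1::real) has_integral l) D"
  proof (subst has_integral_spike_set_eq)
    show "((\<lambda>x. 1::real) has_integral l) {0..l}"
      using has_integral_const_real[of "1::real" 0 l] A.period_pos by simp
    have n: "negligible ({0, l} \<union> ({0<..<l} \<inter> P -` {P' 0}))" using fin by (intro negligible_finite) auto
    show "negligible {x \<in> D - {0..l}. (1::real) \<noteq> 0}" by (rule negligible_subset[OF n]) (auto simp: D_def)
    show "negligible {x \<in> {0..l} - D. (1::real) \<noteq> 0}" by (rule negligible_subset[OF n]) (auto simp: D_def)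
  qed
  have "D \<in> sets lebesgue" using openD by (simp add: borel_open)
  note cv = has_absolute_integral_change_of_variables_1'[OF this _ injD, of \<phi>' "\<lambda>_. 1" l]
  have "((\<lambda>x. \<bar>\<phi>' x\<bar> * 1) has_integral l) D"
    using one by (rule has_integral_eq[rotated]) (simp add: abs1)
  then have "(\<lambda>x. \<bar>\<phi>' x\<bar> * 1) absolutely_integrable_on D \<and> integral D (\<lambda>x. \<bar>\<phi>' x\<bar> * 1) = l"
    by (auto intro!: nonnegative_absolutely_integrable_1 simp: integral_unique has_integral_integrable)
  then have 2: "(\<lambda>x. 1::real) absolutely_integrable_on \<phi> ` D" "integral (\<phi> ` D) (\<lambda>x. 1::real) = l"
    using cv d has_field_derivative_at_within by blast+
  have "integral (\<phi> ` D) (\<lambda>x. 1::real) \<le> integral {0..l'} (\<lambda>x. 1)"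
  proof (rule integral_subset_le)
    show "\<phi> ` D \<subseteq> {0..l'}" using \<phi>(1) by force
    show "(\<lambda>x. 1::real) integrable_on \<phi> ` D" using 2(1) set_lebesgue_integral_eq_integral(1) by blast
  qed auto
  then show ?thesis using 2(2) B.period_pos by simp
qed

lemma unit_speed_loop_shift:
  assumes "unit_speed_loop l P T"
  shows "unit_speed_loop l (\<lambda>t. P (c + t)) (\<lambda>t. T (c + t))"
proof -
  interpret unit_speed_loop l P T by fact
  show ?thesis
  proof
    show "((\<lambda>t. P (c + t)) has_vector_derivative T (c + t)) (at t)" for t by (rule der_shift)
    show "continuous_on UNIV (\<lambda>t. T (c + t))"
      by (rule continuous_on_compose2[OF contT]) (auto intro!: continuous_intros)
    show "\<exists>k::int. t' = t + of_int k * l" if "P (c + t) = P (c + t')" for t t'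
      using injP[OF that] by (metis add.assoc add_left_cancel)
    show "P (c + (t + of_int k * l)) = P (c + t)" "T (c + (t + of_int k * l)) = T (c + t)" for t k
      using perP[of "c + t" k] perT[of "c + t" k] by (simp_all add: add.assoc)
  qed (auto simp: period_pos unit)
qed

text \<open>
  The base points of both loops are moved away from the point in question, so that the change of
  parameter is defined there.
\<close>

lemma unit_speed_loop_tangent_unique:
  assumes "unit_speed_loop l P T" "unit_speed_loop l' P' T'" "range P = range P'" "P t = P' r"
  shows "T t = T' r \<or> T t = - T' r"
proof -
  interpret B: unit_speed_loop l' P' T' by fact
  define Q Q' where "Q y = P ((t - l / 2) + y)" and "Q' y = P' ((r - l' / 2) + y)" for y
  define U U' where "U y = T ((t - l / 2) + y)" and "U' y = T' ((r - l' / 2) + y)" for y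
  have QU: "unit_speed_loop l Q U" "unit_speed_loop l' Q' U'"
    unfolding Q_def Q'_def U_def U'_def by (intro unit_speed_loop_shift assms)+
  have "surj (\<lambda>y. (c::real) + y)" for c by (rule surjI[of _ "\<lambda>y. y - c"]) simp
  then have "range Q = range P" "range Q' = range P'"
    unfolding Q_def Q'_def by (metis image_image)+
  then have rng: "range Q = range Q'" using assms(3) by simp
  have pos: "0 < l" "0 < l'" using QU by (auto dest: unit_speed_loop.period_pos)
  have inj: "y = z" if yz: "Q' y = Q' z" "\<bar>z - y\<bar> < l'" for y z
  proof -
    obtain k :: int where k: "z = y + of_int k * l'" using unit_speed_loop.injP[OF QU(2) yz(1)] by blast
    then have "\<bar>of_int k\<bar> * l' < 1 * l'" using yz(2) pos by (simp add: abs_mult)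
    then have "\<bar>of_int k\<bar> < (1::real)" using pos by (simp only: mult_less_cancel_right_pos)
    then have "k = 0" by linarith
    then show ?thesis using k by simp
  qed
  have eq: "Q (l / 2) = Q' (l' / 2)" using assms(4) by (simp add: Q_def Q'_def)
  have "Q' (l' / 2) \<noteq> Q' 0" using inj[of "l' / 2" 0] pos by auto
  then have D: "l / 2 \<in> {0<..<l} - Q -` {Q' 0}" using eq pos by auto
  obtain \<phi> \<phi>' where \<phi>: "\<phi> (l / 2) \<in> {0<..<l'}" "Q' (\<phi> (l / 2)) = Q (l / 2)"
    "U (l / 2) = \<phi>' (l / 2) *\<^sub>R U' (\<phi> (l / 2))" "\<bar>\<phi>' (l / 2)\<bar> = 1"
    by (rule unit_speed_loop_reparametrisation[OF QU rng]) (use D in blast)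
  have "\<phi> (l / 2) = l' / 2" using inj[of "\<phi> (l / 2)" "l' / 2"] \<phi>(1,2) eq by (auto simp: abs_less_iff)
  then show ?thesis using \<phi>(3,4) by (auto simp: U_def U'_def abs_if split: if_splits)
qed

lemma constrained_loop_length_unique:
  assumes "constrained_loop \<kappa> s \<gamma>" "constrained_loop \<kappa>' s' \<gamma>'" "\<gamma> ` {0..s} = \<gamma>' ` {0..s'}"
  shows "s = s'"
proof -
  have r: "range (periodic_ext s \<gamma>) = \<gamma> ` {0..s}" "range (periodic_ext s' \<gamma>') = \<gamma>' ` {0..s'}"
    using assms(1,2) by (auto simp: constrained_loop_def intro!: periodic_ext_range)
  show ?thesis
    using unit_speed_loop_length_le unit_speed_loop_periodic_ext[OF assms(1)]
      unit_speed_loop_periodic_ext[OF assms(2)] assms(3) r by (metis order_antisym)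
qed

section \<open>Distant strands of a thick loop\<close>

text \<open>
  A loop of curvature at most one all of whose double normals have length at least one, which is
  thickness \<open>1\<close> in a form that does not mention infima.
\<close>

locale thick_loop = unit_speed_loop +
  assumes lips: "\<And>a b. a \<le> b \<Longrightarrow> b \<le> a + l \<Longrightarrow> norm (T b - T a) \<le> b - a"
    and double_normal: "\<And>a b. P a \<noteq> P b \<Longrightarrow> (P a - P b) \<bullet> T a = 0 \<Longrightarrow> (P a - P b) \<bullet> T b = 0
        \<Longrightarrow> 1 \<le> norm (P a - P b)"
begin

lemma tangent_inner_ge:
  assumes "\<bar>y\<bar> \<le> l"
  shows "1 - y\<^sup>2 / 2 \<le> T s \<bullet> T (s + y)"
proof -
  have "norm (T (s + y) - T s) \<le> \<bar>y\<bar>"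
    using lips[of s "s + y"] lips[of "s + y" s] assms by (cases "y \<ge> 0") (auto simp: norm_minus_commute)
  then have "(norm (T (s + y) - T s))\<^sup>2 \<le> y\<^sup>2" by (metis norm_ge_zero power2_abs power_mono)
  moreover have "(norm (T (s + y) - T s))\<^sup>2 = 2 - 2 * (T s \<bullet> T (s + y))"
    using unit[of s] unit[of "s + y"]
    by (simp add: power2_norm_eq_inner inner_simps inner_commute norm_eq_1)
  ultimately show ?thesis by simp
qed

text \<open>
  Integrating the Lipschitz bound for the tangent: over a short arc the curve advances almost at unit
  speed in its initial direction.
\<close>

lemma chord_inner_ge:
  assumes "0 \<le> x" "x \<le> l"
  shows "x - x ^ 3 / 6 \<le> T s \<bullet> (P (s + x) - P s)" (is ?A)
    and "x - x ^ 3 / 6 \<le> T s \<bullet> (P s - P (s - x))" (is ?B)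
proof -
  have d: "((\<lambda>y. T s \<bullet> P (s + y) - y + y ^ 3 / 6) has_real_derivative T s \<bullet> T (s + y) - 1 + y\<^sup>2 / 2) (at y)" for y
    using has_real_derivative_inner_right[OF der_shift[of s y UNIV], of "T s"]
    by (auto intro!: derivative_eq_intros)
  have m: "\<exists>D. ((\<lambda>y. T s \<bullet> P (s + y) - y + y ^ 3 / 6) has_real_derivative D) (at y) \<and> 0 \<le> D" if "\<bar>y\<bar> \<le> l" for y
    using d tangent_inner_ge[OF that, of s] by fastforce
  show ?A
    using DERIV_nonneg_imp_nondecreasing[OF assms(1) m] assms by (auto simp: inner_simps)
  show ?B
    using DERIV_nonneg_imp_nondecreasing[of "-x" 0, OF _ m] assms by (auto simp: inner_simps)
qed

lemma chord_two_ge: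
  assumes "2 \<le> l"
  shows "1 \<le> norm (P (s + 2) - P s)"
proof -
  have "5 / 3 \<le> T (s + 1) \<bullet> (P (s + 2) - P s)"
    using chord_inner_ge[of 1 "s + 1"] assms by (simp add: inner_simps add.assoc)
  also have "\<dots> \<le> norm (T (s + 1)) * norm (P (s + 2) - P s)" by (rule norm_cauchy_schwarz)
  finally show ?thesis by (simp add: unit)
qed

text \<open>
  A chord orthogonal to the curve at one end cannot span a short arc, because over a short arc the
  curve moves away from the normal plane.
\<close>

lemma normal_chord_arc:
  assumes "0 < x" "x < l" "T s \<bullet> (P (s + x) - P s) = 0"
  shows "2 < x" "x < l - 2"
proof -
  have *: "2 < y" if "0 < y" "y - y ^ 3 / 6 \<le> 0" for y :: real
  proof (rule ccontr)
    assume "\<not> 2 < y"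
    then have "y * y\<^sup>2 \<le> y * 2\<^sup>2" using that by (intro mult_left_mono power_mono) auto
    then show False using that by (simp add: power2_eq_square power3_eq_cube)
  qed
  show "2 < x" using * chord_inner_ge(1)[of x s] assms by auto
  have "P (s - (l - x)) = P (s + x)" using period1(3)[of "s + x"] by (simp add: algebra_simps)
  then have "T s \<bullet> (P s - P (s - (l - x))) = 0" using assms(3) by (simp add: inner_simps)
  then show "x < l - 2" using *[of "l - x"] chord_inner_ge(2)[of "l - x" s] assms by auto
qed

text \<open>
  Strands that are far apart along the loop are at distance at least one. A shortest chord among
  those spanning arcs of length at least two either spans an arc of length exactly two, where the
  curvature bound makes it long, or is a double normal.
\<close>

lemma strands_apart:
  assumes "2 \<le> x" "x \<le> l - 2"
  shows "1 \<le> norm (P (s + x) - P s)"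
proof -
  define g where "g = (\<lambda>z. norm (P (fst z + snd z) - P (fst z)))"
  have "\<exists>z\<in>{0..l} \<times> {2..l - 2}. \<forall>w\<in>{0..l} \<times> {2..l - 2}. g z \<le> g w"
    unfolding g_def
    by (rule continuous_attains_inf)
       (use assms period_pos in \<open>auto intro!: continuous_intros compact_Times continuous_on_compose2[OF contP[of UNIV]]\<close>)
  then obtain z0 where z0: "z0 \<in> {0..l} \<times> {2..l - 2}" "\<And>w. w \<in> {0..l} \<times> {2..l - 2} \<Longrightarrow> g z0 \<le> g w" by blast
  obtain s0 x0 where sx: "z0 = (s0, x0)" by fastforce
  have z: "x0 \<in> {2..l - 2}" "\<And>s x. s \<in> {0..l} \<Longrightarrow> x \<in> {2..l - 2} \<Longrightarrow> norm (P (s0 + x0) - P s0) \<le> norm (P (s + x) - P s)"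
    using z0(1) z0(2)[of "(s, x)" for s x] by (auto simp: sx g_def)
  have min: "norm (P (s0 + x0) - P s0) \<le> norm (P (s + x) - P s)" if "x \<in> {2..l - 2}" for s x
  proof -
    obtain k :: int where k: "s + of_int k * l \<in> {0..<l}" using real_mod_period[OF period_pos] by blast
    have "P (s + of_int k * l + x) = P (s + x)" using perP[of "s + x" k] by (simp add: algebra_simps)
    then show ?thesis using z(2)[of "s + of_int k * l" x] k that perP[of s k] by auto
  qed
  have "1 \<le> norm (P (s0 + x0) - P s0)"
  proof (cases "x0 = 2 \<or> x0 = l - 2")
    case True
    then show ?thesis
    proof
      assume "x0 = 2" then show ?thesis using chord_two_ge[of s0] z(1) by simp
    next
      assume x0: "x0 = l - 2"
      then have "s0 + x0 - l = s0 - 2" by simp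
      then have "P (s0 + x0) = P (s0 - 2)" using period1(3)[of "s0 + x0"] by metis
      then show ?thesis using chord_two_ge[of "s0 - 2"] z(1) x0 by (simp add: norm_minus_commute)
    qed
  next
    case False
    then have x0: "2 < x0" "x0 < l - 2" using z(1) by auto
    define e where "e = min (x0 - 2) (l - 2 - x0)"
    have e: "e > 0" using x0 by (simp add: e_def)
    have sq: "(norm v)\<^sup>2 \<le> (norm w)\<^sup>2" if "norm v \<le> norm w" for v w :: "real^3" using that by (simp add: power_mono)
    let ?v = "P (s0 + x0) - P s0"
    have "2 * (?v \<bullet> T (s0 + x0)) = 0"
    proof (rule DERIV_local_min[OF _ e])
      have "((\<lambda>y. P (s0 + y) - P s0) has_vector_derivative T (s0 + x0)) (at x0)"
        using der_shift[of s0 x0 UNIV] by (auto intro!: derivative_eq_intros)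
      from has_real_derivative_norm_square[OF this]
      show "((\<lambda>y. (P (s0 + y) - P s0) \<bullet> (P (s0 + y) - P s0)) has_real_derivative 2 * (?v \<bullet> T (s0 + x0))) (at x0)" .
      show "\<forall>y. \<bar>x0 - y\<bar> < e \<longrightarrow> ?v \<bullet> ?v \<le> (P (s0 + y) - P s0) \<bullet> (P (s0 + y) - P s0)"
      proof (intro allI impI)
        fix y assume "\<bar>x0 - y\<bar> < e"
        then have "y \<in> {2..l - 2}" unfolding e_def atLeastAtMost_iff by linarith
        from sq[OF min[OF this, of s0]]
        show "?v \<bullet> ?v \<le> (P (s0 + y) - P s0) \<bullet> (P (s0 + y) - P s0)"
          by (simp add: power2_norm_eq_inner)
      qed
    qed
    moreover have "2 * (?v \<bullet> (- T (s0 + 0))) = 0"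
    proof (rule DERIV_local_min[OF _ e])
      have "((\<lambda>y. P (s0 + x0) - P (s0 + y)) has_vector_derivative - T (s0 + 0)) (at 0)"
        using der_shift[of s0 0 UNIV] by (auto intro!: derivative_eq_intros)
      from has_real_derivative_norm_square[OF this]
      show "((\<lambda>y. (P (s0 + x0) - P (s0 + y)) \<bullet> (P (s0 + x0) - P (s0 + y))) has_real_derivative 2 * (?v \<bullet> (- T (s0 + 0)))) (at 0)" by simp
      show "\<forall>y. \<bar>0 - y\<bar> < e \<longrightarrow> (P (s0 + x0) - P (s0 + 0)) \<bullet> (P (s0 + x0) - P (s0 + 0)) \<le> (P (s0 + x0) - P (s0 + y)) \<bullet> (P (s0 + x0) - P (s0 + y))"
      proof (intro allI impI)
        fix y assume "\<bar>0 - y\<bar> < e"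
        then have "x0 - y \<in> {2..l - 2}" unfolding e_def atLeastAtMost_iff by linarith
        from sq[OF min[OF this, of "s0 + y"]]
        show "(P (s0 + x0) - P (s0 + 0)) \<bullet> (P (s0 + x0) - P (s0 + 0)) \<le> (P (s0 + x0) - P (s0 + y)) \<bullet> (P (s0 + x0) - P (s0 + y))"
          by (simp add: power2_norm_eq_inner)
      qed
    qed
    moreover have "P (s0 + x0) \<noteq> P s0"
    proof
      assume "P (s0 + x0) = P s0"
      then obtain k :: int where k: "s0 + x0 = s0 + of_int k * l" using injP[of s0 "s0 + x0"] by metis
      have kl: "0 < of_int k * l" "of_int k * l < 1 * l" using k x0 period_pos by linarith+
      have "0 < k" using kl(1) period_pos by (simp add: zero_less_mult_iff)
      moreover have "k < 1" using kl(2) period_pos by (simp add: mult_less_cancel_right_pos)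
      ultimately show False by simp
    qed
    ultimately show ?thesis by (intro double_normal) auto
  qed
  also have "\<dots> \<le> norm (P (s + x) - P s)" using assms by (intro min) auto
  finally show ?thesis .
qed

end

lemma thick_loop_periodic_ext:
  assumes C: "constrained_loop 1 s \<gamma>" and R: "1/2 \<le> thickness_radius s \<gamma>"
  shows "thick_loop s (periodic_ext s \<gamma>) (periodic_ext s (tangent s \<gamma>))"
proof -
  interpret unit_speed_loop s "periodic_ext s \<gamma>" "periodic_ext s (tangent s \<gamma>)"
    by (rule unit_speed_loop_periodic_ext[OF C])
  have s: "0 < s" "tangent s \<gamma> 0 = tangent s \<gamma> s" using C by (auto simp: constrained_loop_def)
  show ?thesis
  proof
    show "norm (periodic_ext s (tangent s \<gamma>) b - periodic_ext s (tangent s \<gamma>) a) \<le> b - a"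
      if "a \<le> b" "b \<le> a + s" for a b
      using periodic_ext_lipschitz[OF s, of 1 a b] constrained_tangent_lipschitz[OF C] that by auto
    show "1 \<le> norm (periodic_ext s \<gamma> a - periodic_ext s \<gamma> b)"
      if "periodic_ext s \<gamma> a \<noteq> periodic_ext s \<gamma> b"
        "(periodic_ext s \<gamma> a - periodic_ext s \<gamma> b) \<bullet> periodic_ext s (tangent s \<gamma>) a = 0"
        "(periodic_ext s \<gamma> a - periodic_ext s \<gamma> b) \<bullet> periodic_ext s (tangent s \<gamma>) b = 0" for a b
    proof -
      have i: "s * frac (t / s) \<in> {0..s}" for t using periodic_ext_arg[OF s(1), of t]
        unfolding atLeastLessThan_iff atLeastAtMost_iff by linarith
      have "1 \<le> R2 s \<gamma>" using R by (simp add: thickness_radius_def)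
      also have "R2 s \<gamma> \<le> norm (periodic_ext s \<gamma> a - periodic_ext s \<gamma> b)"
        unfolding R2_def
        by (rule cInf_lower) (use that i in \<open>auto simp: periodic_ext_def intro!: bdd_belowI[of _ 0]\<close>)
      finally show ?thesis .
    qed
  qed
qed

text \<open>
  The thickness of a knot is witnessed by some parametrisation, whereas an isotopy supplies another
  one. The transfer is possible because tangent lines depend on the point set only.
\<close>

lemma thick_loop_of_thick_knot:
  assumes C: "constrained_loop 1 s \<gamma>" and K: "thick_knot (1/2) (\<gamma> ` {0..s})"
  shows "thick_loop s (periodic_ext s \<gamma>) (periodic_ext s (tangent s \<gamma>))"
proof -
  obtain s' \<gamma>' where C': "constrained_loop 1 s' \<gamma>'" "\<gamma> ` {0..s} = \<gamma>' ` {0..s'}" "1/2 \<le> thickness_radius s' \<gamma>'"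
    using K unfolding thick_knot_def by blast
  have "s = s'" by (rule constrained_loop_length_unique[OF C C'(1,2)])
  let ?P = "periodic_ext s \<gamma>" and ?T = "periodic_ext s (tangent s \<gamma>)"
  let ?P' = "periodic_ext s \<gamma>'" and ?T' = "periodic_ext s (tangent s \<gamma>')"
  interpret A: unit_speed_loop s ?P ?T by (rule unit_speed_loop_periodic_ext[OF C])
  interpret B: thick_loop s ?P' ?T' using thick_loop_periodic_ext C' \<open>s = s'\<close> by blast
  have s: "0 < s" "tangent s \<gamma> 0 = tangent s \<gamma> s" using C by (auto simp: constrained_loop_def)
  have rng: "range ?P = range ?P'"
    using periodic_ext_range[of s \<gamma>] periodic_ext_range[of s \<gamma>'] C C' \<open>s = s'\<close> by (simp add: constrained_loop_def)
  show ?thesis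
  proof
    show "norm (?T b - ?T a) \<le> b - a" if "a \<le> b" "b \<le> a + s" for a b
      using periodic_ext_lipschitz[OF s, of 1 a b] constrained_tangent_lipschitz[OF C] that by auto
    show "1 \<le> norm (?P a - ?P b)"
      if dn: "?P a \<noteq> ?P b" "(?P a - ?P b) \<bullet> ?T a = 0" "(?P a - ?P b) \<bullet> ?T b = 0" for a b
    proof -
      obtain a' b' where ab: "?P a = ?P' a'" "?P b = ?P' b'" using rng by (metis rangeE rangeI)
      have "?T a = ?T' a' \<or> ?T a = - ?T' a'" "?T b = ?T' b' \<or> ?T b = - ?T' b'"
        using unit_speed_loop_tangent_unique[OF A.unit_speed_loop_axioms B.unit_speed_loop_axioms rng] ab by auto
      then show ?thesis using B.double_normal[of a' b'] dn ab by auto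
    qed
  qed
qed

section \<open>Rigidity of a loop around two strands\<close>

context unit_speed_loop begin

text \<open>
  A loop that meets a line through \<open>p\<close> and \<open>q\<close> beyond \<open>q\<close> and beyond \<open>p\<close>, and keeps distance at
  least one from both points, needs time \<open>\<pi> + \<rho>\<close> in between: a quarter turn around \<open>q\<close> until it reaches the
  plane through \<open>q\<close> orthogonal to the line, the distance \<open>\<rho>\<close> to the parallel plane through \<open>p\<close>, and
  a quarter turn around \<open>p\<close>.
\<close>

lemma half_turn_time:
  assumes ab: "a \<le> b" and e: "norm e = 1" and rho: "q = p + \<rho> *\<^sub>R e" "0 < \<rho>"
    and Pa: "P a = q + \<mu> *\<^sub>R e" "0 < \<mu>" and Pb: "P b = p - \<nu> *\<^sub>R e" "0 < \<nu>"
    and far: "\<And>t. 1 \<le> norm (P t - p)" "\<And>t. 1 \<le> norm (P t - q)"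
  obtains c d where "a \<le> c" "c \<le> d" "d \<le> b" "e \<bullet> (P c - q) = 0" "e \<bullet> (P d - p) = 0"
    "pi / 2 \<le> c - a" "\<rho> \<le> d - c" "pi / 2 \<le> b - d"
proof -
  have ee: "e \<bullet> e = 1" using e by (simp add: norm_eq_1)
  have cont: "continuous_on {x..y} (\<lambda>t. e \<bullet> (P t - z))" for x y z
    by (intro continuous_intros contP)
  have "e \<bullet> (P a - q) > 0" "e \<bullet> (P b - q) < 0"
    using Pa Pb rho ee by (simp_all add: inner_simps)
  then obtain c where c: "a \<le> c" "c \<le> b" "e \<bullet> (P c - q) = 0"
    using IVT2'[of "\<lambda>t. e \<bullet> (P t - q)" b 0 a, OF _ _ ab cont] less_imp_le by meson
  have "e \<bullet> (P c - p) > 0" "e \<bullet> (P b - p) < 0"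
    using Pb c rho ee by (simp_all add: inner_simps)
  then obtain d where d: "c \<le> d" "d \<le> b" "e \<bullet> (P d - p) = 0"
    using IVT2'[of "\<lambda>t. e \<bullet> (P t - p)" b 0 c, OF _ _ c(2) cont] less_imp_le by meson
  have der': "((\<lambda>t. P t - z) has_vector_derivative T t) (at t within S)" for t z S
    using has_vector_derivative_diff[OF has_vector_derivative_at_within[OF der[of t], of S]
        has_vector_derivative_const[of z]] by simp
  have 1: "pi / 2 \<le> c - a"
    by (rule quarter_turn_time[OF c(1) _ der'[where z = q]]) (use c(3) Pa far unit in auto)
  have 2: "pi / 2 \<le> b - d"
    by (rule quarter_turn_time[OF d(2) _ der'[where z = p]]) (use d(3) Pb far unit in \<open>auto simp: inner_commute\<close>)
  have 3: "\<rho> \<le> d - c"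
  proof -
    have "norm (P d - P c) \<le> 1 * (d - c)"
      by (rule norm_diff_le_of_derivative_bound[of "{}" c d P 1 T]) (use d der unit contP in auto)
    moreover have "e \<bullet> (P d - P c) = - \<rho>" using c(3) d(3) rho ee by (simp add: inner_simps)
    then have "\<rho> \<le> norm e * norm (P d - P c)" using Cauchy_Schwarz_ineq2[of e "P d - P c"] rho by simp
    ultimately show ?thesis using e by simp
  qed
  show ?thesis using that c d 1 2 3 by blast
qed

text \<open>
  If no time is lost, both quarter turns are arcs of unit circles. The middle part has no time for a
  sideways motion, so it is a straight segment and the two quarter circles lie in one plane.
\<close>

lemma half_turn_rigid:
  assumes ab: "b - a \<le> pi + \<rho>" and e: "norm e = 1" and rho: "q = p + \<rho> *\<^sub>R e" "0 < \<rho>"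
    and Pa: "P a = q + \<mu> *\<^sub>R e" "0 < \<mu>" and Pb: "P b = p - \<nu> *\<^sub>R e" "0 < \<nu>" "a \<le> b"
    and far: "\<And>t. 1 \<le> norm (P t - p)" "\<And>t. 1 \<le> norm (P t - q)"
  shows "P a = q + e" "P b = p - e" "\<exists>c. P c = q + T a" "\<exists>d. P d = p + T a" "T b = - T a"
proof -
  obtain c d where cd: "a \<le> c" "c \<le> d" "d \<le> b" "e \<bullet> (P c - q) = 0" "e \<bullet> (P d - p) = 0"
    "pi / 2 \<le> c - a" "\<rho> \<le> d - c" "pi / 2 \<le> b - d"
    using half_turn_time[OF Pb(3) e rho Pa Pb(1,2) far] by blast
  have eq: "c - a = pi / 2" "d - c = \<rho>" "b - d = pi / 2" using cd ab by linarith+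
  have ee: "e \<bullet> e = 1" using e by (simp add: norm_eq_1)
  have der': "((\<lambda>t. P t - z) has_vector_derivative T t) (at t within S)" for t z S
    using has_vector_derivative_diff[OF has_vector_derivative_at_within[OF der[of t], of S]
        has_vector_derivative_const[of z]] by simp
  define f g where "f = (P c - q) /\<^sub>R norm (P c - q)" and "g = (P d - p) /\<^sub>R norm (P d - p)"
  have arc1: "P t - q = cos (t - a) *\<^sub>R e + sin (t - a) *\<^sub>R f" if "t \<in> {a..c}" for t
    using quarter_turn_rigid[OF eq(1) _ that der'[where z = q]] cd(4) Pa far(2) unit e by (simp add: f_def)
  have arc2: "P t - p = cos (t - d) *\<^sub>R g + sin (t - d) *\<^sub>R (- e)" if "t \<in> {d..b}" for t
    using quarter_turn_rigid[OF eq(3) _ that der'[where z = p]] cd(5) Pb(1,2) far(1) unit e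
    by (simp add: g_def inner_commute)
  have Pc: "P c = q + f" using arc1[of c] eq cd by (simp add: algebra_simps)
  have Pd: "P d = p + g" using arc2[of d] cd by (simp add: algebra_simps)
  show "P a = q + e" using arc1[of a] cd by (simp add: algebra_simps)
  show "P b = p - e" using arc2[of b] cd eq by (simp add: algebra_simps)
  have "f = g"
  proof -
    have "norm (P d - P c) \<le> 1 * (d - c)"
      by (rule norm_diff_le_of_derivative_bound[of "{}" c d P 1 T]) (use cd der unit contP in auto)
    then have "(norm (P d - P c))\<^sup>2 \<le> \<rho>\<^sup>2" using eq by (simp add: power_mono)
    moreover have "P d - P c = (g - f) - \<rho> *\<^sub>R e" using Pc Pd rho by simp
    moreover have "e \<bullet> (g - f) = 0" using cd(4,5) by (simp add: f_def g_def inner_simps)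
    then have "(norm ((g - f) - \<rho> *\<^sub>R e))\<^sup>2 = (g - f) \<bullet> (g - f) + \<rho>\<^sup>2"
      unfolding power2_norm_eq_inner inner_diff_left[of "g - f"] inner_diff_right[of _ "g - f"]
      using ee by (simp add: inner_commute power2_eq_square)
    ultimately have "(g - f) \<bullet> (g - f) \<le> 0" by simp
    then have "(norm (g - f))\<^sup>2 \<le> 0" by (simp only: power2_norm_eq_inner)
    then show ?thesis by simp
  qed
  have ac: "a < c" "d < b" using eq pi_gt_zero by linarith+
  have "T a = f"
  proof -
    have "((\<lambda>t. cos (t - a) *\<^sub>R e + sin (t - a) *\<^sub>R f) has_vector_derivative f) (at a within cbox a c)"
      by (auto intro!: derivative_eq_intros)
    then have "((\<lambda>t. P t - q) has_vector_derivative f) (at a within cbox a c)"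
      by (rule has_vector_derivative_transform[rotated 2]) (use arc1 ac in auto)
    then show ?thesis
      using vector_derivative_unique_within_closed_interval[OF ac(1) _ der'[where z = q]] ac by simp
  qed
  moreover have "T b = - g"
  proof -
    have sc: "sin (b - d) = 1" "cos (b - d) = 0" by (simp_all only: eq(3) sin_pi_half cos_pi_half)
    have "((\<lambda>t. cos (t - d) *\<^sub>R g + sin (t - d) *\<^sub>R (- e)) has_vector_derivative - g) (at b within cbox d b)"
      using sc by (auto intro!: derivative_eq_intros)
    then have "((\<lambda>t. P t - p) has_vector_derivative - g) (at b within cbox d b)"
      by (rule has_vector_derivative_transform[rotated 2]) (use arc2 ac in auto)
    then show ?thesis
      using vector_derivative_unique_within_closed_interval[OF ac(2) _ der'[where z = p]] ac by simp
  qed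
  ultimately show "T b = - T a" "\<exists>c. P c = q + T a" "\<exists>d. P d = p + T a"
    using \<open>f = g\<close> Pc Pd by auto
qed

end

text \<open>
  The loop \<open>A\<close> is half-way around, and tight against, two points of \<open>B\<close> at distance one: it passes
  through the two tips and through two more points of the stadium with foci \<open>B s1\<close> and \<open>B s2\<close>, with
  tangents parallel at the tips. Only finitely many closed conditions are recorded, so that the
  relation passes to limits. As long as the curves keep distance one from each other, these conditions
  determine the directions of all tangents involved.
\<close>

definition gripped :: "(real \<Rightarrow> real^3) \<Rightarrow> (real \<Rightarrow> real^3) \<Rightarrow> (real \<Rightarrow> real^3) \<Rightarrow> bool" where
  "gripped A TA B \<longleftrightarrow> (\<exists>t0 t1 t2 t3 s1 s2. norm (B s2 - B s1) = 1 \<and>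
     A t0 = B s2 + (B s2 - B s1) \<and> A t1 = B s1 - (B s2 - B s1) \<and>
     A t2 = B s2 + TA t0 \<and> A t3 = B s1 + TA t0 \<and> (TA t1 \<bullet> TA t0)\<^sup>2 = 1)"

text \<open>
  The key estimate. A line that meets, in this order, \<open>A\<close>, two points of \<open>B\<close> at distance at least
  one, and \<open>A\<close> again, forces \<open>A\<close> to have length at least \<open>2 * \<pi> + 2\<close>. Since \<open>A\<close> is not longer
  than that, it is the stadium around these two points, and their distance is exactly one.
\<close>

lemma gripped_of_line:
  assumes A: "unit_speed_loop l A TA" and l: "l \<le> 2 * pi + 2"
    and pq: "1 \<le> norm (B s2 - B s1)"
    and far: "\<And>t s. 1 \<le> norm (A t - B s)"
    and t0: "A t0 = B s1 + \<mu> *\<^sub>R (B s2 - B s1)" "1 < \<mu>"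
    and t1: "A t1 = B s2 + \<nu> *\<^sub>R (B s1 - B s2)" "1 < \<nu>"
  shows "gripped A TA B"
proof -
  interpret unit_speed_loop l A TA by fact
  define p q \<rho> e where "p = B s1" "q = B s2" "\<rho> = norm (B s2 - B s1)" "e = (q - p) /\<^sub>R \<rho>"
  note defs = p_q_\<rho>_e_def
  have \<rho>: "1 \<le> \<rho>" "norm e = 1" "q = p + \<rho> *\<^sub>R e" "p = q + \<rho> *\<^sub>R (- e)"
  proof -
    have "norm (B s2 - B s1) \<noteq> 0" using pq by linarith
    then show "1 \<le> \<rho>" "norm e = 1" "q = p + \<rho> *\<^sub>R e" "p = q + \<rho> *\<^sub>R (- e)"
      using pq by (simp_all add: defs)
  qed
  have qp: "B s2 - B s1 = \<rho> *\<^sub>R e" "B s1 - B s2 = - (\<rho> *\<^sub>R e)" using \<rho>(3) by (simp_all add: defs(1,2) flip: defs(3,4))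
  have At0: "A t0 = q + ((\<mu> - 1) * \<rho>) *\<^sub>R e"
    using t0(1)[unfolded qp, folded defs(1)] \<rho>(3) by (simp add: algebra_simps)
  have At1': "A t1 = p - ((\<nu> - 1) * \<rho>) *\<^sub>R e"
    using t1(1)[unfolded qp, folded defs(2)] \<rho>(3) by (simp add: algebra_simps)
  obtain k :: int where k: "t1 - t0 + of_int k * l \<in> {0..<l}" using real_mod_period[OF period_pos] by blast
  define t1' where "t1' = t1 + of_int k * l"
  have t1': "t0 \<le> t1'" "t1' \<le> t0 + l" using k by (auto simp: t1'_def)
  have At1: "A t1' = p - ((\<nu> - 1) * \<rho>) *\<^sub>R e" using At1' perP by (simp add: t1'_def)
  have pos: "0 < (\<mu> - 1) * \<rho>" "0 < (\<nu> - 1) * \<rho>" using t0 t1 \<rho> by auto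
  have fp: "\<And>t. 1 \<le> norm (A t - p)" "\<And>t. 1 \<le> norm (A t - q)" using far by (auto simp: defs)
  have "0 < \<rho>" using \<rho> by simp
  have "pi + \<rho> \<le> t1' - t0"
    by (rule half_turn_time[OF t1'(1) \<rho>(2,3) \<open>0 < \<rho>\<close> At0 pos(1) At1 pos(2) fp]) linarith
  moreover have "pi + \<rho> \<le> t0 + l - t1'"
  proof -
    have "norm (- e) = 1" using \<rho>(2) by simp
    moreover have "A t1' = p + ((\<nu> - 1) * \<rho>) *\<^sub>R (- e)" "A (t0 + l) = q - ((\<mu> - 1) * \<rho>) *\<^sub>R (- e)"
      using At1 At0 period1(1)[of t0] by simp_all
    ultimately show ?thesis
      by (rule half_turn_time[OF t1'(2) _ \<rho>(4) \<open>0 < \<rho>\<close> _ pos(2) _ pos(1) fp(2,1)]) linarith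
  qed
  ultimately have le: "t1' - t0 \<le> pi + \<rho>" "\<rho> = 1" using l \<rho>(1) by linarith+
  note R = half_turn_rigid[OF le(1) \<rho>(2,3) \<open>0 < \<rho>\<close> At0 pos(1) At1 pos(2) t1'(1) fp]
  obtain c d where cd: "A c = q + TA t0" "A d = p + TA t0" using R by blast
  have Te: "TA t1 = - TA t0" using R(5) perT by (simp add: t1'_def)
  have T1: "(TA t1 \<bullet> TA t0)\<^sup>2 = 1" using unit[of t0] by (simp add: Te norm_eq_1)
  have "A t1 = A t1'" using perP by (simp add: t1'_def)
  moreover have "e = B s2 - B s1" using le(2) by (simp add: defs)
  ultimately have "A t0 = B s2 + (B s2 - B s1)" "A t1 = B s1 - (B s2 - B s1)"
    "A c = B s2 + TA t0" "A d = B s1 + TA t0" "norm (B s2 - B s1) = 1"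
    using R(1,2) cd le(2) by (simp_all only: defs(1,2,3))
  then show ?thesis unfolding gripped_def using T1 by blast
qed

lemma nearest_points_orthogonal:
  assumes A: "unit_speed_loop l A TA" and B: "unit_speed_loop m B TB"
    and far: "\<And>t s. 1 \<le> norm (A t - B s)" and 1: "norm (A t0 - B s0) = 1"
  shows "(A t0 - B s0) \<bullet> TA t0 = 0" "(A t0 - B s0) \<bullet> TB s0 = 0"
proof -
  have sq: "(A t0 - B s0) \<bullet> (A t0 - B s0) \<le> (A t - B s) \<bullet> (A t - B s)" for t s
    using far[of t s] 1 by (simp add: power2_norm_eq_inner[symmetric] power_mono)
  have d: "((\<lambda>t. A t - B s0) has_vector_derivative TA t0) (at t0)"
    "((\<lambda>s. A t0 - B s) has_vector_derivative - TB s0) (at s0)"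
    using unit_speed_loop.der[OF A] unit_speed_loop.der[OF B] by (auto intro!: derivative_eq_intros)
  have "2 * ((A t0 - B s0) \<bullet> TA t0) = 0"
    by (rule DERIV_local_min[OF has_real_derivative_norm_square[OF d(1)], of 1]) (use sq in auto)
  moreover have "2 * ((A t0 - B s0) \<bullet> (- TB s0)) = 0"
    by (rule DERIV_local_min[OF has_real_derivative_norm_square[OF d(2)], of 1]) (use sq in auto)
  ultimately show "(A t0 - B s0) \<bullet> TA t0 = 0" "(A t0 - B s0) \<bullet> TB s0 = 0" by auto
qed

lemma orthonormal_expansion_3:
  fixes e f g v :: "real^3"
  assumes n: "norm e = 1" "norm f = 1" "norm g = 1" and o: "e \<bullet> f = 0" "e \<bullet> g = 0" "f \<bullet> g = 0"
  shows "v = (v \<bullet> e) *\<^sub>R e + (v \<bullet> f) *\<^sub>R f + (v \<bullet> g) *\<^sub>R g"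
proof -
  have d: "e \<noteq> f" "e \<noteq> g" "f \<noteq> g" using n o by (auto simp: norm_eq_1)
  have "pairwise orthogonal {e, f, g}" using o by (auto simp: pairwise_def orthogonal_def inner_commute)
  then have "independent {e, f, g}" by (rule pairwise_orthogonal_independent) (use n in auto)
  then have span: "UNIV \<subseteq> span {e, f, g}" using d by (intro card_ge_dim_independent) auto
  define w where "w = v - ((v \<bullet> e) *\<^sub>R e + (v \<bullet> f) *\<^sub>R f + (v \<bullet> g) *\<^sub>R g)"
  have "orthogonal w y" if "y \<in> {e, f, g}" for y
    using that n o by (auto simp: w_def orthogonal_def inner_simps inner_commute norm_eq_1)
  then have "orthogonal w w" using orthogonal_to_span[of w "{e, f, g}" w] span by blast
  then show ?thesis by (simp add: w_def orthogonal_self)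
qed

lemma has_derivative_curve_compose:
  assumes "(P has_vector_derivative T) (at t)" "(g has_derivative g') (at x within S)" "g x = t"
  shows "((\<lambda>x. P (g x)) has_derivative (\<lambda>h. g' h *\<^sub>R T)) (at x within S)"
  using has_derivative_compose[OF assms(2), of P "\<lambda>h. h *\<^sub>R T"] assms(1,3)
  by (simp add: has_vector_derivative_def)

lemma unit_parallel:
  fixes a b :: "'a::real_inner"
  assumes "norm a = 1" "norm b = 1" "(a \<bullet> b)\<^sup>2 = 1"
  shows "a = (a \<bullet> b) *\<^sub>R b"
proof -
  have "(norm (a - (a \<bullet> b) *\<^sub>R b))\<^sup>2 = 0"
    using assms unfolding power2_norm_eq_inner by (simp add: inner_simps inner_commute norm_eq_1 power2_eq_square)
  then show ?thesis by simp
qed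

text \<open>
  Zeros of this map are lines as in the key estimate: both components vanish exactly if \<open>A t0\<close> and
  \<open>A t1\<close> lie on the line through \<open>B s1\<close> and \<open>B s2\<close>, at the affine parameters \<open>\<mu>\<close> and \<open>1 - \<nu>\<close>.
\<close>

definition line_gap :: "(real \<Rightarrow> real^3) \<Rightarrow> (real \<Rightarrow> real^3) \<Rightarrow> real \<times> real \<times> real \<times> real \<times> real \<times> real \<Rightarrow> (real^3) \<times> (real^3)" where
  "line_gap A B = (\<lambda>(t0, t1, s1, s2, \<mu>, \<nu>).
     (A t0 - B s1 - \<mu> *\<^sub>R (B s2 - B s1), A t1 - B s2 - \<nu> *\<^sub>R (B s1 - B s2)))"

lemma line_gap_close:
  assumes "\<And>t. norm (A' t - A t) \<le> \<epsilon>" "\<And>s. norm (B' s - B s) \<le> \<epsilon>" "\<bar>\<mu>\<bar> \<le> 3" "\<bar>\<nu>\<bar> \<le> 3" "0 \<le> \<epsilon>"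
  shows "norm (line_gap A' B' (t0, t1, s1, s2, \<mu>, \<nu>) - line_gap A B (t0, t1, s1, s2, \<mu>, \<nu>)) \<le> 16 * \<epsilon>"
proof -
  have *: "norm ((A' t - B' s - \<mu> *\<^sub>R (B' s' - B' s)) - (A t - B s - \<mu> *\<^sub>R (B s' - B s))) \<le> 8 * \<epsilon>"
    if "\<bar>\<mu>\<bar> \<le> 3" for t s s' \<mu>
  proof -
    have "(A' t - B' s - \<mu> *\<^sub>R (B' s' - B' s)) - (A t - B s - \<mu> *\<^sub>R (B s' - B s))
       = (A' t - A t) - (B' s - B s) - \<mu> *\<^sub>R ((B' s' - B s') - (B' s - B s))"
      by (simp add: algebra_simps)
    also have "norm \<dots> \<le> norm (A' t - A t) + norm (B' s - B s) + \<bar>\<mu>\<bar> * (norm (B' s' - B s') + norm (B' s - B s))"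
      by (smt (verit) norm_triangle_ineq4 norm_scaleR mult_left_mono abs_ge_zero)
    also have "\<dots> \<le> \<epsilon> + \<epsilon> + 3 * (\<epsilon> + \<epsilon>)"
      using assms that by (intro add_mono mult_mono) auto
    finally show ?thesis by simp
  qed
  show ?thesis
    unfolding line_gap_def
    using *[OF assms(3), of t0 s1 s2] *[OF assms(4), of t1 s2 s1]
      norm_Pair_le[of "(A' t0 - B' s1 - \<mu> *\<^sub>R (B' s2 - B' s1)) - (A t0 - B s1 - \<mu> *\<^sub>R (B s2 - B s1))"
         "(A' t1 - B' s2 - \<nu> *\<^sub>R (B' s1 - B' s2)) - (A t1 - B s2 - \<nu> *\<^sub>R (B s1 - B s2))"]
    by simp
qed

lemma continuous_on_line_gap:
  assumes "continuous_on UNIV A" "continuous_on UNIV B"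
  shows "continuous_on UNIV (line_gap A B)"
  unfolding line_gap_def case_prod_unfold
  by (intro continuous_intros continuous_on_compose2[OF assms(1)] continuous_on_compose2[OF assms(2)]) auto

text \<open>
  The chord \<open>e\<close> and the tangent \<open>f\<close> of \<open>A\<close> at the first tip are orthonormal, and the distance
  from \<open>A\<close> to \<open>B\<close> is minimal at the recorded points, so both strands of \<open>B\<close> are orthogonal to the
  plane spanned by \<open>e\<close> and \<open>f\<close>. Moving the points along \<open>A\<close> changes the gap in direction \<open>f\<close>,
  moving the strands changes it in direction \<open>e \<times> f\<close>, and \<open>\<mu>\<close>, \<open>\<nu>\<close> change it in direction \<open>e\<close>. The
  strands act through the matrix with rows \<open>(1, -2)\<close> and \<open>(-2, 1)\<close> up to signs, which is invertible.
\<close>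

lemma line_gap_transversal:
  assumes A: "unit_speed_loop l A TA" and B: "unit_speed_loop m B TB"
    and far: "\<And>t s. 1 \<le> norm (A t - B s)"
    and e1: "norm (B s2 - B s1) = 1"
    and t0: "A t0 = B s2 + (B s2 - B s1)" and t1: "A t1 = B s1 - (B s2 - B s1)"
    and t2: "A t2 = B s2 + TA t0" and t3: "A t3 = B s1 + TA t0" and par: "(TA t1 \<bullet> TA t0)\<^sup>2 = 1"
  shows "\<exists>J. (line_gap A B has_derivative J) (at (t0, t1, s1, s2, 2, 2)) \<and> surj J"
    and "TB s1 \<bullet> (B s2 - B s1) = 0"
proof -
  note dA = unit_speed_loop.der[OF A] and dB = unit_speed_loop.der[OF B]
  note uA = unit_speed_loop.unit[OF A] and uB = unit_speed_loop.unit[OF B]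
  define e f g where "e = B s2 - B s1" "f = TA t0" "g = TB s1"
  note defs = e_f_g_def
  have ef: "norm e = 1" "norm f = 1" "norm g = 1" using e1 uA uB by (auto simp: defs)
  have o: "e \<bullet> f = 0" "e \<bullet> TB s2 = 0"
    using nearest_points_orthogonal[OF A B far, of t0 s2] t0 e1 by (auto simp: defs)
  have o2: "f \<bullet> TB s2 = 0" using nearest_points_orthogonal(2)[OF A B far, of t2 s2] t2 uA by (auto simp: defs)
  have o3: "e \<bullet> g = 0" using nearest_points_orthogonal(2)[OF A B far, of t1 s1] t1 e1 
    by (auto simp: defs inner_simps norm_minus_commute)
  have o4: "f \<bullet> g = 0" using nearest_points_orthogonal(2)[OF A B far, of t3 s1] t3 uA by (auto simp: defs)
  note expand = orthonormal_expansion_3[OF ef o(1) o3 o4]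
  show "TB s1 \<bullet> (B s2 - B s1) = 0" using o3 by (simp add: defs inner_commute)
  define \<sigma> where "\<sigma> = TB s2 \<bullet> g"
  have g2: "TB s2 = \<sigma> *\<^sub>R g" using expand[of "TB s2"] o o2 by (simp add: \<sigma>_def inner_commute)
  have \<sigma>: "\<sigma> * \<sigma> = 1"
  proof -
    have "1 = \<bar>\<sigma>\<bar>" using uB[of s2] ef(3) unfolding g2 by simp
    then show ?thesis by (metis abs_mult_self_eq mult_1)
  qed
  define \<eta> where "\<eta> = TA t1 \<bullet> f"
  have f1: "TA t1 = \<eta> *\<^sub>R f" using unit_parallel[OF uA uA par] by (simp add: \<eta>_def defs)
  have \<eta>: "\<eta> * \<eta> = 1" using par by (simp add: \<eta>_def defs power2_eq_square)
  define J where "J = (\<lambda>(h1, h2, h3, h4, h5, h6).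
     (h1 *\<^sub>R TA t0 - h3 *\<^sub>R TB s1 - (2 *\<^sub>R (h4 *\<^sub>R TB s2 - h3 *\<^sub>R TB s1) + h5 *\<^sub>R (B s2 - B s1)),
      h2 *\<^sub>R TA t1 - h4 *\<^sub>R TB s2 - (2 *\<^sub>R (h3 *\<^sub>R TB s1 - h4 *\<^sub>R TB s2) + h6 *\<^sub>R (B s1 - B s2))))"
  have "(line_gap A B has_derivative J) (at (t0, t1, s1, s2, 2, 2))"
    unfolding line_gap_def J_def case_prod_unfold
    by (rule derivative_eq_intros has_derivative_curve_compose[OF dA] has_derivative_curve_compose[OF dB] | simp)+
  moreover have "surj J"
  proof (rule surjI)
    define G where "G = (\<lambda>(v, w). (v \<bullet> f, (w \<bullet> f) * \<eta>, - (v \<bullet> g + 2 * (w \<bullet> g)) / 3,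
      \<sigma> * (- (2 * (v \<bullet> g) + w \<bullet> g) / 3), - (v \<bullet> e), w \<bullet> e))"
    fix x :: "(real^3) \<times> (real^3)"
    obtain v w where x: "x = (v, w)" by fastforce
    have "J (G x) = ((v \<bullet> e) *\<^sub>R e + (v \<bullet> f) *\<^sub>R f + (v \<bullet> g) *\<^sub>R g, (w \<bullet> e) *\<^sub>R e + (w \<bullet> f) *\<^sub>R f + (w \<bullet> g) *\<^sub>R g)"
    proof -
      have s: "TA t0 = f" "B s1 - B s2 = - e" "B s2 - B s1 = e" "TB s1 = g" by (simp_all add: defs)
      have r: "(\<sigma> * y) *\<^sub>R \<sigma> *\<^sub>R g = y *\<^sub>R g" "(y * \<eta>) *\<^sub>R \<eta> *\<^sub>R f = y *\<^sub>R f" for y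
        using \<sigma> \<eta> by (simp_all add: mult.assoc mult.left_commute[of \<sigma>] )
      have alg: "f' - h *\<^sub>R g - (2 *\<^sub>R (k *\<^sub>R g - h *\<^sub>R g) + (- y) *\<^sub>R e) = y *\<^sub>R e + f' + (h - 2 * k) *\<^sub>R g"
          "f' - k *\<^sub>R g - (2 *\<^sub>R (h *\<^sub>R g - k *\<^sub>R g) + y *\<^sub>R (- e)) = y *\<^sub>R e + f' + (k - 2 * h) *\<^sub>R g"
        for f' :: "real^3" and h k y
        by (simp_all add: vec_eq_iff algebra_simps)
      show ?thesis
        unfolding J_def G_def x prod.case f1 g2 s r alg by (simp add: field_simps)
    qed
    then show "J (G x) = x" using expand[of v] expand[of w] x by simp
  qed
  ultimately show "\<exists>J. (line_gap A B has_derivative J) (at (t0, t1, s1, s2, 2, 2)) \<and> surj J" by blast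
qed


text \<open>
  The line through the two tips is a transversal zero of the gap, so a nearby pair of loops still
  has such a line. Its two points on \<open>B\<close> belong to distant strands and are therefore at distance at
  least one, and the key estimate applies to the new pair.
\<close>

lemma gripped_open:
  assumes A: "unit_speed_loop l A TA" and B: "thick_loop m B TB" and l: "l \<le> 2 * pi + 2"
    and far: "\<And>t s. 1 \<le> norm (A t - B s)" and grip: "gripped A TA B"
  shows "\<exists>\<epsilon>>0. \<forall>A' TA' B' TB'. unit_speed_loop l A' TA' \<longrightarrow> thick_loop m B' TB' \<longrightarrow>
     (\<forall>t s. 1 \<le> norm (A' t - B' s)) \<longrightarrow> (\<forall>t. norm (A' t - A t) \<le> \<epsilon>) \<longrightarrow> (\<forall>s. norm (B' s - B s) \<le> \<epsilon>) \<longrightarrow>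
     gripped A' TA' B'"
proof -
  interpret B: thick_loop m B TB by fact
  have B': "unit_speed_loop m B TB" by unfold_locales
  obtain t0 t1 t2 t3 s1 s2 where g: "norm (B s2 - B s1) = 1"
     "A t0 = B s2 + (B s2 - B s1)" "A t1 = B s1 - (B s2 - B s1)"
     "A t2 = B s2 + TA t0" "A t3 = B s1 + TA t0" "(TA t1 \<bullet> TA t0)\<^sup>2 = 1"
    using grip unfolding gripped_def by blast
  obtain J where J: "(line_gap A B has_derivative J) (at (t0, t1, s1, s2, 2, 2))" "surj J"
    using line_gap_transversal(1)[OF A B' far g] by blast
  have normal: "TB s1 \<bullet> (B s2 - B s1) = 0" by (rule line_gap_transversal(2)[OF A B' far g])
  obtain k :: int where k: "s2 - s1 + of_int k * m \<in> {0..<m}" using real_mod_period[OF B.period_pos] by blast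
  define x where "x = s2 - s1 + of_int k * m"
  have Bx: "B (s1 + x) = B s2" using B.perP[of s2 k] by (simp add: x_def)
  have "x \<noteq> 0" using g(1) Bx by auto
  then have x: "2 < x" "x < m - 2"
    using B.normal_chord_arc[of x s1] k normal Bx by (auto simp: x_def)
  \<comment> \<open>small enough to keep the two strands far apart along the loop and \<open>\<mu>\<close>, \<open>\<nu>\<close> above one\<close>
  define \<delta> where "\<delta> = min (1/2) (min ((x - 2) / 2) ((m - 2 - x) / 2))"
  have \<delta>: "0 < \<delta>" "\<delta> \<le> 1/2" "2 * \<delta> \<le> x - 2" "2 * \<delta> \<le> m - 2 - x"
    unfolding \<delta>_def using x by (auto simp: min_def)
  have z: "line_gap A B (t0, t1, s1, s2, 2, 2) = 0" using g by (simp add: line_gap_def scaleR_2 zero_prod_def)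
  obtain \<epsilon> where \<epsilon>: "\<epsilon> > 0" "\<And>\<Psi>. continuous_on UNIV \<Psi> \<Longrightarrow>
      (\<And>y. y \<in> cball (t0, t1, s1, s2, 2::real, 2::real) \<delta> \<Longrightarrow> norm (\<Psi> y - line_gap A B y) \<le> \<epsilon>) \<Longrightarrow>
     \<exists>y\<in>cball (t0, t1, s1, s2, 2::real, 2::real) \<delta>. \<Psi> y = 0"
    using transversal_zero_persists[OF J z \<delta>(1)] by blast
  have comps: "\<bar>u0 - t0\<bar> \<le> \<delta>" "\<bar>u1 - t1\<bar> \<le> \<delta>" "\<bar>r1 - s1\<bar> \<le> \<delta>" "\<bar>r2 - s2\<bar> \<le> \<delta>" "\<bar>\<mu> - 2\<bar> \<le> \<delta>" "\<bar>\<nu> - 2\<bar> \<le> \<delta>"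
    if "(u0, u1, r1, r2, \<mu>, \<nu>) \<in> cball (t0, t1, s1, s2, 2::real, 2::real) \<delta>" for u0 u1 r1 r2 \<mu> \<nu>
  proof -
    have "norm (t0 - u0, t1 - u1, s1 - r1, s2 - r2, 2 - \<mu>, 2 - \<nu>) \<le> \<delta>"
      using that by (simp add: dist_norm)
    then show "\<bar>u0 - t0\<bar> \<le> \<delta>" "\<bar>u1 - t1\<bar> \<le> \<delta>" "\<bar>r1 - s1\<bar> \<le> \<delta>" "\<bar>r2 - s2\<bar> \<le> \<delta>" "\<bar>\<mu> - 2\<bar> \<le> \<delta>" "\<bar>\<nu> - 2\<bar> \<le> \<delta>"
      by (smt (verit) norm_fst_le norm_snd_le fst_conv snd_conv real_norm_def abs_minus_commute)+
  qed
  show ?thesis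
  proof (intro exI[of _ "\<epsilon> / 16"] conjI allI impI)
    fix A' TA' B' TB'
    assume A': "unit_speed_loop l A' TA'" and tB': "thick_loop m B' TB'"
      and far': "\<forall>t s. 1 \<le> norm (A' t - B' s)"
      and close: "\<forall>t. norm (A' t - A t) \<le> \<epsilon> / 16" "\<forall>s. norm (B' s - B s) \<le> \<epsilon> / 16"
    interpret A': unit_speed_loop l A' TA' by fact
    interpret B': thick_loop m B' TB' by fact
    have "\<exists>y\<in>cball (t0, t1, s1, s2, 2::real, 2::real) \<delta>. line_gap A' B' y = 0"
    proof (rule \<epsilon>(2))
      show "continuous_on UNIV (line_gap A' B')" by (intro continuous_on_line_gap A'.contP B'.contP)
      fix y assume y: "y \<in> cball (t0, t1, s1, s2, 2::real, 2::real) \<delta>"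
      obtain u0 u1 r1 r2 \<mu> \<nu> where y': "y = (u0, u1, r1, r2, \<mu>, \<nu>)" by (metis prod_cases6)
      have "\<bar>\<mu>\<bar> \<le> 3" "\<bar>\<nu>\<bar> \<le> 3" using comps(5,6)[OF y[unfolded y']] \<delta>(2) by linarith+
      then have "norm (line_gap A' B' y - line_gap A B y) \<le> 16 * (\<epsilon> / 16)"
        unfolding y' using close \<epsilon>(1) by (intro line_gap_close) auto
      then show "norm (line_gap A' B' y - line_gap A B y) \<le> \<epsilon>" by simp
    qed
    then obtain u0 u1 r1 r2 \<mu> \<nu> where y: "(u0, u1, r1, r2, \<mu>, \<nu>) \<in> cball (t0, t1, s1, s2, 2::real, 2::real) \<delta>"
      and eq: "line_gap A' B' (u0, u1, r1, r2, \<mu>, \<nu>) = 0" by (metis prod_cases6)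
    note c = comps[OF y]
    have "1 \<le> norm (B' (r1 + (r2 - r1 + of_int k * m)) - B' r1)"
      by (rule B'.strands_apart) (use c \<delta> in \<open>unfold x_def, linarith+\<close>)
    moreover have "B' (r1 + (r2 - r1 + of_int k * m)) = B' r2" using B'.perP[of r2 k] by simp
    ultimately have "1 \<le> norm (B' r2 - B' r1)" by simp
    then show "gripped A' TA' B'"
    proof (rule gripped_of_line[OF A' l _ far'[rule_format]])
      show "A' u0 = B' r1 + \<mu> *\<^sub>R (B' r2 - B' r1)" "A' u1 = B' r2 + \<nu> *\<^sub>R (B' r1 - B' r2)"
        using eq by (auto simp: line_gap_def zero_prod_def algebra_simps)
      show "1 < \<mu>" "1 < \<nu>" using c \<delta>(2) by linarith+
    qed
  qed (use \<epsilon> in auto)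
qed

section \<open>Persistence along thin isotopies\<close>

lemma uniform_limit_periodic_ext:
  assumes s: "0 < s" and U: "uniform_limit {0..s} F f X"
  shows "uniform_limit UNIV (\<lambda>u. periodic_ext s (F u)) (periodic_ext s f) X"
proof (rule uniform_limitI)
  fix e :: real assume "e > 0"
  then have "\<forall>\<^sub>F u in X. \<forall>t\<in>{0..s}. dist (F u t) (f t) < e" using U by (rule uniform_limitD[rotated])
  then show "\<forall>\<^sub>F u in X. \<forall>t\<in>UNIV. dist (periodic_ext s (F u) t) (periodic_ext s f t) < e"
  proof eventually_elim
    case (elim u)
    have "s * frac (t / s) \<in> {0..s}" for t
      using periodic_ext_arg[OF s, of t] unfolding atLeastLessThan_iff atLeastAtMost_iff by linarith
    then show ?case using elim by (simp add: periodic_ext_def)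
  qed
qed

lemma continuous_on_uniform_family:
  fixes F :: "'a::metric_space \<Rightarrow> 'b::metric_space \<Rightarrow> 'c::metric_space"
  assumes c: "\<And>u. u \<in> U \<Longrightarrow> continuous_on UNIV (F u)"
    and l: "\<And>u. u \<in> U \<Longrightarrow> uniform_limit UNIV F (F u) (at u within U)"
  shows "continuous_on (U \<times> UNIV) (\<lambda>z. F (fst z) (snd z))"
proof (clarsimp simp: continuous_on_iff)
  fix u t and e :: real assume u: "u \<in> U" and e: "0 < e"
  have "\<forall>\<^sub>F v in at u within U. \<forall>t\<in>UNIV. dist (F v t) (F u t) < e / 2"
    using l[OF u] by (rule uniform_limitD) (use e in simp)
  then obtain d where d: "d > 0" "\<And>v t. v \<in> U \<Longrightarrow> v \<noteq> u \<Longrightarrow> dist v u < d \<Longrightarrow> dist (F v t) (F u t) < e / 2"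
    unfolding eventually_at by auto
  obtain d' where d': "d' > 0" "\<And>t'. dist t' t < d' \<Longrightarrow> dist (F u t') (F u t) < e / 2"
    using c[OF u] e unfolding continuous_on_iff by (meson UNIV_I half_gt_zero)
  show "\<exists>d>0. \<forall>v\<in>U. \<forall>t'. dist (v, t') (u, t) < d \<longrightarrow> dist (F v t') (F u t) < e"
  proof (intro exI[of _ "min d d'"] conjI ballI allI impI)
    fix v t' assume v: "v \<in> U" "dist (v, t') (u, t) < min d d'"
    have "dist v u < d" "dist t' t < d'"
      using v dist_fst_le[of "(v, t')" "(u, t)"] dist_snd_le[of "(v, t')" "(u, t)"] by auto
    moreover from this have "dist (F v t') (F u t') < e / 2" using d v e by (cases "v = u") auto
    ultimately show "dist (F v t') (F u t) < e" using d'(2) by (metis dist_triangle_half_l dist_commute)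
  qed (use d d' in auto)
qed

text \<open>
  The conditions of \<open>gripped\<close> are the vanishing of one continuous function of the parameters.
\<close>

definition grip_defect :: "(real \<Rightarrow> real^3) \<Rightarrow> (real \<Rightarrow> real^3) \<Rightarrow> (real \<Rightarrow> real^3) \<Rightarrow>
    real \<Rightarrow> real \<Rightarrow> real \<Rightarrow> real \<Rightarrow> real \<Rightarrow> real \<Rightarrow> real" where
  "grip_defect A TA B t0 t1 t2 t3 s1 s2 = \<bar>norm (B s2 - B s1) - 1\<bar> +
     norm (A t0 - (B s2 + (B s2 - B s1))) + norm (A t1 - (B s1 - (B s2 - B s1))) +
     norm (A t2 - (B s2 + TA t0)) + norm (A t3 - (B s1 + TA t0)) + \<bar>(TA t1 \<bullet> TA t0)\<^sup>2 - 1\<bar>"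

lemma gripped_iff_defect:
  assumes A: "unit_speed_loop l A TA" and B: "unit_speed_loop m B TB"
  shows "gripped A TA B \<longleftrightarrow> (\<exists>t0\<in>{0..l}. \<exists>t1\<in>{0..l}. \<exists>t2\<in>{0..l}. \<exists>t3\<in>{0..l}. \<exists>s1\<in>{0..m}. \<exists>s2\<in>{0..m}.
     grip_defect A TA B t0 t1 t2 t3 s1 s2 = 0)"
proof -
  interpret A: unit_speed_loop l A TA by fact
  interpret B: unit_speed_loop m B TB by fact
  have zero: "grip_defect A TA B t0 t1 t2 t3 s1 s2 = 0 \<longleftrightarrow> norm (B s2 - B s1) = 1 \<and>
     A t0 = B s2 + (B s2 - B s1) \<and> A t1 = B s1 - (B s2 - B s1) \<and>
     A t2 = B s2 + TA t0 \<and> A t3 = B s1 + TA t0 \<and> (TA t1 \<bullet> TA t0)\<^sup>2 = 1" for t0 t1 t2 t3 s1 s2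
  proof -
    have pos: "0 \<le> \<bar>x\<bar>" "0 \<le> norm v" for x :: real and v :: "real^3" by auto
    show ?thesis
      unfolding grip_defect_def
      by (subst add_nonneg_eq_0_iff, (intro add_nonneg_nonneg pos)+)+ auto
  qed
  have redA: "\<exists>t'\<in>{0..l}. A t' = A t \<and> TA t' = TA t" for t
  proof -
    obtain k :: int where k: "t + of_int k * l \<in> {0..<l}" using real_mod_period[OF A.period_pos] by blast
    then show ?thesis using A.perP[of t k] A.perT[of t k] by (intro bexI[of _ "t + of_int k * l"]) auto
  qed
  have redB: "\<exists>t'\<in>{0..m}. B t' = B t" for t
  proof -
    obtain k :: int where k: "t + of_int k * m \<in> {0..<m}" using real_mod_period[OF B.period_pos] by blast
    then show ?thesis using B.perP[of t k] by (intro bexI[of _ "t + of_int k * m"]) auto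
  qed
  show ?thesis
  proof
    assume "gripped A TA B"
    then obtain t0 t1 t2 t3 s1 s2 where g: "norm (B s2 - B s1) = 1 \<and>
     A t0 = B s2 + (B s2 - B s1) \<and> A t1 = B s1 - (B s2 - B s1) \<and>
     A t2 = B s2 + TA t0 \<and> A t3 = B s1 + TA t0 \<and> (TA t1 \<bullet> TA t0)\<^sup>2 = 1"
      unfolding gripped_def by blast
    obtain t0' t1' t2' t3' s1' s2' where r: "t0' \<in> {0..l}" "A t0' = A t0 \<and> TA t0' = TA t0"
      "t1' \<in> {0..l}" "A t1' = A t1 \<and> TA t1' = TA t1" "t2' \<in> {0..l}" "A t2' = A t2 \<and> TA t2' = TA t2"
      "t3' \<in> {0..l}" "A t3' = A t3 \<and> TA t3' = TA t3" "s1' \<in> {0..m}" "B s1' = B s1" "s2' \<in> {0..m}" "B s2' = B s2"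
      using redA[of t0] redA[of t1] redA[of t2] redA[of t3] redB[of s1] redB[of s2] by blast
    have "grip_defect A TA B t0' t1' t2' t3' s1' s2' = 0" unfolding zero using g r by simp
    then show "\<exists>t0\<in>{0..l}. \<exists>t1\<in>{0..l}. \<exists>t2\<in>{0..l}. \<exists>t3\<in>{0..l}. \<exists>s1\<in>{0..m}. \<exists>s2\<in>{0..m}.
     grip_defect A TA B t0 t1 t2 t3 s1 s2 = 0" using r by blast
  next
    assume "\<exists>t0\<in>{0..l}. \<exists>t1\<in>{0..l}. \<exists>t2\<in>{0..l}. \<exists>t3\<in>{0..l}. \<exists>s1\<in>{0..m}. \<exists>s2\<in>{0..m}.
     grip_defect A TA B t0 t1 t2 t3 s1 s2 = 0"
    then show "gripped A TA B" unfolding zero gripped_def by blast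
  qed
qed

text \<open>
  The set of times at which the loops are gripped is closed, as the projection of a compact set of
  zeros of the defect, and open in the unit interval.
\<close>

lemma gripped_persists:
  fixes A TA B TB :: "real \<Rightarrow> real \<Rightarrow> real^3"
  assumes A: "\<And>u. u \<in> {0..1} \<Longrightarrow> unit_speed_loop l (A u) (TA u)"
    and B: "\<And>u. u \<in> {0..1} \<Longrightarrow> thick_loop m (B u) (TB u)"
    and l: "l \<le> 2 * pi + 2"
    and far: "\<And>u t s. u \<in> {0..1} \<Longrightarrow> 1 \<le> norm (A u t - B u s)"
    and lim: "\<And>u. u \<in> {0..1} \<Longrightarrow> uniform_limit UNIV A (A u) (at u within {0..1})"
      "\<And>u. u \<in> {0..1} \<Longrightarrow> uniform_limit UNIV TA (TA u) (at u within {0..1})"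
      "\<And>u. u \<in> {0..1} \<Longrightarrow> uniform_limit UNIV B (B u) (at u within {0..1})"
    and start: "gripped (A 0) (TA 0) (B 0)"
  shows "gripped (A 1) (TA 1) (B 1)"
proof -
  define G where "G = {u \<in> {0..1}. gripped (A u) (TA u) (B u)}"
  have B': "unit_speed_loop m (B u) (TB u)" if "u \<in> {0..1}" for u
    using B[OF that] by (simp add: thick_loop_def)
  have "closed G"
  proof -
    have contA: "continuous_on ({0..1} \<times> UNIV) (\<lambda>z. A (fst z) (snd z))"
      by (rule continuous_on_uniform_family[OF unit_speed_loop.contP[OF A] lim(1)])
    have contTA: "continuous_on ({0..1} \<times> UNIV) (\<lambda>z. TA (fst z) (snd z))"
      by (rule continuous_on_uniform_family[OF unit_speed_loop.contT[OF A] lim(2)])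
    have contB: "continuous_on ({0..1} \<times> UNIV) (\<lambda>z. B (fst z) (snd z))"
      by (rule continuous_on_uniform_family[OF unit_speed_loop.contP[OF B'] lim(3)])
    define K where "K = {0..1::real} \<times> {0..l} \<times> {0..l} \<times> {0..l} \<times> {0..l} \<times> {0..m} \<times> {0..m}"
    define F where "F = (\<lambda>(u, t0, t1, t2, t3, s1, s2). grip_defect (A u) (TA u) (B u) t0 t1 t2 t3 s1 s2)"
    have K: "compact K" unfolding K_def by (intro compact_Times compact_Icc)
    have cA: "continuous_on K (\<lambda>z. A (fst z) (g z))" "continuous_on K (\<lambda>z. TA (fst z) (g z))"
      "continuous_on K (\<lambda>z. B (fst z) (g z))" if "continuous_on K g" for g
    proof -
      have c: "continuous_on K (\<lambda>z. (fst z, g z))" by (intro continuous_intros that)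
      have sub: "(\<lambda>z. (fst z, g z)) ` K \<subseteq> {0..1} \<times> UNIV" by (auto simp: K_def)
      show "continuous_on K (\<lambda>z. A (fst z) (g z))" "continuous_on K (\<lambda>z. TA (fst z) (g z))"
        "continuous_on K (\<lambda>z. B (fst z) (g z))"
        using continuous_on_compose2[OF contA c sub] continuous_on_compose2[OF contTA c sub]
          continuous_on_compose2[OF contB c sub] by simp_all
    qed
    have "continuous_on K F"
      unfolding F_def case_prod_unfold grip_defect_def by (intro continuous_intros cA)
    then have "closed (K \<inter> F -` {0})" using K by (intro continuous_closed_preimage compact_imp_closed) auto
    then have "compact (K \<inter> (K \<inter> F -` {0}))" using K by (rule compact_Int_closed[rotated])
    then have "compact (fst ` (K \<inter> (K \<inter> F -` {0})))" by (intro compact_continuous_image continuous_intros)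
    moreover have "fst ` (K \<inter> (K \<inter> F -` {0})) = G"
    proof
      show "fst ` (K \<inter> (K \<inter> F -` {0})) \<subseteq> G"
      proof
        fix u assume "u \<in> fst ` (K \<inter> (K \<inter> F -` {0}))"
        then obtain x where x: "(u, x) \<in> K" "F (u, x) = 0" by auto
        obtain t0 t1 t2 t3 s1 s2 where x': "x = (t0, t1, t2, t3, s1, s2)" by (metis prod_cases6)
        have u: "u \<in> {0..1}" using x by (simp add: K_def)
        have "gripped (A u) (TA u) (B u)"
          unfolding gripped_iff_defect[OF A[OF u] B'[OF u]] using x unfolding x' K_def F_def mem_Times_iff prod.case fst_conv snd_conv by blast
        then show "u \<in> G" using u by (simp add: G_def)
      qed
      show "G \<subseteq> fst ` (K \<inter> (K \<inter> F -` {0}))"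
      proof
        fix u assume "u \<in> G"
        then have u: "u \<in> {0..1}" "gripped (A u) (TA u) (B u)" by (auto simp: G_def)
        then obtain t0 t1 t2 t3 s1 s2 where t: "t0 \<in> {0..l}" "t1 \<in> {0..l}" "t2 \<in> {0..l}" "t3 \<in> {0..l}"
          "s1 \<in> {0..m}" "s2 \<in> {0..m}" "grip_defect (A u) (TA u) (B u) t0 t1 t2 t3 s1 s2 = 0"
          unfolding gripped_iff_defect[OF A[OF u(1)] B'[OF u(1)]] by blast
        have "(u, t0, t1, t2, t3, s1, s2) \<in> K \<inter> (K \<inter> F -` {0})"
          using u(1) t by (simp add: K_def F_def)
        then show "u \<in> fst ` (K \<inter> (K \<inter> F -` {0}))" by (rule rev_image_eqI) simp
      qed
    qed
    ultimately show ?thesis by (simp add: compact_imp_closed)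
  qed
  then have "closedin (top_of_set {0..1}) G"
    by (rule closed_subset[rotated]) (auto simp: G_def)
  moreover have "openin (top_of_set {0..1}) G"
    unfolding openin_euclidean_subtopology_iff
  proof (intro conjI ballI)
    fix u assume "u \<in> G"
    then have u: "u \<in> {0..1}" "gripped (A u) (TA u) (B u)" by (auto simp: G_def)
    obtain \<epsilon> where \<epsilon>: "\<epsilon> > 0" "\<And>A' TA' B' TB'. unit_speed_loop l A' TA' \<Longrightarrow> thick_loop m B' TB' \<Longrightarrow>
     (\<And>t s. 1 \<le> norm (A' t - B' s)) \<Longrightarrow> (\<And>t. norm (A' t - A u t) \<le> \<epsilon>) \<Longrightarrow> (\<And>s. norm (B' s - B u s) \<le> \<epsilon>) \<Longrightarrow>
     gripped A' TA' B'"
      using gripped_open[OF A[OF u(1)] B[OF u(1)] l far[OF u(1)] u(2)] by blast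
    have "\<forall>\<^sub>F v in at u within {0..1}. (\<forall>t\<in>UNIV. dist (A v t) (A u t) < \<epsilon>) \<and> (\<forall>t\<in>UNIV. dist (B v t) (B u t) < \<epsilon>)"
      using uniform_limitD[OF lim(1)[OF u(1)] \<epsilon>(1)] uniform_limitD[OF lim(3)[OF u(1)] \<epsilon>(1)]
      by (rule eventually_conj)
    then obtain d where d: "d > 0" "\<And>v t. v \<in> {0..1} \<Longrightarrow> v \<noteq> u \<Longrightarrow> dist v u < d \<Longrightarrow> dist (A v t) (A u t) < \<epsilon> \<and> dist (B v t) (B u t) < \<epsilon>"
      unfolding eventually_at by auto
    have "v \<in> G" if v: "v \<in> {0..1}" "dist v u < d" for v
    proof (cases "v = u")
      case False
      have "gripped (A v) (TA v) (B v)"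
        by (rule \<epsilon>(2)[OF A[OF v(1)] B[OF v(1)] far[OF v(1)]])
           (use d(2)[OF v(1) False v(2)] in \<open>auto simp: dist_norm less_imp_le\<close>)
      then show ?thesis using v by (simp add: G_def)
    qed (use \<open>u \<in> G\<close> in simp)
    then show "\<exists>e>0. \<forall>v\<in>{0..1}. dist v u < e \<longrightarrow> v \<in> G" using d(1) by blast
  qed (auto simp: G_def)
  moreover have "0 \<in> G" using start by (simp add: G_def)
  ultimately have "G = {0..1}"
    using connected_clopen[THEN iffD1, OF connected_Icc, rule_format, of 0 1 G] by auto
  then have "1 \<in> G" by simp
  then show ?thesis by (simp add: G_def)
qed

lemma midpoint_in_both_balls:
  fixes a b :: "'a::real_normed_vector"
  assumes "norm (a - b) < 2 * r"
  shows "midpoint a b \<in> ball a r" "midpoint a b \<in> ball b r"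
  using assms unfolding mem_ball dist_midpoint by (simp_all add: dist_norm)

lemma disjoint_tubes_far:
  assumes "disjoint_tubes r L" "K \<in> L" "K' \<in> L" "K \<noteq> K'" "a \<in> K" "b \<in> K'"
  shows "2 * r \<le> norm (a - b)"
proof (rule ccontr)
  assume "\<not> ?thesis"
  then have "midpoint a b \<in> tube r K \<inter> tube r K'"
    using midpoint_in_both_balls[of a b r] assms(5,6) unfolding tube_def by (auto simp del: mem_ball)
  then show False using assms(1-4) unfolding disjoint_tubes_def pairwise_def disjnt_def by blast
qed

text \<open>
  Being gripped to the end, the two components still have points at distance one, so their tubes of
  radius one overlap. The hypothesis covers all parametrisations because a thin isotopy may start
  with any of them.
\<close>

lemma gripped_not_disentangled:
  assumes AB: "A \<noteq> B"
    and start: "\<And>l \<gamma> m \<beta>. constrained_loop 1 l \<gamma> \<Longrightarrow> \<gamma> ` {0..l} = A \<Longrightarrow> constrained_loop 1 m \<beta> \<Longrightarrow> \<beta> ` {0..m} = B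
      \<Longrightarrow> l \<le> 2 * pi + 2 \<and> gripped (periodic_ext l \<gamma>) (periodic_ext l (tangent l \<gamma>)) (periodic_ext m \<beta>)"
  shows "\<not> thinly_disentangled 1 {A, B}"
proof
  assume "thinly_disentangled 1 {A, B}"
  then obtain L' where "thin_isotopy 1 {A, B} L'" and tubes: "disjoint_tubes 1 L'"
    unfolding thinly_disentangled_def using zero_less_one by blast
  then obtain l and h :: "(real^3) set \<Rightarrow> real \<Rightarrow> real \<Rightarrow> real^3" where h: "\<forall>K\<in>{A, B}. \<forall>u\<in>{0..1}.
           constrained_loop 1 (l K) (h K u) \<and>
           uniform_limit {0..l K} (h K) (h K u) (at u within {0..1}) \<and>
           uniform_limit {0..l K} (\<lambda>v. tangent (l K) (h K v)) (tangent (l K) (h K u)) (at u within {0..1})"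
    and thin: "\<forall>u\<in>{0..1}. inj_on (\<lambda>K. h K u ` {0..l K}) {A, B} \<and> thin_link 1 ((\<lambda>K. h K u ` {0..l K}) ` {A, B})"
    and ends: "\<forall>K\<in>{A, B}. h K 0 ` {0..l K} = K" "(\<lambda>K. h K 1 ` {0..l K}) ` {A, B} = L'"
    unfolding thin_isotopy_def
    apply (elim exE conjE)
    subgoal for l h by (rule that[of l h])
    done
  define P T where "P K u = periodic_ext (l K) (h K u)" and "T K u = periodic_ext (l K) (tangent (l K) (h K u))" for K u
  have C: "constrained_loop 1 (l K) (h K u)" if "K \<in> {A, B}" "u \<in> {0..1}" for K u
    using bspec[OF bspec[OF h that(1)] that(2)] by (rule conjunct1)
  have rng: "range (P K u) = h K u ` {0..l K}" if "K \<in> {A, B}" "u \<in> {0..1}" for K u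
    unfolding P_def using C[OF that] by (intro periodic_ext_range) (auto simp: constrained_loop_def)
  have pos: "0 < l K" if "K \<in> {A, B}" for K using C[OF that, of 0] by (simp add: constrained_loop_def)
  have ne: "h A u ` {0..l A} \<noteq> h B u ` {0..l B}" if "u \<in> {0..1}" for u
  proof -
    have "inj_on (\<lambda>K. h K u ` {0..l K}) {A, B}" using bspec[OF thin that] by (rule conjunct1)
    then show ?thesis using AB by (simp add: inj_on_def)
  qed
  have "gripped (P A 1) (T A 1) (P B 1)"
  proof (rule gripped_persists[where l = "l A" and m = "l B"])
    fix u :: real assume u: "u \<in> {0..1}"
    show "unit_speed_loop (l A) (P A u) (T A u)"
      unfolding P_def T_def by (rule unit_speed_loop_periodic_ext[OF C]) (use u in auto)
    have tl: "thin_link 1 ((\<lambda>K. h K u ` {0..l K}) ` {A, B})" using bspec[OF thin u] by (rule conjunct2)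
    then have "thick_knot (1/2) (h B u ` {0..l B})" unfolding thin_link_def by simp
    then show "thick_loop (l B) (P B u) (T B u)"
      unfolding P_def T_def using C[of B u] u by (intro thick_loop_of_thick_knot) auto
    show "1 \<le> norm (P A u t - P B u s)" for t s
    proof -
      have "2 * (1/2) \<le> norm (P A u t - P B u s)"
      proof (rule disjoint_tubes_far[OF _ _ _ ne[OF u]])
        show "disjoint_tubes (1/2) ((\<lambda>K. h K u ` {0..l K}) ` {A, B})" using tl unfolding thin_link_def by simp
        show "P A u t \<in> h A u ` {0..l A}" "P B u s \<in> h B u ` {0..l B}"
          using rng[of A u] rng[of B u] u by auto
      qed auto
      then show ?thesis by simp
    qed
    show "uniform_limit UNIV (P A) (P A u) (at u within {0..1})"
      "uniform_limit UNIV (T A) (T A u) (at u within {0..1})"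
      "uniform_limit UNIV (P B) (P B u) (at u within {0..1})"
      unfolding P_def T_def using h u pos by (intro uniform_limit_periodic_ext; blast)+
  next
    show "l A \<le> 2 * pi + 2" "gripped (P A 0) (T A 0) (P B 0)"
      unfolding P_def T_def using start[OF C[of A 0] _ C[of B 0]] ends(1) by auto
  qed
  then obtain t0 t2 s2 where "P A 1 t2 = P B 1 s2 + T A 1 t0" unfolding gripped_def by blast
  moreover have "norm (T A 1 t0) = 1"
    using unit_speed_loop.unit[OF unit_speed_loop_periodic_ext[OF C[of A 1]]] by (simp add: T_def)
  ultimately have "norm (P A 1 t2 - P B 1 s2) = 1" by simp
  moreover have "2 * 1 \<le> norm (P A 1 t2 - P B 1 s2)"
  proof (rule disjoint_tubes_far[OF tubes _ _ ne[of 1]])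
    show "h A 1 ` {0..l A} \<in> L'" "h B 1 ` {0..l B} \<in> L'" using ends(2) by auto
    show "P A 1 t2 \<in> h A 1 ` {0..l A}" "P B 1 s2 \<in> h B 1 ` {0..l B}"
      using rng[of A 1] rng[of B 1] by auto
  qed simp
  ultimately show False by simp
qed

lemma thinly_isotopic_lengths:
  assumes "thinly_isotopic L L'" "K \<in> L"
  shows "\<exists>s \<gamma> \<gamma>'. constrained_loop 1 s \<gamma> \<and> constrained_loop 1 s \<gamma>' \<and> \<gamma> ` {0..s} = K \<and> \<gamma>' ` {0..s} \<in> L'"
proof -
  obtain l and h :: "(real^3) set \<Rightarrow> real \<Rightarrow> real \<Rightarrow> real^3" where h: "\<forall>K\<in>L. \<forall>u\<in>{0..1}. constrained_loop 1 (l K) (h K u)"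
    "\<forall>K\<in>L. h K 0 ` {0..l K} = K" "(\<lambda>K. h K 1 ` {0..l K}) ` L = L'"
    using assms(1) unfolding thinly_isotopic_def thin_isotopy_def
    apply (elim exE conjE)
    subgoal for d l h by (rule that[of l h]) blast+
    done
  have "constrained_loop 1 (l K) (h K 0)" "constrained_loop 1 (l K) (h K 1)" using h(1) assms(2) by auto
  then show ?thesis using h(2,3) assms(2) by (intro exI[of _ "l K"] exI[of _ "h K 0"] exI[of _ "h K 1"]) auto
qed

section \<open>Loops that are symmetric about a point\<close>

text \<open>
  Both components of the examples are symmetric about the origin. Half of such a loop is made of two
  arcs \<open>f\<close> on \<open>[0, a]\<close> and \<open>g\<close> on \<open>[a, H]\<close>; the other half is its reflection. The same gluing of the
  derivatives gives the tangent and the curvature vector.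
\<close>

definition antisym_loop :: "real \<Rightarrow> real \<Rightarrow> (real \<Rightarrow> real^3) \<Rightarrow> (real \<Rightarrow> real^3) \<Rightarrow> real \<Rightarrow> real^3" where
  "antisym_loop a H f g t =
     (if t \<le> a then f t else if t \<le> H then g t else if t \<le> H + a then - f (t - H) else - g (t - H))"

lemma antisym_loop_derivative:
  assumes f: "\<And>t. (f has_vector_derivative f' t) (at t)" and g: "\<And>t. (g has_vector_derivative g' t) (at t)"
    and aH: "0 < a" "a < H" and t: "t \<notin> {a, H, H + a}"
  shows "(antisym_loop a H f g has_vector_derivative antisym_loop a H f' g' t) (at t)"
proof -
  have shift: "((\<lambda>t. - k (t - H)) has_vector_derivative - k' (t - H)) (at t)"
    if "\<And>t. (k has_vector_derivative k' t) (at t)" for k k' :: "real \<Rightarrow> real^3" and t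
  proof -
    have "((k \<circ> (\<lambda>t. t - H)) has_vector_derivative 1 *\<^sub>R k' (t - H)) (at t)"
      by (rule vector_diff_chain_at) (auto intro!: derivative_eq_intros that)
    then show ?thesis by (auto simp: o_def intro!: derivative_eq_intros)
  qed
  consider "t < a" | "a < t" "t < H" | "H < t" "t < H + a" | "H + a < t" using t aH by force
  then show ?thesis
  proof cases
    case 1
    show ?thesis
      by (rule has_vector_derivative_transform_within_open[of f _ t "{..<a}"])
         (use 1 f in \<open>auto simp: antisym_loop_def\<close>)
  next
    case 2
    show ?thesis
      by (rule has_vector_derivative_transform_within_open[of g _ t "{a<..<H}"])
         (use 2 g in \<open>auto simp: antisym_loop_def\<close>)
  next
    case 3
    show ?thesis
      by (rule has_vector_derivative_transform_within_open[of "\<lambda>t. - f (t - H)" _ t "{H<..<H + a}"])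
         (use 3 aH shift[OF f] in \<open>auto simp: antisym_loop_def\<close>)
  next
    case 4
    show ?thesis
      by (rule has_vector_derivative_transform_within_open[of "\<lambda>t. - g (t - H)" _ t "{H + a<..}"])
         (use 4 aH shift[OF g] in \<open>auto simp: antisym_loop_def\<close>)
  qed
qed

lemma continuous_on_antisym_loop:
  assumes f: "continuous_on UNIV f" and g: "continuous_on UNIV g"
    and aH: "0 < a" "a < H" and m: "f a = g a" "g H = - f 0"
  shows "continuous_on S (antisym_loop a H f g)"
proof -
  have c: "continuous_on S (\<lambda>t. - k (t - H))" if "continuous_on UNIV k" for S and k :: "real \<Rightarrow> real^3"
    by (intro continuous_intros continuous_on_compose2[OF that]) auto
  have "continuous_on UNIV (\<lambda>t. if t \<le> a then f t else if t \<le> H then g t else if t \<le> H + a then - f (t - H) else - g (t - H))"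
    by (intro continuous_on_cases_le continuous_on_id c continuous_on_subset[OF f] continuous_on_subset[OF g] f g)
       (use m aH in auto)
  then show ?thesis unfolding antisym_loop_def[abs_def] by (rule continuous_on_subset) simp
qed

lemma norm_vector_derivative_le_lipschitz:
  fixes f :: "real \<Rightarrow> 'a::real_normed_vector"
  assumes d: "(f has_vector_derivative D) (at t within S)" and nt: "at t within S \<noteq> bot"
    and L: "\<And>y. y \<in> S \<Longrightarrow> norm (f y - f t) \<le> \<kappa> * \<bar>y - t\<bar>"
  shows "norm D \<le> \<kappa>"
proof (rule Lim_norm_ubound[OF nt])
  have lim: "((\<lambda>y. norm (f y - f t - (y - t) *\<^sub>R D) / norm (y - t)) \<longlongrightarrow> 0) (at t within S)"
    using d unfolding has_vector_derivative_def has_derivative_iff_norm by simp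
  have eq: "norm (f y - f t - (y - t) *\<^sub>R D) / norm (y - t) = norm ((f y - f t) /\<^sub>R (y - t) - D)"
    if "y \<noteq> t" for y
  proof -
    have "(f y - f t) /\<^sub>R (y - t) - D = inverse (y - t) *\<^sub>R (f y - f t - (y - t) *\<^sub>R D)"
      using that by (simp add: scaleR_diff_right)
    then show ?thesis by (metis abs_inverse divide_inverse mult.commute norm_scaleR real_norm_def)
  qed
  have "((\<lambda>y. norm ((f y - f t) /\<^sub>R (y - t) - D)) \<longlongrightarrow> 0) (at t within S)"
  proof (rule Lim_transform_eventually[OF lim])
    show "\<forall>\<^sub>F y in at t within S. norm (f y - f t - (y - t) *\<^sub>R D) / norm (y - t) = norm ((f y - f t) /\<^sub>R (y - t) - D)"
      unfolding eventually_at_filter by (rule always_eventually) (use eq in blast)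
  qed
  then have "((\<lambda>y. (f y - f t) /\<^sub>R (y - t) - D) \<longlongrightarrow> 0) (at t within S)"
    by (rule tendsto_norm_zero_cancel)
  then show "((\<lambda>y. (f y - f t) /\<^sub>R (y - t)) \<longlongrightarrow> D) (at t within S)"
    by (rule LIM_zero_cancel)
  have "norm ((f y - f t) /\<^sub>R (y - t)) \<le> \<kappa>" if "y \<in> S" "y \<noteq> t" for y
    using L[OF that(1)] that(2) unfolding norm_scaleR abs_inverse
    by (simp add: inverse_eq_divide pos_divide_le_eq)
  then show "\<forall>\<^sub>F y in at t within S. norm ((f y - f t) /\<^sub>R (y - t)) \<le> \<kappa>"
    by (auto simp: eventually_at_filter)
qed

text \<open>
  The arcs are smooth curves on the whole line. The last group of assumptions says that the four arcs
  meet only where consecutive ones join.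
\<close>

locale antisym_data =
  fixes a H :: real and f f1 f2 f3 g g1 g2 g3 :: "real \<Rightarrow> real^3"
  assumes aH: "0 < a" "a < H"
    and f: "\<And>t. (f has_vector_derivative f1 t) (at t)" "\<And>t. (f1 has_vector_derivative f2 t) (at t)"
       "\<And>t. (f2 has_vector_derivative f3 t) (at t)"
    and g: "\<And>t. (g has_vector_derivative g1 t) (at t)" "\<And>t. (g1 has_vector_derivative g2 t) (at t)"
       "\<And>t. (g2 has_vector_derivative g3 t) (at t)"
    and unit: "\<And>t. norm (f1 t) = 1" "\<And>t. norm (g1 t) = 1"
    and curv: "\<And>t. norm (f2 t) \<le> 1" "\<And>t. norm (g2 t) \<le> 1" "f2 0 \<noteq> 0"
    and match: "f a = g a" "g H = - f 0" "f1 a = g1 a" "g1 H = - f1 0"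
    and inj: "inj_on f {0..<a}" "inj_on g {a..<H}" "\<And>t u. t \<in> {0..<a} \<Longrightarrow> u \<in> {a..<H} \<Longrightarrow> f t \<noteq> g u"
      "\<And>t u. t \<in> {0..<a} \<Longrightarrow> u \<in> {0..<a} \<Longrightarrow> f t \<noteq> - f u"
      "\<And>t u. t \<in> {0..<a} \<Longrightarrow> u \<in> {a..<H} \<Longrightarrow> f t \<noteq> - g u"
      "\<And>t u. t \<in> {a..<H} \<Longrightarrow> u \<in> {a..<H} \<Longrightarrow> g t \<noteq> - g u"
begin

abbreviation "\<gamma> \<equiv> antisym_loop a H f g"
abbreviation "\<tau> \<equiv> antisym_loop a H f1 g1"

lemma cont: "continuous_on UNIV f" "continuous_on UNIV g" "continuous_on UNIV f1" "continuous_on UNIV g1"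
  by (meson f g has_vector_derivative_continuous continuous_at_imp_continuous_on)+

lemma \<gamma>_derivative:
  assumes "t \<in> {0..2 * H}"
  shows "(\<gamma> has_vector_derivative \<tau> t) (at t within {0..2 * H})"
proof (rule has_vector_derivative_of_continuous[of "{a, H, H + a}"])
  show "continuous_on {0..2 * H} \<gamma>" "continuous_on {0..2 * H} \<tau>"
    by (intro continuous_on_antisym_loop cont aH match)+
qed (use assms antisym_loop_derivative[OF f(1) g(1) aH] in auto)

lemma tangent_\<gamma>:
  assumes "t \<in> {0..2 * H}"
  shows "tangent (2 * H) \<gamma> t = \<tau> t"
  unfolding tangent_def using vector_derivative_within_cbox[of 0 "2 * H" t \<gamma> "\<tau> t"] \<gamma>_derivative[OF assms] assms aH
  by simp

lemma tangent_derivative: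
  assumes "t \<in> {0<..<2 * H} - {a, H, H + a}"
  shows "(tangent (2 * H) \<gamma> has_vector_derivative antisym_loop a H f2 g2 t) (at t)"
  by (rule has_vector_derivative_transform_within_open[OF antisym_loop_derivative[OF f(2) g(2) aH, of t], of "{0<..<2 * H}"])
     (use assms tangent_\<gamma> in auto)

lemma bound2: "norm (antisym_loop a H f2 g2 t) \<le> 1"
  using curv by (simp add: antisym_loop_def)

lemma contT: "continuous_on {0..2 * H} (tangent (2 * H) \<gamma>)"
  using continuous_on_antisym_loop[OF cont(3,4) aH match(3,4)]
  by (rule continuous_on_eq) (simp add: tangent_\<gamma>)

lemma lips:
  assumes "t \<in> {0..2 * H}" "u \<in> {0..2 * H}"
  shows "norm (tangent (2 * H) \<gamma> u - tangent (2 * H) \<gamma> t) \<le> 1 * \<bar>u - t\<bar>"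
proof -
  have *: "norm (tangent (2 * H) \<gamma> u - tangent (2 * H) \<gamma> t) \<le> 1 * (u - t)" if "0 \<le> t" "t \<le> u" "u \<le> 2 * H" for t u
    by (rule norm_diff_le_of_derivative_bound[of "{a, H, H + a}" t u _ 1 "antisym_loop a H f2 g2"])
       (use that bound2 in \<open>auto intro!: tangent_derivative continuous_on_subset[OF contT]\<close>)
  then show ?thesis using assms *[of t u] *[of u t] by (cases "t \<le> u") (auto simp: norm_minus_commute)
qed

lemma closed_loop: "\<gamma> 0 = \<gamma> (2 * H)" "\<tau> 0 = \<tau> (2 * H)"
  using aH match by (auto simp: antisym_loop_def)

lemma range_\<gamma>: "\<gamma> ` {0..2 * H} = (\<Union>s\<in>{1, -1}. (\<lambda>t. s *\<^sub>R f t) ` {0..a} \<union> (\<lambda>t. s *\<^sub>R g t) ` {a..H})"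
proof
  show "\<gamma> ` {0..2 * H} \<subseteq> (\<Union>s\<in>{1, -1}. (\<lambda>t. s *\<^sub>R f t) ` {0..a} \<union> (\<lambda>t. s *\<^sub>R g t) ` {a..H})"
  proof
    fix x assume "x \<in> \<gamma> ` {0..2 * H}"
    then obtain t where t: "0 \<le> t" "t \<le> 2 * H" "x = \<gamma> t" by auto
    consider "t \<le> a" "x = 1 *\<^sub>R f t" | "a \<le> t" "t \<le> H" "x = 1 *\<^sub>R g t"
      | "H \<le> t" "t \<le> H + a" "x = (-1) *\<^sub>R f (t - H)" | "H + a \<le> t" "x = (-1) *\<^sub>R g (t - H)"
      using t by (fastforce simp: antisym_loop_def split: if_splits)
    then show "x \<in> (\<Union>s\<in>{1, -1}. (\<lambda>t. s *\<^sub>R f t) ` {0..a} \<union> (\<lambda>t. s *\<^sub>R g t) ` {a..H})"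
      using t by cases (force simp: image_iff)+
  qed
  have "f t \<in> \<gamma> ` {0..2 * H}" if "t \<in> {0..a}" for t
    using that aH by (intro image_eqI[of _ _ t]) (auto simp: antisym_loop_def)
  moreover have "g t \<in> \<gamma> ` {0..2 * H}" if "t \<in> {a..H}" for t
    using that aH match by (intro image_eqI[of _ _ t]) (auto simp: antisym_loop_def)
  moreover have "- f t \<in> \<gamma> ` {0..2 * H}" if "t \<in> {0..a}" for t
    using that aH match by (intro image_eqI[of _ _ "H + t"]) (auto simp: antisym_loop_def)
  moreover have "- g t \<in> \<gamma> ` {0..2 * H}" if "t \<in> {a..H}" for t
    using that aH match by (intro image_eqI[of _ _ "H + t"]) (auto simp: antisym_loop_def)
  ultimately show "(\<Union>s\<in>{1, -1}. (\<lambda>t. s *\<^sub>R f t) ` {0..a} \<union> (\<lambda>t. s *\<^sub>R g t) ` {a..H}) \<subseteq> \<gamma> ` {0..2 * H}"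
    by auto
qed

lemma inj_\<gamma>: "inj_on \<gamma> {0..<2 * H}"
proof -
  have half: "inj_on \<gamma> {0..<H}" 
  proof (rule inj_onI)
    fix t u assume tu: "t \<in> {0..<H}" "u \<in> {0..<H}" "\<gamma> t = \<gamma> u"
    have v: "\<gamma> y = (if y < a then f y else g y)" if "y \<in> {0..<H}" for y
      using that match by (auto simp: antisym_loop_def)
    show "t = u"
      using tu inj(1,2) inj(3)[of t u] inj(3)[of u t] unfolding v[OF tu(1)] v[OF tu(2)]
      by (auto simp: inj_on_def split: if_splits)
  qed
  have opp: "\<gamma> t \<noteq> - \<gamma> u" if tu: "t \<in> {0..<H}" "u \<in> {0..<H}" for t u
  proof -
    have v: "\<gamma> y = (if y < a then f y else g y)" if "y \<in> {0..<H}" for y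
      using that match by (auto simp: antisym_loop_def)
    show ?thesis
      using tu inj(4)[of t u] inj(5)[of t u] inj(5)[of u t] inj(6)[of t u] unfolding v[OF tu(1)] v[OF tu(2)]
      by (auto split: if_splits simp: equation_minus_iff)
  qed
  have anti: "\<gamma> y = - \<gamma> (y - H)" if "y \<in> {H..<2 * H}" for y
    using that match aH by (auto simp: antisym_loop_def)
  show ?thesis
  proof (rule inj_onI)
    fix t u assume tu: "t \<in> {0..<2 * H}" "u \<in> {0..<2 * H}" "\<gamma> t = \<gamma> u"
    show "t = u"
    proof (cases "t < H"; cases "u < H")
      assume "t < H" "u < H" then show ?thesis using tu half by (auto simp: inj_on_def)
    next
      assume c: "t < H" "\<not> u < H"
      then show ?thesis using tu anti[of u] opp[of t "u - H"] by auto
    next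
      assume c: "\<not> t < H" "u < H"
      then show ?thesis using tu anti[of t] opp[of u "t - H"] by auto
    next
      assume c: "\<not> t < H" "\<not> u < H"
      then have "\<gamma> (t - H) = \<gamma> (u - H)" using tu anti[of t] anti[of u] by auto
      then have "t - H = u - H" using tu c half by (intro inj_onD[OF half]) auto
      then show ?thesis by simp
    qed
  qed
qed

lemma constrained: "constrained_loop 1 (2 * H) \<gamma>"
  unfolding constrained_loop_def
proof (intro conjI ballI impI)
  let ?T = "tangent (2 * H) \<gamma>"
  show "0 < 2 * H" using aH by simp
  show "\<gamma> 0 = \<gamma> (2 * H)" by (rule closed_loop)
  show "inj_on \<gamma> {0..<2 * H}" by (rule inj_\<gamma>)
  show "\<gamma> differentiable_on {0..2 * H}"
    unfolding differentiable_on_def using \<gamma>_derivative differentiableI_vector by blast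
  show "continuous_on {0..2 * H} ?T" by (rule contT)
  show "?T 0 = ?T (2 * H)" using closed_loop(2) tangent_\<gamma> aH by simp
  show "norm (?T t) = 1" if "t \<in> {0..2 * H}" for t
    using unit tangent_\<gamma>[OF that] by (simp add: antisym_loop_def)
  show "?T piecewise_C1_differentiable_on {0..2 * H}"
    unfolding piecewise_C1_differentiable_on_def
  proof (intro conjI exI)
    show "continuous_on {0..2 * H} ?T" by (rule contT)
    show "finite {0, a, H, H + a, 2 * H}" by simp
    have "continuous_on ({0..2 * H} - {0, a, H, H + a, 2 * H}) (antisym_loop a H f2 g2)"
    proof (rule continuous_at_imp_continuous_on, rule ballI)
      fix t assume "t \<in> {0..2 * H} - {0, a, H, H + a, 2 * H}"
      then show "isCont (antisym_loop a H f2 g2) t"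
        using antisym_loop_derivative[OF f(3) g(3) aH, of t] has_vector_derivative_continuous by blast
    qed
    then show "?T C1_differentiable_on {0..2 * H} - {0, a, H, H + a, 2 * H}"
      unfolding C1_differentiable_on_def
      by (intro exI[of _ "antisym_loop a H f2 g2"]) (auto intro!: tangent_derivative)
  qed
  show "norm (vector_derivative ?T (at t within {0..2 * H})) \<le> 1"
    if t: "t \<in> {0..2 * H}" and d: "?T differentiable at t within {0..2 * H}" for t
  proof (rule norm_vector_derivative_le_lipschitz)
    show "(?T has_vector_derivative vector_derivative ?T (at t within {0..2 * H})) (at t within {0..2 * H})"
      using d by (simp add: vector_derivative_works)
    show "at t within {0..2 * H} \<noteq> bot" using t aH by (simp add: trivial_limit_within islimpt_Icc)
    show "norm (?T y - ?T t) \<le> 1 * \<bar>y - t\<bar>" if "y \<in> {0..2 * H}" for y by (rule lips[OF t that])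
  qed
qed

text \<open>
  By the explicit formula the curvature vector is non-zero at some point, so the maximal curvature is
  positive and at most one, and the thickness is decided by the double normals.
\<close>

lemma thickness:
  assumes ne: "\<exists>t u. t \<in> {0..2 * H} \<and> u \<in> {0..2 * H} \<and> \<gamma> t \<noteq> \<gamma> u \<and> (\<gamma> t - \<gamma> u) \<bullet> \<tau> t = 0 \<and> (\<gamma> t - \<gamma> u) \<bullet> \<tau> u = 0"
    and dn: "\<And>t u. t \<in> {0..2 * H} \<Longrightarrow> u \<in> {0..2 * H} \<Longrightarrow> \<gamma> t \<noteq> \<gamma> u \<Longrightarrow> (\<gamma> t - \<gamma> u) \<bullet> \<tau> t = 0 \<Longrightarrow>
      (\<gamma> t - \<gamma> u) \<bullet> \<tau> u = 0 \<Longrightarrow> 1 \<le> norm (\<gamma> t - \<gamma> u)"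
  shows "1/2 \<le> thickness_radius (2 * H) \<gamma>"
proof -
  let ?T = "tangent (2 * H) \<gamma>"
  have "1 \<le> R2 (2 * H) \<gamma>"
    unfolding R2_def
  proof (rule cInf_greatest)
    obtain t u where tu: "t \<in> {0..2 * H}" "u \<in> {0..2 * H}" "\<gamma> t \<noteq> \<gamma> u"
      "(\<gamma> t - \<gamma> u) \<bullet> \<tau> t = 0" "(\<gamma> t - \<gamma> u) \<bullet> \<tau> u = 0" using ne by blast
    show "{norm (\<gamma> t - \<gamma> u) |t u. t \<in> {0..2 * H} \<and> u \<in> {0..2 * H} \<and> \<gamma> t \<noteq> \<gamma> u \<and>
       (\<gamma> t - \<gamma> u) \<bullet> ?T t = 0 \<and> (\<gamma> t - \<gamma> u) \<bullet> ?T u = 0} \<noteq> {}"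
    proof -
      have "(\<gamma> t - \<gamma> u) \<bullet> ?T t = 0" "(\<gamma> t - \<gamma> u) \<bullet> ?T u = 0"
        by (simp_all only: tangent_\<gamma>[OF tu(1)] tangent_\<gamma>[OF tu(2)] tu(4,5))
      then show ?thesis using tu(1-3) by blast
    qed
    fix x assume "x \<in> {norm (\<gamma> t - \<gamma> u) |t u. t \<in> {0..2 * H} \<and> u \<in> {0..2 * H} \<and> \<gamma> t \<noteq> \<gamma> u \<and>
       (\<gamma> t - \<gamma> u) \<bullet> ?T t = 0 \<and> (\<gamma> t - \<gamma> u) \<bullet> ?T u = 0}"
    then obtain t u where tu: "t \<in> {0..2 * H}" "u \<in> {0..2 * H}" "\<gamma> t \<noteq> \<gamma> u"
      "(\<gamma> t - \<gamma> u) \<bullet> ?T t = 0" "(\<gamma> t - \<gamma> u) \<bullet> ?T u = 0" "x = norm (\<gamma> t - \<gamma> u)" by blast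
    show "1 \<le> x"
      unfolding tu(6) using tu(4,5) by (intro dn[OF tu(1-3)]) (simp_all only: tangent_\<gamma>[OF tu(1)] tangent_\<gamma>[OF tu(2)])
  qed
  moreover have "1 \<le> R1 (2 * H) \<gamma>"
  proof -
    let ?S = "{norm (vector_derivative ?T (at t within {0..2 * H})) | t.
            t \<in> {0..2 * H} \<and> ?T differentiable (at t within {0..2 * H})}"
    have le: "x \<le> 1" if x: "x \<in> ?S" for x
    proof -
      obtain t where t: "t \<in> {0..2 * H}" "?T differentiable (at t within {0..2 * H})"
        "x = norm (vector_derivative ?T (at t within {0..2 * H}))" using x by blast
      then show ?thesis using constrained[unfolded constrained_loop_def] by blast
    qed
    have "\<exists>t\<in>{0<..<a}. f2 t \<noteq> 0"
    proof (rule ccontr)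
      assume "\<not> ?thesis"
      then have z: "\<And>t. t \<in> {0<..<a} \<Longrightarrow> f2 t = 0" by blast
      have "isCont f2 0" using f(3) has_vector_derivative_continuous by blast
      moreover have "continuous_on {0..a} f2"
        by (meson f(3) has_vector_derivative_continuous continuous_at_imp_continuous_on)
      then have "f2 0 = 0" using continuous_constant_on_closure[of "{0<..<a}" f2 0 0] z aH by simp
      then show False using curv by simp
    qed
    then obtain t where t: "0 < t" "t < a" "f2 t \<noteq> 0" by auto
    have d: "(?T has_vector_derivative f2 t) (at t within {0..2 * H})"
      using tangent_derivative[of t] t aH by (auto simp: antisym_loop_def intro: has_vector_derivative_at_within)
    then have "vector_derivative ?T (at t within {0..2 * H}) = f2 t"
      using vector_derivative_within_cbox[of 0 "2 * H" t ?T "f2 t"] t aH by simp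
    moreover have "?T differentiable (at t within {0..2 * H})" using d by (rule differentiableI_vector)
    moreover have "t \<in> {0..2 * H}" using t aH by simp
    ultimately have mem: "norm (f2 t) \<in> ?S" by (intro CollectI exI[of _ t]) simp
    have "norm (f2 t) \<le> Sup ?S" using mem le by (intro cSup_upper bdd_aboveI[of _ 1]) auto
    then have "0 < Sup ?S" using t(3) by (smt (verit) norm_le_zero_iff)
    moreover have "Sup ?S \<le> 1" using mem le by (intro cSup_least) auto
    ultimately show ?thesis by (simp add: R1_def max_curvature_def)
  qed
  ultimately show ?thesis by (simp add: thickness_radius_def)
qed

end

section \<open>Coordinates in space\<close>

abbreviation vec3 :: "real \<Rightarrow> real \<Rightarrow> real \<Rightarrow> real^3" where
  "vec3 x y z \<equiv> vector [x, y, z]"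

lemma vec3_eq_iff: "v = w \<longleftrightarrow> v $ 1 = w $ 1 \<and> v $ 2 = w $ 2 \<and> v $ 3 = w $ 3" for v w :: "real^3"
  by (simp add: vec_eq_iff forall_3)

lemma inner_vec3: "v \<bullet> w = v $ 1 * w $ 1 + v $ 2 * w $ 2 + v $ 3 * w $ 3" for v w :: "real^3"
  by (simp add: inner_vec_def sum_3)

lemma norm_vec3: "(norm v)\<^sup>2 = (v $ 1)\<^sup>2 + (v $ 2)\<^sup>2 + (v $ 3)\<^sup>2" for v :: "real^3"
  unfolding power2_norm_eq_inner inner_vec3 by (simp add: power2_eq_square)

lemma norm_vec3_le_1: "norm v \<le> 1 \<longleftrightarrow> (v $ 1)\<^sup>2 + (v $ 2)\<^sup>2 + (v $ 3)\<^sup>2 \<le> 1" for v :: "real^3"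
  using abs_square_le_1[of "norm v"] by (simp add: norm_vec3)

lemma norm_vec3_eq_1: "norm v = 1 \<longleftrightarrow> (v $ 1)\<^sup>2 + (v $ 2)\<^sup>2 + (v $ 3)\<^sup>2 = 1" for v :: "real^3"
  by (simp add: norm_eq_1 inner_vec3 power2_eq_square)

lemma norm_vec3_ge_1: "1 \<le> norm v \<longleftrightarrow> 1 \<le> (v $ 1)\<^sup>2 + (v $ 2)\<^sup>2 + (v $ 3)\<^sup>2" for v :: "real^3"
  using one_le_power[of "norm v" 2] power_le_one_iff[of "norm v" 2] power2_le_imp_le[of 1 "norm v"] 
  by (simp add: norm_vec3[symmetric]) fastforce

lemma uminus_vec3: "- vec3 x y z = vec3 (- x) (- y) (- z)"
  by (simp add: vec3_eq_iff)

lemma has_vector_derivative_vec3: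
  assumes "(x has_real_derivative x') (at t)" "(y has_real_derivative y') (at t)" "(z has_real_derivative z') (at t)"
  shows "((\<lambda>t. vec3 (x t) (y t) (z t)) has_vector_derivative vec3 x' y' z') (at t)"
proof -
  have e: "vec3 a b c = a *\<^sub>R axis 1 1 + b *\<^sub>R axis 2 1 + c *\<^sub>R axis 3 1" for a b c
    by (simp add: vec3_eq_iff axis_def)
  show ?thesis
    unfolding e using assms
    by (auto intro!: derivative_eq_intros simp: has_real_derivative_iff_has_vector_derivative)
qed

section \<open>The stadium\<close>

definition "stadium_cap = (\<lambda>t. vec3 (1/2 + sin t) (- cos t) 0)"
definition "stadium_side = (\<lambda>t. vec3 (1/2 + pi - t) 1 0)"

definition stadium :: "(real^3) set" where
  "stadium = {v. v $ 3 = 0 \<and> (max 0 (\<bar>v $ 1\<bar> - 1/2))\<^sup>2 + (v $ 2)\<^sup>2 = 1}"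

interpretation stadium: antisym_data pi "pi + 1" stadium_cap "\<lambda>t. vec3 (cos t) (sin t) 0"
  "\<lambda>t. vec3 (- sin t) (cos t) 0" "\<lambda>t. vec3 (- cos t) (- sin t) 0"
  stadium_side "\<lambda>t. vec3 (-1) 0 0" "\<lambda>t. vec3 0 0 0" "\<lambda>t. vec3 0 0 0"
proof
  show "inj_on stadium_cap {0..<pi}"
    using cos_inj_pi by (auto simp: inj_on_def stadium_cap_def vec3_eq_iff)
  show "stadium_cap t \<noteq> stadium_side u" if "t \<in> {0..<pi}" "u \<in> {pi..<pi + 1}" for t u
  proof
    assume "stadium_cap t = stadium_side u"
    then have "cos t = cos pi" by (simp add: vec3_eq_iff stadium_cap_def stadium_side_def)
    then show False using that cos_inj_pi[of t pi] by auto
  qed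
  show "stadium_cap t \<noteq> - stadium_cap u" if "t \<in> {0..<pi}" "u \<in> {0..<pi}" for t u
    using that sin_ge_zero[of t] sin_ge_zero[of u] by (auto simp: vec3_eq_iff stadium_cap_def)
  show "stadium_cap t \<noteq> - stadium_side u" if "t \<in> {0..<pi}" "u \<in> {pi..<pi + 1}" for t u
    using that sin_ge_zero[of t] by (auto simp: vec3_eq_iff stadium_cap_def stadium_side_def)
qed (auto simp: stadium_cap_def stadium_side_def norm_vec3_eq_1 vec3_eq_iff inj_on_def uminus_vec3 norm_vec3_le_1
      intro!: has_vector_derivative_vec3 derivative_eq_intros)

lemma side_abs_le: "t \<in> {pi..pi + 1} \<Longrightarrow> \<bar>1/2 + pi - t\<bar> \<le> 1/2"
  unfolding atLeastAtMost_iff abs_le_iff by linarith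

lemma stadium_range: "stadium.\<gamma> ` {0..2 * (pi + 1)} = stadium"
  unfolding stadium.range_\<gamma>
proof (intro equalityI subsetI)
  fix v assume "v \<in> (\<Union>s\<in>{1, - 1}. (\<lambda>t. s *\<^sub>R stadium_cap t) ` {0..pi} \<union> (\<lambda>t. s *\<^sub>R stadium_side t) ` {pi..pi + 1})"
  then obtain s t where s: "s \<in> {1, -1}" and v: "t \<in> {0..pi} \<and> v = s *\<^sub>R stadium_cap t \<or> t \<in> {pi..pi + 1} \<and> v = s *\<^sub>R stadium_side t"
    by blast
  from s have s: "\<bar>s\<bar> = 1" by auto
  have s2: "s\<^sup>2 = 1" using s by (metis power2_abs one_power2)
  from v show "v \<in> stadium"
  proof
    assume t: "t \<in> {0..pi} \<and> v = s *\<^sub>R stadium_cap t"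
    then have "\<bar>v $ 1\<bar> = 1/2 + sin t" using s sin_ge_zero[of t] by (simp add: stadium_cap_def abs_mult)
    then show ?thesis using t sin_ge_zero[of t] s2 by (simp add: stadium_def stadium_cap_def power_mult_distrib)
  next
    assume t: "t \<in> {pi..pi + 1} \<and> v = s *\<^sub>R stadium_side t"
    then have "\<bar>v $ 1\<bar> = \<bar>1/2 + pi - t\<bar>" using s by (simp add: stadium_side_def abs_mult)
    then have "\<bar>v $ 1\<bar> \<le> 1/2" using side_abs_le t by simp
    then show ?thesis using t s2 by (simp add: stadium_def stadium_side_def power_mult_distrib)
  qed
next
  fix v assume v: "v \<in> stadium"
  have v3: "v $ 3 = 0" and eq: "(max 0 (\<bar>v $ 1\<bar> - 1/2))\<^sup>2 + (v $ 2)\<^sup>2 = 1" using v by (auto simp: stadium_def)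
  have y: "\<bar>v $ 2\<bar> \<le> 1" using eq by (metis abs_square_le_1 le_add_same_cancel2 zero_le_power2)
  show "v \<in> (\<Union>s\<in>{1, - 1}. (\<lambda>t. s *\<^sub>R stadium_cap t) ` {0..pi} \<union> (\<lambda>t. s *\<^sub>R stadium_side t) ` {pi..pi + 1})"
  proof (cases "\<bar>v $ 1\<bar> < 1/2")
    case True
    then have "(v $ 2)\<^sup>2 = 1" using eq by simp
    then have "v $ 2 = 1 \<or> v $ 2 = -1" by (simp add: power2_eq_1_iff)
    then have "v = 1 *\<^sub>R stadium_side (pi + 1/2 - v $ 1) \<or> v = (-1) *\<^sub>R stadium_side (pi + 1/2 + v $ 1)"
      using v3 by (auto simp: stadium_side_def vec3_eq_iff)
    moreover have "pi + 1/2 - v $ 1 \<in> {pi..pi + 1}" "pi + 1/2 + v $ 1 \<in> {pi..pi + 1}" using True by auto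
    ultimately show ?thesis by blast
  next
    case False
    define s where "s = sgn (v $ 1)"
    define t where "t = arccos (- s * v $ 2)"
    have s: "s \<in> {1, -1}" "s * v $ 1 = \<bar>v $ 1\<bar>" using False by (auto simp: s_def sgn_if)
    have sy: "\<bar>- s * v $ 2\<bar> \<le> 1" using s y by auto
    have t: "t \<in> {0..pi}" "cos t = - s * v $ 2" using sy by (auto simp: t_def abs_le_iff arccos_lbound arccos_ubound)
    have ss: "s * s = 1" using s by auto
    have "(cos t)\<^sup>2 = (v $ 2)\<^sup>2" using ss t(2) by (simp add: power_mult_distrib power2_eq_square[of s])
    then have "(sin t)\<^sup>2 = 1 - (v $ 2)\<^sup>2" by (simp add: sin_squared_eq)
    also have "\<dots> = (\<bar>v $ 1\<bar> - 1/2)\<^sup>2" using eq False by (simp add: max_def)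
    finally have "sin t = \<bar>v $ 1\<bar> - 1/2" using sin_ge_zero[of t] t(1) False by (simp add: power2_eq_iff_nonneg)
    then have "v = s *\<^sub>R stadium_cap t"
      using s ss t(2) v3 by (auto simp: vec3_eq_iff stadium_cap_def)
    then show ?thesis using s(1) t(1) by blast
  qed
qed

text \<open>
  The double normals of both components are classified in this way: in a plane, orthogonality to the
  tangents at both ends amounts to parallelism to both unit normals.
\<close>

lemma common_normal:
  fixes p q x y x' y' :: real
  assumes u: "x\<^sup>2 + y\<^sup>2 = 1" "x'\<^sup>2 + y'\<^sup>2 = 1" and o: "q * x = p * y" "q * x' = p * y'" and ne: "p \<noteq> 0 \<or> q \<noteq> 0"
  obtains k where "k \<noteq> 0" "p = k * x" "q = k * y" "x' = x \<and> y' = y \<or> x' = - x \<and> y' = - y"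
proof -
  define k k' where kk: "k = p * x + q * y" "k' = p * x' + q * y'"
  have "k * x = p * x\<^sup>2 + (q * x) * y" "k * y = (p * y) * x + q * y\<^sup>2"
    "k' * x' = p * x'\<^sup>2 + (q * x') * y'" "k' * y' = (p * y') * x' + q * y'\<^sup>2"
    by (simp_all add: kk power2_eq_square algebra_simps)
  then have "k * x = p * (x\<^sup>2 + y\<^sup>2)" "k * y = q * (x\<^sup>2 + y\<^sup>2)" "k' * x' = p * (x'\<^sup>2 + y'\<^sup>2)" "k' * y' = q * (x'\<^sup>2 + y'\<^sup>2)"
    unfolding o by (simp_all add: o[symmetric] power2_eq_square algebra_simps)
  then have par: "p = k * x" "q = k * y" "p = k' * x'" "q = k' * y'" using u by simp_all
  have "k * k = k * k * (x\<^sup>2 + y\<^sup>2)" using u by simp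
  also have "\<dots> = p * p + q * q" unfolding par(1,2) by (simp add: power2_eq_square algebra_simps)
  also have "\<dots> = k' * k' * (x'\<^sup>2 + y'\<^sup>2)" unfolding par(3,4) by (simp add: power2_eq_square algebra_simps)
  finally have "k' = k \<or> k' = - k" using u by (auto simp: square_eq_iff)
  then have alt: "k' = k \<or> k' = - k" .
  have "k \<noteq> 0"
  proof
    assume "k = 0" then have "p = 0" "q = 0" by (simp_all add: par(1,2))
    then show False using ne by simp
  qed
  from alt have "x' = x \<and> y' = y \<or> x' = - x \<and> y' = - y"
  proof
    assume "k' = k"
    then have "k * x' = k * x" "k * y' = k * y" using par by simp_all
    then show ?thesis using \<open>k \<noteq> 0\<close> by simp
  next
    assume "k' = - k"
    then have "k * x' = k * - x" "k * y' = k * - y" using par by simp_all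
    then have "x' = - x" "y' = - y" using mult_left_cancel[OF \<open>k \<noteq> 0\<close>] by blast+
    then show ?thesis by simp
  qed
  then show ?thesis using that par(1,2) \<open>k \<noteq> 0\<close> by blast
qed

text \<open>
  A stadium is the set of ends of unit normals to its core segment. For a double normal either the two
  unit normals are opposite, and the chord has length at least \<open>2 - 1\<close>, or they agree and the chord
  lies along the core, which is impossible as the tips have a single foot point each.
\<close>

lemma stadium_thick: "thick_knot (1/2) stadium"
proof -
  \<comment> \<open>every point is a unit normal attached to a point of the core segment\<close>
  have normal: "\<exists>c n. stadium.\<gamma> t = vec3 c 0 0 + n \<and> \<bar>c\<bar> \<le> 1/2 \<and> norm n = 1 \<and> n $ 3 = 0 \<and>
      stadium.\<tau> t = vec3 (- n $ 2) (n $ 1) 0 \<and> (n $ 2 = 0 \<longrightarrow> c = n $ 1 / 2)" if "t \<in> {0..2 * (pi + 1)}" for t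
  proof -
    have cap: "\<exists>c n. s *\<^sub>R stadium_cap t = vec3 c 0 0 + n \<and> \<bar>c\<bar> \<le> 1/2 \<and> norm n = 1 \<and> n $ 3 = 0 \<and>
      s *\<^sub>R vec3 (cos t) (sin t) 0 = vec3 (- n $ 2) (n $ 1) 0 \<and> (n $ 2 = 0 \<longrightarrow> c = n $ 1 / 2)"
      if "s \<in> {1, -1}" "t \<in> {0..pi}" for s t
    proof (intro exI conjI)
      let ?n = "s *\<^sub>R vec3 (sin t) (- cos t) 0"
      show "s *\<^sub>R stadium_cap t = vec3 (s / 2) 0 0 + ?n" by (simp add: vec3_eq_iff stadium_cap_def algebra_simps)
      show "norm ?n = 1" using that by (auto simp: norm_vec3_eq_1)
      show "?n $ 2 = 0 \<longrightarrow> s / 2 = ?n $ 1 / 2"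
      proof
        assume "?n $ 2 = 0"
        then have "cos t = 0" using that by auto
        then have "(sin t)\<^sup>2 = 1" by (simp add: sin_squared_eq)
        then have "sin t = 1" using sin_ge_zero[of t] that by (auto simp: power2_eq_1_iff)
        then show "s / 2 = ?n $ 1 / 2" by simp
      qed
    qed (use that in \<open>auto simp: vec3_eq_iff\<close>)
    have side: "\<exists>c n. s *\<^sub>R stadium_side t = vec3 c 0 0 + n \<and> \<bar>c\<bar> \<le> 1/2 \<and> norm n = 1 \<and> n $ 3 = 0 \<and>
      s *\<^sub>R vec3 (-1) 0 0 = vec3 (- n $ 2) (n $ 1) 0 \<and> (n $ 2 = 0 \<longrightarrow> c = n $ 1 / 2)"
      if "s \<in> {1, -1}" "t \<in> {pi..pi + 1}" for s t
    proof -
      have "\<bar>s * (1/2 + pi - t)\<bar> \<le> 1/2" using that side_abs_le[OF that(2)] unfolding abs_mult by auto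
      then show ?thesis
        using that by (intro exI[of _ "s * (1/2 + pi - t)"] exI[of _ "vec3 0 s 0"])
          (auto simp: vec3_eq_iff stadium_side_def norm_vec3_eq_1)
    qed
    consider "t \<le> pi" | "pi < t" "t \<le> pi + 1" | "pi + 1 < t" "t \<le> pi + 1 + pi" | "pi + 1 + pi < t" by linarith
    then show ?thesis
    proof cases
      case 1 then show ?thesis using cap[of 1 t] that by (simp add: antisym_loop_def)
    next
      case 2 then show ?thesis using side[of 1 t] that by (simp add: antisym_loop_def)
    next
      case 3 then show ?thesis using cap[of "-1" "t - (pi + 1)"] that by (simp add: antisym_loop_def)
    next
      case 4
      moreover have "pi + 1 < t" using 4 pi_gt_zero by linarith
      ultimately show ?thesis using side[of "-1" "t - (pi + 1)"] that by (simp add: antisym_loop_def)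
    qed
  qed
  have "1/2 \<le> thickness_radius (2 * (pi + 1)) stadium.\<gamma>"
  proof (rule stadium.thickness)
    have "stadium.\<gamma> (pi / 2) = vec3 (3/2) 0 0" "stadium.\<tau> (pi / 2) = vec3 0 1 0"
      by (simp_all add: antisym_loop_def stadium_cap_def)
    moreover have "stadium.\<gamma> (pi + 1 + pi / 2) = vec3 (-3/2) 0 0" "stadium.\<tau> (pi + 1 + pi / 2) = vec3 0 (-1) 0"
    proof -
      have "\<not> 3 * pi / 2 + 1 \<le> pi" using pi_gt_zero by linarith
      then show "stadium.\<gamma> (pi + 1 + pi / 2) = vec3 (-3/2) 0 0" "stadium.\<tau> (pi + 1 + pi / 2) = vec3 0 (-1) 0"
        by (simp_all add: antisym_loop_def stadium_cap_def uminus_vec3)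
    qed
    ultimately show "\<exists>t u. t \<in> {0..2 * (pi + 1)} \<and> u \<in> {0..2 * (pi + 1)} \<and> stadium.\<gamma> t \<noteq> stadium.\<gamma> u \<and>
       (stadium.\<gamma> t - stadium.\<gamma> u) \<bullet> stadium.\<tau> t = 0 \<and> (stadium.\<gamma> t - stadium.\<gamma> u) \<bullet> stadium.\<tau> u = 0"
      by (intro exI[of _ "pi / 2"] exI[of _ "pi + 1 + pi / 2"]) (simp add: vec3_eq_iff inner_vec3)
  next
    fix t u assume tu: "t \<in> {0..2 * (pi + 1)}" "u \<in> {0..2 * (pi + 1)}" "stadium.\<gamma> t \<noteq> stadium.\<gamma> u"
      "(stadium.\<gamma> t - stadium.\<gamma> u) \<bullet> stadium.\<tau> t = 0" "(stadium.\<gamma> t - stadium.\<gamma> u) \<bullet> stadium.\<tau> u = 0"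
    obtain c n where n: "stadium.\<gamma> t = vec3 c 0 0 + n" "\<bar>c\<bar> \<le> 1/2" "norm n = 1" "n $ 3 = 0"
      "stadium.\<tau> t = vec3 (- n $ 2) (n $ 1) 0" "n $ 2 = 0 \<longrightarrow> c = n $ 1 / 2" using normal[OF tu(1)] by blast
    obtain c' n' where n': "stadium.\<gamma> u = vec3 c' 0 0 + n'" "\<bar>c'\<bar> \<le> 1/2" "norm n' = 1" "n' $ 3 = 0"
      "stadium.\<tau> u = vec3 (- n' $ 2) (n' $ 1) 0" "n' $ 2 = 0 \<longrightarrow> c' = n' $ 1 / 2" using normal[OF tu(2)] by blast
    define x y x' y' where xy: "x = n $ 1" "y = n $ 2" "x' = n' $ 1" "y' = n' $ 2"
    have u: "x\<^sup>2 + y\<^sup>2 = 1" "x'\<^sup>2 + y'\<^sup>2 = 1" using n(3,4) n'(3,4) by (simp_all add: norm_vec3_eq_1 xy)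
    define p q where pq: "p = c - c' + x - x'" "q = y - y'"
    have v: "(stadium.\<gamma> t - stadium.\<gamma> u) $ 1 = p" "(stadium.\<gamma> t - stadium.\<gamma> u) $ 2 = q" "(stadium.\<gamma> t - stadium.\<gamma> u) $ 3 = 0"
      using n n' by (simp_all add: pq xy)
    have o: "q * x = p * y" "q * x' = p * y'"
      using tu(4,5) v unfolding n(5) n'(5) by (simp_all add: inner_vec3 xy)
    have ne: "p \<noteq> 0 \<or> q \<noteq> 0" using tu(3) v by (auto simp: vec3_eq_iff)
    obtain k where par: "p = k * x" "q = k * y" and k0: "k \<noteq> 0" and alt: "x' = x \<and> y' = y \<or> x' = - x \<and> y' = - y"
      using common_normal[OF u o ne] by metis
    from alt have "1 \<le> p\<^sup>2 + q\<^sup>2"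
    proof
      assume e: "x' = x \<and> y' = y"
      then have "q = 0" by (simp add: pq)
      then have "y = 0" using par k0 by auto
      then have "p = 0" using n(6) n'(6) e by (simp add: pq xy)
      then show ?thesis using ne \<open>q = 0\<close> by simp
    next
      assume e: "x' = - x \<and> y' = - y"
      have d: "(c - c')\<^sup>2 \<le> 1\<^sup>2" using n(2) n'(2) by (intro power2_le_iff_abs_le[THEN iffD2]) auto
      have "p\<^sup>2 + q\<^sup>2 = (c - c')\<^sup>2 + 4 * ((c - c') * x) + 4 * (x\<^sup>2 + y\<^sup>2)" 
        using e by (simp add: pq power2_eq_square algebra_simps)
      also have "4 * (x\<^sup>2 + y\<^sup>2) = 4" using u by simp
      finally have pq2: "p\<^sup>2 + q\<^sup>2 = (c - c')\<^sup>2 + 4 * ((c - c') * x) + 4" .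
      have "((c - c') * x)\<^sup>2 \<le> (c - c')\<^sup>2 * 1" 
        using u(1) unfolding power_mult_distrib by (intro mult_left_mono) (auto, smt (verit) zero_le_power2)
      then have 1: "\<bar>(c - c') * x\<bar> \<le> \<bar>c - c'\<bar>" by (simp add: abs_le_square_iff)
      define D where "D = \<bar>c - c'\<bar>"
      have D: "D \<le> 1" "(c - c')\<^sup>2 = D\<^sup>2" using n(2) n'(2) unfolding D_def by (linarith, simp)
      have "0 \<le> (1 - D) * (3 - D)" using D by (intro mult_nonneg_nonneg) auto
      also have "\<dots> = D\<^sup>2 - 4 * D + 3" by (simp add: power2_eq_square algebra_simps)
      finally show ?thesis unfolding pq2 D(2) using 1 unfolding D_def[symmetric] by linarith
    qed
    then show "1 \<le> norm (stadium.\<gamma> t - stadium.\<gamma> u)" unfolding norm_vec3_ge_1 v by simp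
  qed
  then show ?thesis unfolding thick_knot_def using stadium.constrained stadium_range by metis
qed

section \<open>The peanuts\<close>

text \<open>
  A planar curve made of four arcs of radius \<open>R\<close>: two neck arcs bulging towards each other, centred at
  \<open>\<plusminus>(R + 1/2)\<close> on the first axis, and two bulbs centred at height \<open>\<plusminus> 2 * R * sin \<beta>\<close>. The circles
  of neighbouring arcs touch, and \<open>\<beta>\<close> is the angle of the point of contact. The two strands of the
  neck are at distance one in the middle. The bound \<open>R < 3/2\<close> lets the stadium pass over a bulb if
  thickness is ignored.
\<close>

locale peanut =
  fixes R \<beta> :: real
  assumes R: "1 \<le> R" "R < 3/2" and \<beta>: "0 < \<beta>" "\<beta> < pi / 2" and cos_\<beta>: "2 * R * cos \<beta> = R + 1/2"
begin

definition "neck = (\<lambda>t. vec3 (1/2 + R - R * cos (t / R - \<beta>)) 0 (R * sin (t / R - \<beta>)))"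
definition "bulb = (\<lambda>t. vec3 (- R * sin (t / R - 3 * \<beta> - pi / 2)) 0 (2 * R * sin \<beta> + R * cos (t / R - 3 * \<beta> - pi / 2)))"

definition carrier :: "(real^3) set" where
  "carrier = {v. v $ 2 = 0 \<and> (\<bar>v $ 3\<bar> \<le> R * sin \<beta> \<and> \<bar>v $ 1\<bar> = 1/2 + R - sqrt (R\<^sup>2 - (v $ 3)\<^sup>2) \<or>
     R * sin \<beta> \<le> \<bar>v $ 3\<bar> \<and> (v $ 1)\<^sup>2 + (\<bar>v $ 3\<bar> - 2 * R * sin \<beta>)\<^sup>2 = R\<^sup>2)}"

lemma sin_\<beta>: "0 < sin \<beta>" and cos_pos: "0 < cos \<beta>"
  using \<beta> by (auto intro!: sin_gt_zero cos_gt_zero)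

lemma height: "(2 * R * sin \<beta>)\<^sup>2 + (R + 1/2)\<^sup>2 = (2 * R)\<^sup>2"
proof -
  have "(2 * R * sin \<beta>)\<^sup>2 + (2 * R * cos \<beta>)\<^sup>2 = (2 * R)\<^sup>2 * ((sin \<beta>)\<^sup>2 + (cos \<beta>)\<^sup>2)"
    by (simp only: power_mult_distrib distrib_left)
  then show ?thesis by (simp add: cos_\<beta>)
qed

lemma height_ge_1: "1 \<le> 2 * R * sin \<beta>"
proof -
  have "(2 * R)\<^sup>2 - (R + 1/2)\<^sup>2 = 1 + (R - 1) * (3 * R + 2) + 3/4" by (simp add: power2_eq_square algebra_simps)
  moreover have "0 \<le> (R - 1) * (3 * R + 2)" using R by simp
  ultimately have "1\<^sup>2 \<le> (2 * R * sin \<beta>)\<^sup>2" using height by simp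
  then show ?thesis by (rule power2_le_imp_le) (use R sin_\<beta> in simp)
qed

lemma sin_cos_bulb_ends:
  "sin (- \<beta> - pi / 2) = - cos \<beta>" "cos (- \<beta> - pi / 2) = - sin \<beta>"
  "sin (\<beta> + pi / 2) = cos \<beta>" "cos (\<beta> + pi / 2) = - sin \<beta>"
  by (simp_all add: sin_diff cos_diff sin_add cos_add)

lemma neck_angle: "t / R - \<beta> \<in> {-\<beta>..\<beta>}" if "t \<in> {0..2 * \<beta> * R}"
  using that R by (auto simp: field_simps)

lemma bulb_angle: "t / R - 3 * \<beta> - pi / 2 \<in> {- (\<beta> + pi / 2)..\<beta> + pi / 2}" if "t \<in> {2 * \<beta> * R..R * (pi + 4 * \<beta>)}"
  using that R by (auto simp: field_simps)

lemma neck_bounds: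
  assumes t: "t \<in> {0..2 * \<beta> * R}"
  shows "1/2 \<le> neck t $ 1" "\<bar>neck t $ 3\<bar> \<le> R * sin \<beta>" "0 \<le> cos (t / R - \<beta>)"
proof -
  have "R * cos (t / R - \<beta>) \<le> R * 1" using R by (intro mult_left_mono) auto
  then show "1/2 \<le> neck t $ 1" by (simp add: neck_def)
  define y where "y = t / R - \<beta>"
  have y: "- \<beta> \<le> y" "y \<le> \<beta>" using neck_angle[OF t] by (simp_all add: y_def)
  have "sin y \<le> sin \<beta>" "sin (- \<beta>) \<le> sin y"
    using y \<beta> by (intro sin_monotone_2pi_le; linarith)+
  then have "\<bar>sin (t / R - \<beta>)\<bar> \<le> sin \<beta>" by (simp add: y_def)
  then show "\<bar>neck t $ 3\<bar> \<le> R * sin \<beta>" using R by (simp add: neck_def abs_mult)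
  show "0 \<le> cos (t / R - \<beta>)" using y \<beta> unfolding y_def[symmetric] by (intro cos_ge_zero; linarith)
qed

lemma neck_below:
  assumes t: "t \<in> {0..<2 * \<beta> * R}"
  shows "neck t $ 3 < R * sin \<beta>"
proof -
  have "t / R - \<beta> < \<beta>" using t R by (simp add: field_simps)
  moreover have "- \<beta> \<le> t / R - \<beta>" using neck_angle[of t] t by simp
  ultimately have "sin (t / R - \<beta>) < sin \<beta>" using \<beta> by (intro sin_monotone_2pi) auto
  then show ?thesis using R by (simp add: neck_def)
qed

lemma bulb_above:
  assumes t: "t \<in> {2 * \<beta> * R..R * (pi + 4 * \<beta>)}"
  shows "R * sin \<beta> \<le> bulb t $ 3"
proof -
  have "cos (\<beta> + pi / 2) \<le> cos \<bar>t / R - 3 * \<beta> - pi / 2\<bar>"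
    using bulb_angle[OF t] \<beta> by (intro cos_monotone_0_pi_le) auto
  then have "- sin \<beta> \<le> cos (t / R - 3 * \<beta> - pi / 2)" by (simp add: cos_add)
  then have "R * (- sin \<beta>) \<le> R * cos (t / R - 3 * \<beta> - pi / 2)" using R by (intro mult_left_mono) auto
  then show ?thesis by (simp add: bulb_def)
qed

text \<open>
  A bulb descends to the height of the neck at its two ends only, and the end with negative first
  coordinate is not in the half-open parameter interval.
\<close>

lemma bulb_left_end:
  assumes t: "t \<in> {2 * \<beta> * R..<R * (pi + 4 * \<beta>)}" and low: "bulb t $ 3 \<le> R * sin \<beta>"
  shows "0 < bulb t $ 1"
proof -
  define w where "w = t / R - 3 * \<beta> - pi / 2"
  have w: "w < \<beta> + pi / 2" "- (\<beta> + pi / 2) \<le> w" using t R by (auto simp: w_def field_simps)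
  have "R * cos w \<le> R * (- sin \<beta>)" using low by (simp add: bulb_def w_def)
  then have "cos w \<le> - sin \<beta>" by (rule mult_left_le_imp_le) (use R in simp)
  then have "cos \<bar>w\<bar> \<le> cos (\<beta> + pi / 2)" by (simp add: cos_add)
  then have "\<beta> + pi / 2 \<le> \<bar>w\<bar>" using w \<beta> by (subst (asm) cos_mono_le_eq) auto
  then have "w = - (\<beta> + pi / 2)" using w by linarith
  then have "bulb t $ 1 = R * cos \<beta>" unfolding bulb_def by (simp add: sin_cos_bulb_ends flip: w_def)
  then show ?thesis using R cos_pos by simp
qed

sublocale antisym_data "2 * \<beta> * R" "R * (pi + 4 * \<beta>)" neck
  "\<lambda>t. vec3 (sin (t / R - \<beta>)) 0 (cos (t / R - \<beta>))"
  "\<lambda>t. vec3 (cos (t / R - \<beta>) / R) 0 (- sin (t / R - \<beta>) / R)"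
  "\<lambda>t. vec3 (- sin (t / R - \<beta>) / R / R) 0 (- cos (t / R - \<beta>) / R / R)"
  bulb
  "\<lambda>t. vec3 (- cos (t / R - 3 * \<beta> - pi / 2)) 0 (- sin (t / R - 3 * \<beta> - pi / 2))"
  "\<lambda>t. vec3 (sin (t / R - 3 * \<beta> - pi / 2) / R) 0 (- cos (t / R - 3 * \<beta> - pi / 2) / R)"
  "\<lambda>t. vec3 (cos (t / R - 3 * \<beta> - pi / 2) / R / R) 0 (sin (t / R - 3 * \<beta> - pi / 2) / R / R)"
proof
  have Rne: "R \<noteq> 0" "0 < R" using R by auto
  show "0 < 2 * \<beta> * R" using R \<beta> by simp
  show "2 * \<beta> * R < R * (pi + 4 * \<beta>)" 
  proof -
    have "R * (pi + 4 * \<beta>) = 2 * \<beta> * R + R * (pi + 2 * \<beta>)" by (simp add: algebra_simps)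
    moreover have "0 < R * (pi + 2 * \<beta>)" using Rne \<beta> pi_gt_zero by (intro mult_pos_pos) linarith+
    ultimately show ?thesis by linarith
  qed
  show "(neck has_vector_derivative vec3 (sin (t / R - \<beta>)) 0 (cos (t / R - \<beta>))) (at t)" for t
    unfolding neck_def using Rne by (auto intro!: has_vector_derivative_vec3 derivative_eq_intros)
  show "(bulb has_vector_derivative vec3 (- cos (t / R - 3 * \<beta> - pi / 2)) 0 (- sin (t / R - 3 * \<beta> - pi / 2))) (at t)" for t
    unfolding bulb_def using Rne by (auto intro!: has_vector_derivative_vec3 derivative_eq_intros)
  show "norm (vec3 (cos (t / R - \<beta>) / R) 0 (- sin (t / R - \<beta>) / R)) \<le> 1" for t
    using R by (simp add: norm_vec3_le_1 power_divide add_divide_distrib[symmetric] one_le_power)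
  show "norm (vec3 (sin (t / R - 3 * \<beta> - pi / 2) / R) 0 (- cos (t / R - 3 * \<beta> - pi / 2) / R)) \<le> 1" for t
    using R by (simp add: norm_vec3_le_1 power_divide add_divide_distrib[symmetric] one_le_power)
  have a0: "2 * \<beta> * R / R - 3 * \<beta> - pi / 2 = - (\<beta> + pi / 2)" "R * (pi + 4 * \<beta>) / R - 3 * \<beta> - pi / 2 = \<beta> + pi / 2"
    using Rne by (simp_all add: field_simps)
  have a1: "2 * \<beta> * R / R - \<beta> = \<beta>" using Rne by simp
  show "neck (2 * \<beta> * R) = bulb (2 * \<beta> * R)"
    unfolding neck_def bulb_def a0 a1 using cos_\<beta> by (simp add: vec3_eq_iff sin_cos_bulb_ends)
  show "bulb (R * (pi + 4 * \<beta>)) = - neck 0"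
    unfolding neck_def bulb_def a0 using cos_\<beta> by (simp add: vec3_eq_iff sin_cos_bulb_ends)
  show "vec3 (sin (2 * \<beta> * R / R - \<beta>)) 0 (cos (2 * \<beta> * R / R - \<beta>)) =
    vec3 (- cos (2 * \<beta> * R / R - 3 * \<beta> - pi / 2)) 0 (- sin (2 * \<beta> * R / R - 3 * \<beta> - pi / 2))"
    unfolding a0 a1 by (simp add: vec3_eq_iff sin_cos_bulb_ends)
  show "vec3 (- cos (R * (pi + 4 * \<beta>) / R - 3 * \<beta> - pi / 2)) 0 (- sin (R * (pi + 4 * \<beta>) / R - 3 * \<beta> - pi / 2)) =
    - vec3 (sin (0 / R - \<beta>)) 0 (cos (0 / R - \<beta>))"
    unfolding a0 by (simp add: vec3_eq_iff sin_cos_bulb_ends)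
  show "vec3 (cos (0 / R - \<beta>) / R) 0 (- sin (0 / R - \<beta>) / R) \<noteq> 0"
    using sin_\<beta> Rne by (auto simp: vec3_eq_iff)
  show "inj_on neck {0..<2 * \<beta> * R}"
  proof (rule inj_onI)
    fix t u assume tu: "t \<in> {0..<2 * \<beta> * R}" "u \<in> {0..<2 * \<beta> * R}" "neck t = neck u"
    then have e: "sin (t / R - \<beta>) = sin (u / R - \<beta>)" using Rne by (simp add: neck_def vec3_eq_iff)
    have "t / R - \<beta> \<in> {-\<beta>..\<beta>}" "u / R - \<beta> \<in> {-\<beta>..\<beta>}"
      using tu(1,2) by (intro neck_angle; simp)+
    then have b: "- \<beta> \<le> t / R - \<beta>" "t / R - \<beta> \<le> \<beta>" "- \<beta> \<le> u / R - \<beta>" "u / R - \<beta> \<le> \<beta>"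
      unfolding atLeastAtMost_iff by blast+
    have "t / R - \<beta> = u / R - \<beta>"
      by (rule sin_inj_pi[OF _ _ _ _ e]) (use b \<beta> in linarith)+
    then show "t = u" using Rne by simp
  qed
  show "inj_on bulb {2 * \<beta> * R..<R * (pi + 4 * \<beta>)}"
  proof (rule inj_onI)
    fix t u assume tu: "t \<in> {2 * \<beta> * R..<R * (pi + 4 * \<beta>)}" "u \<in> {2 * \<beta> * R..<R * (pi + 4 * \<beta>)}" "bulb t = bulb u"
    define w w' where "w = t / R - 3 * \<beta> - pi / 2" and "w' = u / R - 3 * \<beta> - pi / 2"
    have "sin w = sin w' \<and> cos w = cos w'" using tu(3) Rne by (simp add: bulb_def vec3_eq_iff w_def w'_def)
    then obtain n :: int where n: "w = w' + 2 * pi * n" using sin_cos_eq_iff by blast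
    have "\<bar>w - w'\<bar> < 2 * pi"
      using bulb_angle[of t] bulb_angle[of u] tu(1,2) \<beta> unfolding w_def[symmetric] w'_def[symmetric] by auto
    then have "2 * pi * \<bar>real_of_int n\<bar> < 2 * pi * 1" using n by (simp add: abs_mult)
    then have "\<bar>real_of_int n\<bar> < 1" using pi_gt_zero by (simp only: mult_less_cancel_left_pos)
    then have "n = 0" by linarith
    then show "t = u" using n Rne by (simp add: w_def w'_def)
  qed
  show "neck t \<noteq> bulb u" if "t \<in> {0..<2 * \<beta> * R}" "u \<in> {2 * \<beta> * R..<R * (pi + 4 * \<beta>)}" for t u
    using neck_below[OF that(1)] bulb_above[of u] that(2) by auto
  show "neck t \<noteq> - neck u" if "t \<in> {0..<2 * \<beta> * R}" "u \<in> {0..<2 * \<beta> * R}" for t u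
  proof
    assume "neck t = - neck u"
    then have "neck t $ 1 = - neck u $ 1" by simp
    then show False using neck_bounds(1)[of t] neck_bounds(1)[of u] that by auto
  qed
  show "neck t \<noteq> - bulb u" if "t \<in> {0..<2 * \<beta> * R}" "u \<in> {2 * \<beta> * R..<R * (pi + 4 * \<beta>)}" for t u
  proof
    assume "neck t = - bulb u"
    then have e: "neck t $ 1 = - bulb u $ 1" "neck t $ 3 = - bulb u $ 3" by simp_all
    have "\<bar>neck t $ 3\<bar> \<le> R * sin \<beta>" "1/2 \<le> neck t $ 1" using neck_bounds(1,2)[of t] that by auto
    then have "bulb u $ 3 \<le> R * sin \<beta>" "bulb u $ 1 < 0" using e by linarith+
    then show False using bulb_left_end[OF that(2)] by linarith
  qed
  show "bulb t \<noteq> - bulb u" if "t \<in> {2 * \<beta> * R..<R * (pi + 4 * \<beta>)}" "u \<in> {2 * \<beta> * R..<R * (pi + 4 * \<beta>)}" for t u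
  proof
    assume "bulb t = - bulb u"
    then have "bulb t $ 3 = - bulb u $ 3" by simp
    moreover have "0 < R * sin \<beta>" using Rne sin_\<beta> by simp
    ultimately show False using bulb_above[of t] bulb_above[of u] that by auto
  qed
qed (use R in \<open>auto simp: norm_vec3_eq_1 intro!: has_vector_derivative_vec3 derivative_eq_intros\<close>)

lemma range_carrier: "\<gamma> ` {0..2 * (R * (pi + 4 * \<beta>))} = carrier"
  unfolding range_\<gamma>
proof (intro equalityI subsetI)
  fix v assume "v \<in> (\<Union>s\<in>{1, - 1}. (\<lambda>t. s *\<^sub>R neck t) ` {0..2 * \<beta> * R} \<union> (\<lambda>t. s *\<^sub>R bulb t) ` {2 * \<beta> * R..R * (pi + 4 * \<beta>)})"
  then obtain s t where s: "s \<in> {1, -1}" and v: "t \<in> {0..2 * \<beta> * R} \<and> v = s *\<^sub>R neck t \<or> t \<in> {2 * \<beta> * R..R * (pi + 4 * \<beta>)} \<and> v = s *\<^sub>R bulb t"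
    by blast
  have abs: "\<bar>s * y\<bar> = \<bar>y\<bar>" "(s * y)\<^sup>2 = y\<^sup>2" for y using s by auto
  from v show "v \<in> carrier"
  proof
    assume t: "t \<in> {0..2 * \<beta> * R} \<and> v = s *\<^sub>R neck t"
    note b = neck_bounds[OF conjunct1[OF t]]
    have "R\<^sup>2 - (neck t $ 3)\<^sup>2 = (R * cos (t / R - \<beta>))\<^sup>2"
      by (simp add: neck_def power_mult_distrib cos_squared_eq algebra_simps)
    then have "sqrt (R\<^sup>2 - (neck t $ 3)\<^sup>2) = R * cos (t / R - \<beta>)" using b(3) R by (simp add: real_sqrt_unique)
    then have "\<bar>neck t $ 1\<bar> = 1/2 + R - sqrt (R\<^sup>2 - (neck t $ 3)\<^sup>2)" using b(1) by (simp add: neck_def)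
    moreover have "v $ 2 = 0" using t by (simp add: neck_def)
    ultimately show ?thesis using b(2) t by (simp add: carrier_def abs)
  next
    assume t: "t \<in> {2 * \<beta> * R..R * (pi + 4 * \<beta>)} \<and> v = s *\<^sub>R bulb t"
    note b = bulb_above[OF conjunct1[OF t]]
    have "0 < R * sin \<beta>" using R sin_\<beta> by simp
    then have z: "\<bar>bulb t $ 3\<bar> = bulb t $ 3" using b by simp
    have "(bulb t $ 1)\<^sup>2 + (bulb t $ 3 - 2 * R * sin \<beta>)\<^sup>2 = R\<^sup>2 * ((sin (t / R - 3 * \<beta> - pi / 2))\<^sup>2 + (cos (t / R - 3 * \<beta> - pi / 2))\<^sup>2)"
      unfolding distrib_left by (simp add: bulb_def power_mult_distrib)
    then have "(bulb t $ 1)\<^sup>2 + (bulb t $ 3 - 2 * R * sin \<beta>)\<^sup>2 = R\<^sup>2" by simp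
    moreover have "v $ 2 = 0" using t by (simp add: bulb_def)
    ultimately show ?thesis using b t by (simp add: carrier_def abs z)
  qed
next
  fix v assume v: "v \<in> carrier"
  have v2: "v $ 2 = 0" using v by (simp add: carrier_def)
  have Rp: "0 < R" using R by simp
  consider "\<bar>v $ 3\<bar> \<le> R * sin \<beta>" "\<bar>v $ 1\<bar> = 1/2 + R - sqrt (R\<^sup>2 - (v $ 3)\<^sup>2)"
    | "R * sin \<beta> \<le> \<bar>v $ 3\<bar>" "(v $ 1)\<^sup>2 + (\<bar>v $ 3\<bar> - 2 * R * sin \<beta>)\<^sup>2 = R\<^sup>2"
    using v by (auto simp: carrier_def)
  then show "v \<in> (\<Union>s\<in>{1, - 1}. (\<lambda>t. s *\<^sub>R neck t) ` {0..2 * \<beta> * R} \<union> (\<lambda>t. s *\<^sub>R bulb t) ` {2 * \<beta> * R..R * (pi + 4 * \<beta>)})"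
  proof cases
    case 1
    have "sqrt (R\<^sup>2 - (v $ 3)\<^sup>2) \<le> sqrt (R\<^sup>2)" by (intro real_sqrt_le_mono) simp
    then have "1/2 \<le> \<bar>v $ 1\<bar>" using 1(2) Rp by simp
    define s where "s = sgn (v $ 1)"
    have s: "s \<in> {1, -1}" "s * v $ 1 = \<bar>v $ 1\<bar>" "s * s = 1" using \<open>1/2 \<le> \<bar>v $ 1\<bar>\<close> by (auto simp: s_def sgn_if)
    define c where "c = s * v $ 3 / R"
    have c: "\<bar>c\<bar> \<le> sin \<beta>" "\<bar>c\<bar> \<le> 1"
    proof -
      have "\<bar>c\<bar> * R = \<bar>v $ 3\<bar>" using s(1) Rp by (auto simp: c_def abs_mult)
      then have "\<bar>c\<bar> * R \<le> sin \<beta> * R" using 1 by (simp add: mult.commute)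
      then show "\<bar>c\<bar> \<le> sin \<beta>" using Rp by simp
      then show "\<bar>c\<bar> \<le> 1" using sin_le_one[of \<beta>] by linarith
    qed
    define \<psi> where "\<psi> = arcsin c"
    have sin\<psi>: "sin \<psi> = c" using c by (simp add: \<psi>_def abs_le_iff)
    have "arcsin c \<le> arcsin (sin \<beta>)" "arcsin (sin (- \<beta>)) \<le> arcsin c"
      using c sin_\<beta> by (intro arcsin_le_arcsin; simp add: abs_le_iff)+
    moreover have "arcsin (sin \<beta>) = \<beta>" "arcsin (sin (- \<beta>)) = - \<beta>" using \<beta> by (intro arcsin_sin; linarith)+
    ultimately have \<psi>: "- \<beta> \<le> \<psi>" "\<psi> \<le> \<beta>" unfolding \<psi>_def by linarith+
    define t where "t = R * (\<psi> + \<beta>)"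
    have tR: "t / R - \<beta> = \<psi>" using Rp by (simp add: t_def)
    have "0 \<le> R * (\<psi> + \<beta>)" "R * (\<psi> + \<beta>) \<le> R * (2 * \<beta>)"
      using \<psi> Rp by (intro mult_nonneg_nonneg mult_left_mono; linarith)+
    then have t: "t \<in> {0..2 * \<beta> * R}" by (simp add: t_def mult.commute mult.left_commute)
    have "0 \<le> cos \<psi>" using \<psi> \<beta> by (intro cos_ge_zero) auto
    moreover have "(R * cos \<psi>)\<^sup>2 = R\<^sup>2 - (v $ 3)\<^sup>2"
    proof -
      have "(R * cos \<psi>)\<^sup>2 = R\<^sup>2 - (R * c)\<^sup>2" by (simp add: power_mult_distrib cos_squared_eq sin\<psi> algebra_simps)
      also have "R * c = s * v $ 3" using Rp by (simp add: c_def)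
      finally show ?thesis using s by (simp add: power_mult_distrib power2_eq_square)
    qed
    ultimately have "sqrt (R\<^sup>2 - (v $ 3)\<^sup>2) = R * cos \<psi>" using Rp by (intro real_sqrt_unique) auto
    then have x: "s * v $ 1 = neck t $ 1" unfolding neck_def tR using 1 s by simp
    have z: "s * v $ 3 = neck t $ 3" unfolding neck_def tR using Rp by (simp add: sin\<psi> c_def)
    have "v = s *\<^sub>R neck t"
      using v2 x[symmetric] z[symmetric] s(3) by (simp add: vec3_eq_iff neck_def mult.assoc[symmetric])
    then show ?thesis using s(1) t by blast
  next
    case 2
    have pos: "0 < R * sin \<beta>" using Rp sin_\<beta> by simp
    define s where "s = sgn (v $ 3)"
    have s: "s \<in> {1, -1}" "s * v $ 3 = \<bar>v $ 3\<bar>" "s * s = 1" using 2(1) pos by (auto simp: s_def sgn_if)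
    define c where "c = (\<bar>v $ 3\<bar> - 2 * R * sin \<beta>) / R"
    have cR: "R * c = \<bar>v $ 3\<bar> - 2 * R * sin \<beta>" using Rp by (simp add: c_def)
    have "(R * c)\<^sup>2 \<le> R\<^sup>2" using 2(2) unfolding cR by (smt (verit) zero_le_power2)
    then have "R\<^sup>2 * c\<^sup>2 \<le> R\<^sup>2 * 1" by (simp add: power_mult_distrib)
    then have "c\<^sup>2 \<le> 1" using Rp by (simp only: mult_le_cancel_left_pos zero_less_power)
    then have c1: "\<bar>c\<bar> \<le> 1" by (simp add: abs_square_le_1)
    have "R * (- sin \<beta>) \<le> R * c" using 2(1) unfolding cR by simp
    then have c2: "- sin \<beta> \<le> c" using Rp by (simp only: mult_le_cancel_left_pos)
    define r where "r = (if s * v $ 1 \<le> 0 then 1 else -1 :: real)"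
    have r: "r \<in> {1, -1}" "r * r = 1" "- r * (s * v $ 1) = \<bar>s * v $ 1\<bar>" by (auto simp: r_def)
    define w where "w = r * arccos c"
    have cosw: "cos w = c" using r(1) c1 by (auto simp: w_def abs_le_iff)
    have "arccos c \<le> arccos (cos (\<beta> + pi / 2))"
      using c1 c2 by (intro arccos_le_arccos) (auto simp: cos_add abs_le_iff)
    then have aw: "arccos c \<le> \<beta> + pi / 2" using \<beta> by (subst (asm) arccos_cos) auto
    have "0 \<le> arccos c" using c1 by (intro arccos_lbound) (auto simp: abs_le_iff)
    then have w: "- (\<beta> + pi / 2) \<le> w" "w \<le> \<beta> + pi / 2" using aw r(1) by (auto simp: w_def)
    have sinw: "R * sin w = - (s * v $ 1)"
    proof -
      have "(R * sin (arccos c))\<^sup>2 = R\<^sup>2 - (R * c)\<^sup>2"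
        using c1 by (simp add: power_mult_distrib sin_squared_eq algebra_simps abs_le_iff)
      also have "\<dots> = (s * v $ 1)\<^sup>2" using 2(2) s(3) unfolding cR by (simp add: power_mult_distrib power2_eq_square[of s])
      finally have "\<bar>R * sin (arccos c)\<bar> = \<bar>s * v $ 1\<bar>" by (simp only: power2_eq_iff abs_eq_iff)
      moreover have "0 \<le> sin (arccos c)" using c1 by (intro sin_ge_zero arccos_lbound arccos_ubound) (auto simp: abs_le_iff)
      ultimately have "R * sin (arccos c) = - r * (s * v $ 1)" using r(3) Rp by simp
      then have "r * (R * sin (arccos c)) = - (s * v $ 1)" using r(2) by simp
      moreover have "sin w = r * sin (arccos c)" using r(1) by (auto simp: w_def)
      ultimately show ?thesis by (simp add: ac_simps)
    qed
    define t where "t = R * (w + 3 * \<beta> + pi / 2)"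
    have tR: "t / R - 3 * \<beta> - pi / 2 = w" using Rp by (simp add: t_def)
    have t: "t \<in> {2 * \<beta> * R..R * (pi + 4 * \<beta>)}"
    proof -
      have "2 * \<beta> * R = R * (2 * \<beta>)" by simp
      then show ?thesis using w Rp unfolding t_def atLeastAtMost_iff by (simp add: mult_le_cancel_left_pos)
    qed
    have x: "s * v $ 1 = bulb t $ 1" unfolding bulb_def tR using sinw by simp
    have z: "s * v $ 3 = bulb t $ 3" unfolding bulb_def tR using s(2) cR by (simp add: cosw)
    have "v = s *\<^sub>R bulb t"
      using v2 x[symmetric] z[symmetric] s(3) by (simp add: vec3_eq_iff bulb_def mult.assoc[symmetric])
    then show ?thesis using s(1) t by blast
  qed
qed

text \<open>
  Every point of the curve is \<open>c + R * n\<close> for the centre \<open>c\<close> of its arc and a unit normal \<open>n\<close>. For a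
  double normal the two normals agree up to sign. Arcs of the same circle then give a diameter, opposite
  necks and opposite bulbs are at distance at least one, and for a neck and a bulb the centres are at
  distance \<open>2 * R\<close>, so the line of the chord contains both centres and the chord has length \<open>2 * R\<close>
  or \<open>4 * R\<close>.
\<close>

lemma thick: "thick_knot (1/2) carrier"
proof -
  have Rp: "0 < R" using R by simp
  define h where "h = 2 * R * sin \<beta>"
  \<comment> \<open>the centre \<open>(c, d)\<close> of an arc, with a half-plane that contains the arcs around this centre\<close>
  define center where "center s c d v \<longleftrightarrow> (c = s * (R + 1/2) \<and> d = 0 \<and> 1/2 \<le> s * v $ 1) \<or> (c = 0 \<and> d = s * h \<and> h / 2 \<le> s * v $ 3)"
    for s c d :: real and v :: "real^3"
  define nrm where "nrm v t = (\<exists>s c d x z. s \<in> {1, -1} \<and> center s c d v \<and> v = vec3 (c + R * x) 0 (d + R * z) \<and>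
     x\<^sup>2 + z\<^sup>2 = 1 \<and> (t = vec3 z 0 (- x) \<or> t = vec3 (- z) 0 x))" for v t :: "real^3"
  have nrmI: "nrm v t" if "s \<in> {1, -1}" "center s c d v" "v = vec3 (c + R * x) 0 (d + R * z)" "x\<^sup>2 + z\<^sup>2 = 1"
      "t = vec3 z 0 (- x) \<or> t = vec3 (- z) 0 x" for s c d x z v t
    unfolding nrm_def using that by blast
  have ss: "s * (s * y) = y" "s\<^sup>2 = 1" if "s \<in> {1, -1}" for s y :: real using that by auto
  have normal: "nrm (\<gamma> t) (\<tau> t)" if t: "t \<in> {0..2 * (R * (pi + 4 * \<beta>))}" for t
  proof -
    have cap: "nrm (s *\<^sub>R neck t) (s *\<^sub>R vec3 (sin (t / R - \<beta>)) 0 (cos (t / R - \<beta>)))"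
      if s: "s \<in> {1, -1}" and t: "t \<in> {0..2 * \<beta> * R}" for s t
    proof (rule nrmI[OF s])
      show "center s (s * (R + 1/2)) 0 (s *\<^sub>R neck t)"
        using neck_bounds(1)[OF t] by (simp add: center_def ss[OF s])
      show "s *\<^sub>R neck t = vec3 (s * (R + 1/2) + R * (s * (- cos (t / R - \<beta>)))) 0 (0 + R * (s * sin (t / R - \<beta>)))"
        by (simp add: vec3_eq_iff neck_def algebra_simps)
      show "(s * (- cos (t / R - \<beta>)))\<^sup>2 + (s * sin (t / R - \<beta>))\<^sup>2 = 1"
        by (simp add: power_mult_distrib ss[OF s])
    qed (simp add: vec3_eq_iff)
    have bul: "nrm (s *\<^sub>R bulb t) (s *\<^sub>R vec3 (- cos (t / R - 3 * \<beta> - pi / 2)) 0 (- sin (t / R - 3 * \<beta> - pi / 2)))"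
      if s: "s \<in> {1, -1}" and t: "t \<in> {2 * \<beta> * R..R * (pi + 4 * \<beta>)}" for s t
    proof (rule nrmI[OF s])
      show "center s 0 (s * h) (s *\<^sub>R bulb t)"
        using bulb_above[OF t] by (simp add: center_def ss[OF s] h_def)
      show "s *\<^sub>R bulb t = vec3 (0 + R * (s * (- sin (t / R - 3 * \<beta> - pi / 2)))) 0 (s * h + R * (s * cos (t / R - 3 * \<beta> - pi / 2)))"
        by (simp add: vec3_eq_iff bulb_def h_def algebra_simps)
      show "(s * (- sin (t / R - 3 * \<beta> - pi / 2)))\<^sup>2 + (s * cos (t / R - 3 * \<beta> - pi / 2))\<^sup>2 = 1"
        by (simp add: power_mult_distrib ss[OF s])
    qed (simp add: vec3_eq_iff)
    let ?H = "R * (pi + 4 * \<beta>)"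
    consider "t \<le> 2 * \<beta> * R" | "2 * \<beta> * R < t" "t \<le> ?H" | "2 * \<beta> * R < t" "?H < t" "t \<le> ?H + 2 * \<beta> * R"
      | "2 * \<beta> * R < t" "?H < t" "?H + 2 * \<beta> * R < t"
      using aH by linarith
    then show ?thesis
    proof cases
      case 1 then show ?thesis using cap[of 1 t] t by (simp add: antisym_loop_def)
    next
      case 2 then show ?thesis using bul[of 1 t] t by (simp add: antisym_loop_def)
    next
      case 3
      then have "\<gamma> t = (-1) *\<^sub>R neck (t - ?H)"
         "\<tau> t = (-1) *\<^sub>R vec3 (sin ((t - ?H) / R - \<beta>)) 0 (cos ((t - ?H) / R - \<beta>))"
        by (simp_all add: antisym_loop_def)
      then show ?thesis using cap[of "-1" "t - ?H"] 3 t by simp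
    next
      case 4
      then have "\<gamma> t = (-1) *\<^sub>R bulb (t - ?H)"
         "\<tau> t = (-1) *\<^sub>R vec3 (- cos ((t - ?H) / R - 3 * \<beta> - pi / 2)) 0 (- sin ((t - ?H) / R - 3 * \<beta> - pi / 2))"
        by (simp_all add: antisym_loop_def)
      then show ?thesis using bul[of "-1" "t - ?H"] 4 t by simp
    qed
  qed
  have h: "1 \<le> h" "h\<^sup>2 + (R + 1/2)\<^sup>2 = (2 * R)\<^sup>2" using height_ge_1 height by (simp_all add: h_def)
  have R1: "1 \<le> R * R" using R by (metis mult_mono' mult_1 zero_le_one)
  have "1/2 \<le> thickness_radius (2 * (R * (pi + 4 * \<beta>))) \<gamma>"
  proof (rule thickness)
    let ?H = "R * (pi + 4 * \<beta>)"
    have b: "\<beta> * R \<le> 2 * \<beta> * R" "0 \<le> \<beta> * R" "0 < \<beta> * R" using \<beta> Rp by auto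
    have e: "\<beta> * R / R = \<beta>" using Rp by simp
    have "\<gamma> (\<beta> * R) = vec3 (1/2) 0 0" "\<tau> (\<beta> * R) = vec3 0 0 1"
      using b e by (simp_all add: antisym_loop_def neck_def)
    moreover have "\<gamma> (?H + \<beta> * R) = vec3 (-1/2) 0 0" "\<tau> (?H + \<beta> * R) = vec3 0 0 (-1)"
    proof -
      have second: "antisym_loop a H' f g (H' + y) = - f y" if "0 < y" "y \<le> a" "a < H'" for a H' f g y
        using that by (simp add: antisym_loop_def)
      show "\<gamma> (?H + \<beta> * R) = vec3 (-1/2) 0 0" "\<tau> (?H + \<beta> * R) = vec3 0 0 (-1)"
        unfolding second[OF b(3,1) aH(2)] by (simp_all add: neck_def e uminus_vec3)
    qed
    moreover have "\<beta> * R \<le> 2 * ?H" "?H + \<beta> * R \<le> 2 * ?H" "0 \<le> ?H + \<beta> * R" using b aH by linarith+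
    ultimately show "\<exists>t u. t \<in> {0..2 * ?H} \<and> u \<in> {0..2 * ?H} \<and> \<gamma> t \<noteq> \<gamma> u \<and>
       (\<gamma> t - \<gamma> u) \<bullet> \<tau> t = 0 \<and> (\<gamma> t - \<gamma> u) \<bullet> \<tau> u = 0"
      using b(2) by (intro exI[of _ "\<beta> * R"] exI[of _ "?H + \<beta> * R"]) (simp add: vec3_eq_iff inner_vec3)
  next
    fix t u assume tu: "t \<in> {0..2 * (R * (pi + 4 * \<beta>))}" "u \<in> {0..2 * (R * (pi + 4 * \<beta>))}" "\<gamma> t \<noteq> \<gamma> u"
      "(\<gamma> t - \<gamma> u) \<bullet> \<tau> t = 0" "(\<gamma> t - \<gamma> u) \<bullet> \<tau> u = 0"
    obtain s c d x z where n: "s \<in> {1, -1}" "center s c d (\<gamma> t)" "\<gamma> t = vec3 (c + R * x) 0 (d + R * z)"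
     "x\<^sup>2 + z\<^sup>2 = 1" "\<tau> t = vec3 z 0 (- x) \<or> \<tau> t = vec3 (- z) 0 x" using normal[OF tu(1)] unfolding nrm_def by blast
    obtain s' c' d' x' z' where n': "s' \<in> {1, -1}" "center s' c' d' (\<gamma> u)" "\<gamma> u = vec3 (c' + R * x') 0 (d' + R * z')"
     "x'\<^sup>2 + z'\<^sup>2 = 1" "\<tau> u = vec3 z' 0 (- x') \<or> \<tau> u = vec3 (- z') 0 x'" using normal[OF tu(2)] unfolding nrm_def by blast
    define p q where pq: "p = c - c' + R * (x - x')" "q = d - d' + R * (z - z')"
    have v: "(\<gamma> t - \<gamma> u) $ 1 = p" "(\<gamma> t - \<gamma> u) $ 2 = 0" "(\<gamma> t - \<gamma> u) $ 3 = q"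
      unfolding n(3) n'(3) by (simp_all add: pq algebra_simps)
    have o: "q * x = p * z" "q * x' = p * z'"
      using tu(4,5) v n(5) n'(5) by (auto simp: inner_vec3)
    have ne: "p \<noteq> 0 \<or> q \<noteq> 0" using tu(3) v by (auto simp: vec3_eq_iff)
    obtain k where k: "k \<noteq> 0" "p = k * x" "q = k * z" and alt: "x' = x \<and> z' = z \<or> x' = - x \<and> z' = - z"
      using common_normal[OF n(4) n'(4) o ne] by metis
    have k2: "p\<^sup>2 + q\<^sup>2 = k\<^sup>2"
    proof -
      have "p\<^sup>2 + q\<^sup>2 = k\<^sup>2 * (x\<^sup>2 + z\<^sup>2)" unfolding k by (simp add: power_mult_distrib algebra_simps)
      then show ?thesis using n(4) by simp
    qed
    have "1 \<le> p\<^sup>2 + q\<^sup>2"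
    proof (cases "c = c' \<and> d = d'")
      case True
      then have "x' = - x \<and> z' = - z" using alt ne by (auto simp: pq)
      then have "p = (2 * R) * x" "q = (2 * R) * z" using True by (simp_all add: pq)
      then have "p\<^sup>2 + q\<^sup>2 = (2 * R)\<^sup>2 * (x\<^sup>2 + z\<^sup>2)" by (simp only: power_mult_distrib distrib_left)
      then show ?thesis using n(4) R1 by (simp add: power2_eq_square)
    next
      case False
      note C = n(2)[unfolded center_def] n'(2)[unfolded center_def]
      consider "s' = - s" "1/2 \<le> s * \<gamma> t $ 1" "1/2 \<le> s' * \<gamma> u $ 1"
        | "s' = - s" "h / 2 \<le> s * \<gamma> t $ 3" "h / 2 \<le> s' * \<gamma> u $ 3"
        | "(c - c')\<^sup>2 + (d - d')\<^sup>2 = (2 * R)\<^sup>2"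
      proof -
        have ss: "s' = s \<or> s' = - s" "s\<^sup>2 = 1" "s'\<^sup>2 = 1" using n(1) n'(1) by auto
        have "(c - c')\<^sup>2 + (d - d')\<^sup>2 = (2 * R)\<^sup>2" if "c = s * (R + 1/2)" "d = 0" "c' = 0" "d' = s' * h"
          using that h(2) ss by (simp add: power_mult_distrib)
        moreover have "(c - c')\<^sup>2 + (d - d')\<^sup>2 = (2 * R)\<^sup>2" if "c' = s' * (R + 1/2)" "d' = 0" "c = 0" "d = s * h"
          using that h(2) ss by (simp add: power_mult_distrib)
        ultimately show ?thesis using that C ss(1) False by blast
      qed
      then show ?thesis
      proof cases
        case 1
        then have "1 \<le> s * p" using v(1) by (simp add: algebra_simps)
        then have "1 \<le> \<bar>p\<bar>" using n(1) by auto
        then have "1 \<le> p\<^sup>2" by (metis abs_le_square_iff abs_1 one_power2)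
        then show ?thesis by (simp add: add_increasing2)
      next
        case 2
        then have "h \<le> s * q" using v(3) by (simp add: algebra_simps)
        then have "1 \<le> \<bar>q\<bar>" using n(1) h(1) by auto
        then have "1 \<le> q\<^sup>2" by (metis abs_le_square_iff abs_1 one_power2)
        then show ?thesis by (simp add: add_increasing)
      next
        case 3
        from alt show ?thesis
        proof
          assume "x' = x \<and> z' = z"
          then have "p\<^sup>2 + q\<^sup>2 = (2 * R)\<^sup>2" using 3 by (simp add: pq)
          then show ?thesis using R1 by (simp add: power2_eq_square)
        next
          assume e: "x' = - x \<and> z' = - z"
          have "c - c' = (k - 2 * R) * x" "d - d' = (k - 2 * R) * z"
            using k(2,3) e by (simp_all add: pq algebra_simps)
          then have "(c - c')\<^sup>2 + (d - d')\<^sup>2 = (k - 2 * R)\<^sup>2 * (x\<^sup>2 + z\<^sup>2)" by (simp only: power_mult_distrib distrib_left)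
          then have "(k - 2 * R)\<^sup>2 = (2 * R)\<^sup>2" using 3 n(4) by simp
          moreover have "k * (k - 4 * R) = (k - 2 * R)\<^sup>2 - (2 * R)\<^sup>2" by (simp add: power2_eq_square algebra_simps)
          ultimately have "k * (k - 4 * R) = 0" by simp
          then have "k = 4 * R" using k(1) by simp
          then show ?thesis using R1 unfolding k2 by (simp add: power2_eq_square)
        qed
      qed
    qed
    then show "1 \<le> norm (\<gamma> t - \<gamma> u)" unfolding norm_vec3_ge_1 v by simp
  qed
  then show ?thesis unfolding thick_knot_def using constrained range_carrier by metis
qed

text \<open>
  The peanut stays outside the two discs of radius \<open>R\<close> bounded by the neck circles, and these contain
  the discs of radius one that touch them from inside in the middle of the neck.
\<close>

lemma outside_neck_discs:
  assumes v: "v \<in> carrier"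
  shows "1 \<le> (\<bar>v $ 1\<bar> - 3/2)\<^sup>2 + (v $ 3)\<^sup>2"
proof -
  define X Z c h where "X = \<bar>v $ 1\<bar>" "Z = \<bar>v $ 3\<bar>" "c = R + 1/2" "h = 2 * R * sin \<beta>"
  note d = X_Z_c_h_def
  have Rp: "0 < R" using R by simp
  have h: "h\<^sup>2 + c\<^sup>2 = (2 * R)\<^sup>2" using height by (simp add: d)
  have zz: "(v $ 3)\<^sup>2 = Z\<^sup>2" "(v $ 1)\<^sup>2 = X\<^sup>2" by (simp_all add: d)
  have far: "R\<^sup>2 \<le> (X - c)\<^sup>2 + Z\<^sup>2"
  proof (cases "\<bar>v $ 3\<bar> \<le> R * sin \<beta> \<and> X = 1/2 + R - sqrt (R\<^sup>2 - (v $ 3)\<^sup>2)")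
    case True
    have "\<bar>v $ 3\<bar> \<le> R * 1" using True mult_left_mono[OF sin_le_one[of \<beta>], of R] Rp by linarith
    then have "(v $ 3)\<^sup>2 \<le> R\<^sup>2" using Rp abs_le_square_iff[of "v $ 3" R] by simp
    then have "(X - c)\<^sup>2 = R\<^sup>2 - Z\<^sup>2" using True by (simp add: d)
    then show ?thesis by simp
  next
    case False
    then have b: "X\<^sup>2 + (Z - h)\<^sup>2 = R\<^sup>2" using v by (auto simp: carrier_def d)
    define m where "m = Z - h"
    have "(c * X - h * m)\<^sup>2 + (h * X + c * m)\<^sup>2 = (h\<^sup>2 + c\<^sup>2) * (X\<^sup>2 + m\<^sup>2)"
      by (simp add: power2_eq_square algebra_simps)
    also have "\<dots> = (2 * R * R)\<^sup>2" using b unfolding h m_def by (simp add: power2_eq_square)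
    finally have "(c * X - h * m)\<^sup>2 \<le> (2 * R * R)\<^sup>2" by (smt (verit) zero_le_power2)
    then have "\<bar>c * X - h * m\<bar> \<le> 2 * R * R" using Rp by (simp add: abs_le_square_iff[symmetric])
    moreover have "(X - c)\<^sup>2 + Z\<^sup>2 = (X\<^sup>2 + m\<^sup>2) + (h\<^sup>2 + c\<^sup>2) - 2 * (c * X - h * m)"
      by (simp add: m_def power2_eq_square algebra_simps)
    then have "(X - c)\<^sup>2 + Z\<^sup>2 = R\<^sup>2 + (2 * R)\<^sup>2 - 2 * (c * X - h * m)" using b h by (simp add: m_def)
    ultimately show ?thesis by (simp add: power2_eq_square)
  qed
  define D where "D = sqrt ((X - c)\<^sup>2 + Z\<^sup>2)"
  have D: "R \<le> D" "\<bar>X - c\<bar> \<le> D" "D\<^sup>2 = (X - c)\<^sup>2 + Z\<^sup>2"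
    using far by (auto simp: D_def intro: real_le_rsqrt)
  have "1 \<le> D - (R - 1)" using D by simp
  then have "1\<^sup>2 \<le> (D - (R - 1))\<^sup>2" by (intro power_mono) auto
  also have "\<dots> = D\<^sup>2 - 2 * (D * (R - 1)) + (R - 1)\<^sup>2" by (simp add: power2_eq_square algebra_simps)
  also have "\<dots> \<le> D\<^sup>2 + 2 * ((X - c) * (R - 1)) + (R - 1)\<^sup>2"
  proof -
    have "- D \<le> X - c" using D(2) by linarith
    then have "- D * (R - 1) \<le> (X - c) * (R - 1)" by (rule mult_right_mono) (use R in simp)
    then show ?thesis by (simp add: mult.commute)
  qed
  also have "\<dots> = (X - 3/2)\<^sup>2 + Z\<^sup>2" unfolding D(3) d(3) by (simp add: power2_eq_square field_simps)
  finally show ?thesis unfolding zz by (simp add: d)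
qed

end

text \<open>
  The stadium is in the horizontal plane and \<open>w\<close> in the vertical plane through the core segment. On a
  cap the squared distance is an affine function of the first coordinate, so it is enough to
  compare at the end of the straight side and at the tip; the latter is the centre of the disc that
  \<open>w\<close> avoids.
\<close>

lemma stadium_far:
  assumes v: "v \<in> stadium" and w: "w $ 2 = 0" "1 \<le> (\<bar>w $ 1\<bar> - 3/2)\<^sup>2 + (w $ 3)\<^sup>2"
  shows "1 \<le> norm (v - w)"
proof -
  define x y X Z where d: "x = \<bar>v $ 1\<bar>" "y = v $ 2" "X = \<bar>w $ 1\<bar>" "Z = w $ 3"
  have v3: "v $ 3 = 0" and eq: "(max 0 (x - 1/2))\<^sup>2 + y\<^sup>2 = 1" using v by (auto simp: stadium_def d)
  have "(x - X)\<^sup>2 \<le> (v $ 1 - w $ 1)\<^sup>2" unfolding d abs_le_square_iff[symmetric] by linarith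
  moreover have "1 \<le> (x - X)\<^sup>2 + y\<^sup>2 + Z\<^sup>2"
  proof (cases "x \<le> 1/2")
    case True
    then have "y\<^sup>2 = 1" using eq by simp
    then show ?thesis by (simp add: add_increasing add_increasing2)
  next
    case False
    then have y: "y\<^sup>2 = 1 - (x - 1/2)\<^sup>2" using eq by (simp add: max_def)
    then have "(x - 1/2)\<^sup>2 \<le> 1\<^sup>2" by (smt (verit) zero_le_power2 one_power2)
    then have "x - 1/2 \<le> 1" by (rule power2_le_imp_le) simp
    then have x: "x \<le> 3/2" by simp
    \<comment> \<open>the squared distance is affine in \<open>x\<close>, so it suffices to bound it at both ends of the cap\<close>
    have "(x - X)\<^sup>2 + y\<^sup>2 + Z\<^sup>2 = (3/2 - x) * (1 + (X - 1/2)\<^sup>2 + Z\<^sup>2) + (x - 1/2) * ((X - 3/2)\<^sup>2 + Z\<^sup>2)"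
      unfolding y by (simp add: power2_eq_square field_simps)
    also have "\<dots> \<ge> (3/2 - x) * 1 + (x - 1/2) * 1"
      using x False w(2) by (intro add_mono mult_left_mono) (auto simp: d)
    finally show ?thesis by simp
  qed
  ultimately show ?thesis unfolding norm_vec3_ge_1 using v3 w(1) by (simp add: d)
qed

section \<open>Unlinking the stadium from a peanut\<close>

text \<open>
  A map that acts affinely on each line parallel to the axis \<open>i\<close>. If the coefficients depend on the
  other coordinates only and the slope is positive, it is a homeomorphism, and it is joined to the
  identity by moving the coefficients linearly. All isotopies needed are compositions of such maps.
\<close>

definition fibre_map :: "3 \<Rightarrow> (real^3 \<Rightarrow> real) \<Rightarrow> (real^3 \<Rightarrow> real) \<Rightarrow> real^3 \<Rightarrow> real^3" where
  "fibre_map i a b v = (\<chi> j. if j = i then a v * v $ i + b v else v $ j)"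

definition isotopic_to_id :: "(real^3 \<Rightarrow> real^3) \<Rightarrow> bool" where
  "isotopic_to_id f \<longleftrightarrow> homotopic_with_canon (\<lambda>h. \<exists>g. homeomorphism UNIV UNIV h g) UNIV UNIV id f"

lemma fibre_map_nth: "fibre_map i a b v $ j = (if j = i then a v * v $ i + b v else v $ j)"
  by (simp add: fibre_map_def)

lemma fibre_map_homeomorphism:
  assumes c: "continuous_on UNIV a" "continuous_on UNIV b"
    and ind: "\<And>v c. a (\<chi> j. if j = i then c else v $ j) = a v" "\<And>v c. b (\<chi> j. if j = i then c else v $ j) = b v"
    and pos: "\<And>v. 0 < a v"
  shows "\<exists>g. homeomorphism UNIV UNIV (fibre_map i a b) g"
proof
  let ?g = "fibre_map i (\<lambda>v. 1 / a v) (\<lambda>v. - b v / a v)"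
  have a0: "a v \<noteq> 0" for v using pos[of v] by simp
  have c1: "continuous_on UNIV (fibre_map i a' b')" if "continuous_on UNIV a'" "continuous_on UNIV b'" for a' b'
    unfolding fibre_map_def
  proof (rule continuous_on_vec_lambda)
    show "continuous_on UNIV (\<lambda>v. if j = i then a' v * v $ i + b' v else v $ j)" for j
      by (cases "j = i") (auto intro!: continuous_intros that)
  qed
  have ind': "a (fibre_map i a' b' v) = a v" "b (fibre_map i a' b' v) = b v" for a' b' v
    unfolding fibre_map_def using ind by simp_all
  show "homeomorphism UNIV UNIV (fibre_map i a b) ?g"
  proof (rule homeomorphismI)
    show "continuous_on UNIV (fibre_map i a b)" by (rule c1[OF c])
    show "continuous_on UNIV ?g" using a0 by (intro c1 continuous_intros c) auto
    show "?g (fibre_map i a b v) = v" for v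
      using a0[of v] by (simp add: vec_eq_iff fibre_map_nth ind' field_simps)
    show "fibre_map i a b (?g v) = v" for v
      using a0[of v] by (simp add: vec_eq_iff fibre_map_nth ind' field_simps)
  qed auto
qed

lemma fibre_map_isotopic_to_id:
  assumes c: "continuous_on UNIV a" "continuous_on UNIV b"
    and ind: "\<And>v c. a (\<chi> j. if j = i then c else v $ j) = a v" "\<And>v c. b (\<chi> j. if j = i then c else v $ j) = b v"
    and pos: "\<And>v. 0 < a v"
  shows "isotopic_to_id (fibre_map i a b)"
  unfolding isotopic_to_id_def homotopic_with_def
proof (rule exI, intro conjI allI ballI)
  let ?h = "\<lambda>z. fibre_map i (\<lambda>v. (1 - fst z) + fst z * a v) (\<lambda>v. fst z * b v) (snd z)"
  have "continuous_on ({0..1} \<times> UNIV) ?h"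
    unfolding fibre_map_def
  proof (rule continuous_on_vec_lambda)
    show "continuous_on ({0..1} \<times> UNIV) (\<lambda>z. if j = i then ((1 - fst z) + fst z * a (snd z)) * snd z $ i + fst z * b (snd z) else snd z $ j)" for j
      by (cases "j = i") (auto intro!: continuous_intros continuous_on_compose2[OF c(1)] continuous_on_compose2[OF c(2)])
  qed
  then show "continuous_map (prod_topology (top_of_set {0..1}) (top_of_set UNIV)) (top_of_set UNIV) ?h"
    unfolding prod_topology_subtopology_eu by simp
  show "?h (0, v) = id v" for v by (simp add: vec_eq_iff fibre_map_nth)
  show "?h (1, v) = fibre_map i a b v" for v by (simp add: vec_eq_iff fibre_map_nth)
  fix t :: real assume t: "t \<in> {0..1}"
  have "\<exists>g. homeomorphism UNIV UNIV (fibre_map i (\<lambda>v. (1 - t) + t * a v) (\<lambda>v. t * b v)) g"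
  proof (rule fibre_map_homeomorphism)
    show "0 < 1 - t + t * a v" for v
    proof (cases "t = 0")
      case False
      then have "0 < t * a v" using t pos[of v] by simp
      then show ?thesis using t by (simp add: add_nonneg_pos)
    qed simp
  qed (use ind in \<open>auto intro!: continuous_intros c\<close>)
  moreover have "(\<lambda>v. ?h (t, v)) = fibre_map i (\<lambda>v. (1 - t) + t * a v) (\<lambda>v. t * b v)" by (simp add: fun_eq_iff)
  ultimately show "\<exists>g. homeomorphism UNIV UNIV (\<lambda>v. ?h (t, v)) g" by simp
qed

lemma isotopic_to_id_homeomorphism:
  assumes "isotopic_to_id f" shows "\<exists>g. homeomorphism UNIV UNIV f g"
  using homotopic_with_imp_property[OF assms[unfolded isotopic_to_id_def]] by blast

lemma isotopic_to_id_compose: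
  assumes f: "isotopic_to_id f" and g: "isotopic_to_id g"
  shows "isotopic_to_id (g \<circ> f)"
proof -
  let ?P = "\<lambda>h :: real^3 \<Rightarrow> real^3. \<exists>g. homeomorphism UNIV UNIV h g"
  obtain f' where f': "homeomorphism UNIV UNIV f f'" using isotopic_to_id_homeomorphism[OF f] by blast
  have "homotopic_with_canon (\<lambda>h. ?P (h \<circ> f)) UNIV UNIV id g"
    using g[unfolded isotopic_to_id_def]
    by (rule homotopic_with_mono) (use homeomorphism_compose[OF f'] in blast)
  then have "homotopic_with_canon ?P UNIV UNIV (id \<circ> f) (g \<circ> f)"
    by (rule homotopic_with_compose_continuous_right) (use f' in \<open>auto simp: homeomorphism_def\<close>)
  then show ?thesis
    using homotopic_with_trans[OF f[unfolded isotopic_to_id_def]] unfolding isotopic_to_id_def by simp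
qed

lemma isotopic_to_id_image:
  assumes "isotopic_to_id f" "\<And>v. f v \<in> Y \<longleftrightarrow> v \<in> X"
  shows "f ` X = Y"
proof -
  obtain g where g: "homeomorphism UNIV UNIV f g" using isotopic_to_id_homeomorphism[OF assms(1)] by blast
  then have "f (g y) = y" for y by (simp add: homeomorphism_def)
  then show ?thesis using assms(2) by (metis (no_types, lifting) image_eqI image_subset_iff subsetI subset_antisym)
qed

lemma planar_circle_iff: "v \<in> planar_circle i \<longleftrightarrow> v $ 3 = 0 \<and> (v $ 1 - 3 * real i)\<^sup>2 + (v $ 2)\<^sup>2 = 1"
  unfolding planar_circle_def dist_norm mem_Collect_eq norm_vec3_eq_1 by auto

lemma planar_circle_0_ne_1: "planar_circle 0 \<noteq> planar_circle 1"
proof -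
  have "vec3 1 0 0 \<in> planar_circle 0" "vec3 1 0 0 \<notin> planar_circle 1" by (simp_all add: planar_circle_iff)
  then show ?thesis by metis
qed

context peanut begin

definition "half_height = 2 * R * sin \<beta> + R"

text \<open>
  The square of the half-width of the peanut at height \<open>z\<close>; it is negative above and below the peanut.
\<close>

definition profile :: "real \<Rightarrow> real" where
  "profile z = (if \<bar>z\<bar> \<le> R * sin \<beta> then (1/2 + R - sqrt (R\<^sup>2 - z\<^sup>2))\<^sup>2 else R\<^sup>2 - (\<bar>z\<bar> - 2 * R * sin \<beta>)\<^sup>2)"

lemma sqrt_neck: "sqrt (R\<^sup>2 - (R * sin \<beta>)\<^sup>2) = R * cos \<beta>"
proof (rule real_sqrt_unique)
  show "(R * cos \<beta>)\<^sup>2 = R\<^sup>2 - (R * sin \<beta>)\<^sup>2" by (simp add: power_mult_distrib cos_squared_eq algebra_simps)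
qed (use R cos_pos in simp)

lemma neck_profile:
  assumes "\<bar>z\<bar> \<le> R * sin \<beta>"
  shows "1/2 \<le> 1/2 + R - sqrt (R\<^sup>2 - z\<^sup>2)" "1/2 + R - sqrt (R\<^sup>2 - z\<^sup>2) \<le> R * cos \<beta>"
proof -
  have "sqrt (R\<^sup>2 - z\<^sup>2) \<le> sqrt (R\<^sup>2)" by (intro real_sqrt_le_mono) simp
  then show "1/2 \<le> 1/2 + R - sqrt (R\<^sup>2 - z\<^sup>2)" using R by simp
  have "z\<^sup>2 \<le> (R * sin \<beta>)\<^sup>2" using assms R sin_\<beta> by (simp add: abs_le_square_iff[symmetric])
  then have "sqrt (R\<^sup>2 - (R * sin \<beta>)\<^sup>2) \<le> sqrt (R\<^sup>2 - z\<^sup>2)" by (intro real_sqrt_le_mono) simp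
  then show "1/2 + R - sqrt (R\<^sup>2 - z\<^sup>2) \<le> R * cos \<beta>" using sqrt_neck cos_\<beta> by simp
qed

lemma profile_junction: "R\<^sup>2 - (R * sin \<beta> - 2 * R * sin \<beta>)\<^sup>2 = (1/2 + R - sqrt (R\<^sup>2 - (R * sin \<beta>)\<^sup>2))\<^sup>2"
proof -
  have "1/2 + R - R * cos \<beta> = R * cos \<beta>" using cos_\<beta> by simp
  moreover have "R\<^sup>2 - (R * sin \<beta> - 2 * R * sin \<beta>)\<^sup>2 = (R * cos \<beta>)\<^sup>2"
  proof -
    have "R * sin \<beta> - 2 * R * sin \<beta> = - (R * sin \<beta>)" by simp
    then show ?thesis by (simp add: power_mult_distrib cos_squared_eq algebra_simps)
  qed
  ultimately show ?thesis unfolding sqrt_neck by simp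
qed

lemma carrier_iff_profile: "v \<in> carrier \<longleftrightarrow> v $ 2 = 0 \<and> (v $ 1)\<^sup>2 = profile (v $ 3)"
proof -
  have sq: "\<bar>x\<bar> = w \<longleftrightarrow> x\<^sup>2 = w\<^sup>2" if "0 \<le> w" for x w :: real
    using that by (metis abs_of_nonneg power2_abs power2_eq_iff_nonneg abs_ge_zero)
  consider "\<bar>v $ 3\<bar> < R * sin \<beta>" | "\<bar>v $ 3\<bar> = R * sin \<beta>" | "R * sin \<beta> < \<bar>v $ 3\<bar>" by linarith
  then show ?thesis
  proof cases
    case 1
    then show ?thesis
      using neck_profile(1)[of "v $ 3"] by (auto simp: carrier_def profile_def sq)
  next
    case 2
    then have "(v $ 3)\<^sup>2 = (R * sin \<beta>)\<^sup>2" by (metis power2_abs)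
    then have "\<bar>v $ 1\<bar> = 1/2 + R - sqrt (R\<^sup>2 - (v $ 3)\<^sup>2) \<longleftrightarrow> (v $ 1)\<^sup>2 = (1/2 + R - sqrt (R\<^sup>2 - (R * sin \<beta>)\<^sup>2))\<^sup>2"
      using neck_profile(1)[of "v $ 3"] 2 by (subst sq) auto
    moreover have "(v $ 1)\<^sup>2 + (\<bar>v $ 3\<bar> - 2 * R * sin \<beta>)\<^sup>2 = R\<^sup>2 \<longleftrightarrow> (v $ 1)\<^sup>2 = (1/2 + R - sqrt (R\<^sup>2 - (R * sin \<beta>)\<^sup>2))\<^sup>2"
      unfolding profile_junction[symmetric] 2 by auto
    ultimately show ?thesis
      using 2 \<open>(v $ 3)\<^sup>2 = (R * sin \<beta>)\<^sup>2\<close> by (auto simp: carrier_def profile_def)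
  next
    case 3 then show ?thesis by (auto simp: carrier_def profile_def)
  qed
qed

lemma half_height_pos: "0 < half_height" "R * sin \<beta> < half_height" "0 < R - R * sin \<beta>"
proof -
  have "sin \<beta> < 1" using sin_monotone_2pi[of \<beta> "pi / 2"] \<beta> by simp
  then have "R * sin \<beta> < R * 1" using R by (intro mult_strict_left_mono) auto
  moreover have "0 < R * sin \<beta>" using R sin_\<beta> by simp
  ultimately show "0 < half_height" "R * sin \<beta> < half_height" "0 < R - R * sin \<beta>" by (simp_all add: half_height_def)
qed

lemma profile_bounds:
  assumes "0 \<le> profile z"
  shows "profile z \<le> R\<^sup>2" "\<bar>z\<bar> \<le> half_height"
proof -
  show "profile z \<le> R\<^sup>2"
  proof (cases "\<bar>z\<bar> \<le> R * sin \<beta>")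
    case True
    have "R * cos \<beta> \<le> R * 1" using R by (intro mult_left_mono) auto
    then have "1/2 + R - sqrt (R\<^sup>2 - z\<^sup>2) \<le> R" using neck_profile(2)[OF True] by simp
    then show ?thesis using neck_profile(1)[OF True] True by (simp add: profile_def power_mono)
  qed (simp add: profile_def)
  show "\<bar>z\<bar> \<le> half_height"
  proof (cases "\<bar>z\<bar> \<le> R * sin \<beta>")
    case False
    then have "(\<bar>z\<bar> - 2 * R * sin \<beta>)\<^sup>2 \<le> R\<^sup>2" using assms by (simp add: profile_def)
    then have "\<bar>z\<bar> - 2 * R * sin \<beta> \<le> R" using R by (simp add: abs_le_square_iff[symmetric])
    then show ?thesis by (simp add: half_height_def)
  qed (use half_height_pos in simp)
qed

text \<open>
  The square of the factor by which the peanut is stretched at height \<open>z\<close> to become an ellipse, that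
  is \<open>(1 - (z / half_height)^2) / profile z\<close> with the common zero of numerator and denominator at
  the top cancelled. The product form with a truncated argument in each factor joins the formulas for
  neck and bulb continuously.
\<close>

definition stretch :: "real \<Rightarrow> real" where
  "stretch z = (let m = min \<bar>z\<bar> (R * sin \<beta>); k = max \<bar>z\<bar> (R * sin \<beta>);
      q = \<lambda>k. (half_height + k) / (half_height\<^sup>2 * (k + (R - 2 * R * sin \<beta>)))
     in (1 - (m / half_height)\<^sup>2) / (1/2 + R - sqrt (R\<^sup>2 - m\<^sup>2))\<^sup>2 * (q k / q (R * sin \<beta>)))"

lemma stretch_parts_pos:
  "R * sin \<beta> \<le> k \<Longrightarrow> 0 < (half_height + k) / (half_height\<^sup>2 * (k + (R - 2 * R * sin \<beta>)))"
  "\<lbrakk>0 \<le> m; m \<le> R * sin \<beta>\<rbrakk> \<Longrightarrow> 0 < (1 - (m / half_height)\<^sup>2) / (1/2 + R - sqrt (R\<^sup>2 - m\<^sup>2))\<^sup>2"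
proof -
  have rs: "0 < R * sin \<beta>" using R sin_\<beta> by simp
  show "0 < (half_height + k) / (half_height\<^sup>2 * (k + (R - 2 * R * sin \<beta>)))" if "R * sin \<beta> \<le> k"
    using that half_height_pos rs by (intro divide_pos_pos mult_pos_pos) auto
  show "0 < (1 - (m / half_height)\<^sup>2) / (1/2 + R - sqrt (R\<^sup>2 - m\<^sup>2))\<^sup>2" if "0 \<le> m" "m \<le> R * sin \<beta>"
  proof (rule divide_pos_pos)
    have "m / half_height < 1" using that half_height_pos by simp
    then have "(m / half_height)\<^sup>2 < 1" using that half_height_pos by (simp add: abs_square_less_1)
    then show "0 < 1 - (m / half_height)\<^sup>2" by simp
    show "0 < (1/2 + R - sqrt (R\<^sup>2 - m\<^sup>2))\<^sup>2" using neck_profile(1)[of m] that by (intro zero_less_power) auto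
  qed
qed

lemma stretch_pos: "0 < stretch z"
proof -
  have rs: "0 < R * sin \<beta>" using R sin_\<beta> by simp
  show ?thesis
    unfolding stretch_def Let_def
    by (intro mult_pos_pos divide_pos_pos[OF stretch_parts_pos(1) stretch_parts_pos(1)] stretch_parts_pos(2))
       (use rs in auto)
qed

lemma continuous_on_stretch: "continuous_on UNIV stretch"
proof -
  have rs: "0 < R * sin \<beta>" using R sin_\<beta> by simp
  have n1: "1/2 + R - sqrt (R\<^sup>2 - (min \<bar>z\<bar> (R * sin \<beta>))\<^sup>2) \<noteq> 0" for z
    using neck_profile(1)[of "min \<bar>z\<bar> (R * sin \<beta>)"] rs by auto
  have n2: "max \<bar>z\<bar> (R * sin \<beta>) + (R - 2 * R * sin \<beta>) \<noteq> 0" for z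
    using half_height_pos(3) max.cobounded2[of "R * sin \<beta>" "\<bar>z\<bar>"] by linarith
  have n3: "(half_height + R * sin \<beta>) / (half_height\<^sup>2 * (R * sin \<beta> + (R - 2 * R * sin \<beta>))) \<noteq> 0"
    by (rule less_imp_neq[symmetric], rule stretch_parts_pos(1)) simp
  show ?thesis
    unfolding stretch_def[abs_def] Let_def
    by (intro continuous_intros) (use n1 n2 n3 half_height_pos in auto)
qed

lemma stretch_profile: "stretch z * profile z = 1 - (z / half_height)\<^sup>2"
proof -
  have rs: "0 < R * sin \<beta>" using R sin_\<beta> by simp
  define q where "q = (\<lambda>k. (half_height + k) / (half_height\<^sup>2 * (k + (R - 2 * R * sin \<beta>))))"
  have q0: "q (R * sin \<beta>) \<noteq> 0" unfolding q_def by (rule less_imp_neq[symmetric], rule stretch_parts_pos(1)) simp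
  have fac: "q k * (R\<^sup>2 - (k - 2 * R * sin \<beta>)\<^sup>2) = 1 - (k / half_height)\<^sup>2" if "R * sin \<beta> \<le> k" for k
  proof -
    have "R\<^sup>2 - (k - 2 * R * sin \<beta>)\<^sup>2 = (half_height - k) * (k + (R - 2 * R * sin \<beta>))"
      by (simp add: half_height_def power2_eq_square algebra_simps)
    moreover have "k + (R - 2 * R * sin \<beta>) \<noteq> 0" using that half_height_pos(3) by linarith
    ultimately have "q k * (R\<^sup>2 - (k - 2 * R * sin \<beta>)\<^sup>2) = (half_height + k) * (half_height - k) / half_height\<^sup>2"
      unfolding q_def by simp
    also have "\<dots> = 1 - (k / half_height)\<^sup>2" using half_height_pos(1) by (simp add: field_simps power2_eq_square)
    finally show ?thesis .
  qed
  show ?thesis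
  proof (cases "\<bar>z\<bar> \<le> R * sin \<beta>")
    case True
    then have "1/2 + R - sqrt (R\<^sup>2 - z\<^sup>2) \<noteq> 0" using neck_profile(1)[OF True] by linarith
    moreover have "min \<bar>z\<bar> (R * sin \<beta>) = \<bar>z\<bar>" "max \<bar>z\<bar> (R * sin \<beta>) = R * sin \<beta>" using True by auto
    ultimately show ?thesis
      using True q0 unfolding stretch_def Let_def profile_def q_def[symmetric]
      by (simp add: power_divide q_def[symmetric])
  next
    case False
    define w where "w = (1/2 + R - sqrt (R\<^sup>2 - (R * sin \<beta>)\<^sup>2))\<^sup>2"
    have w: "0 < w" unfolding w_def using neck_profile(1)[of "R * sin \<beta>"] rs by (intro zero_less_power) auto
    have qw: "1 - ((R * sin \<beta>) / half_height)\<^sup>2 = q (R * sin \<beta>) * w"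
      using fac[of "R * sin \<beta>"] unfolding profile_junction w_def[symmetric] by simp
    have mm: "min \<bar>z\<bar> (R * sin \<beta>) = R * sin \<beta>" "max \<bar>z\<bar> (R * sin \<beta>) = \<bar>z\<bar>" using False by auto
    have "stretch z = (1 - ((R * sin \<beta>) / half_height)\<^sup>2) / w * (q \<bar>z\<bar> / q (R * sin \<beta>))"
      unfolding stretch_def Let_def mm w_def q_def by (rule refl)
    then have "stretch z = q \<bar>z\<bar>" using q0 w unfolding qw by simp
    then show ?thesis using fac[of "\<bar>z\<bar>"] False by (simp add: profile_def power_divide)
  qed
qed

end

definition clamp01 :: "real \<Rightarrow> real" where "clamp01 x = max 0 (min 1 x)"

lemma clamp01: "x \<le> 0 \<Longrightarrow> clamp01 x = 0" "1 \<le> x \<Longrightarrow> clamp01 x = 1" "0 \<le> clamp01 x" "clamp01 x \<le> 1"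
  by (auto simp: clamp01_def)

lemma continuous_on_clamp01: "continuous_on A f \<Longrightarrow> continuous_on A (\<lambda>x. clamp01 (f x))"
  unfolding clamp01_def by (intro continuous_intros)

text \<open>
  The square of the factor by which the stadium is stretched at the first coordinate \<open>x\<close> to become an
  ellipse with half-axes \<open>3/2\<close> and \<open>1\<close>. The truncated arguments join the formulas for the caps and the
  straight sides.
\<close>

definition stadium_stretch :: "real \<Rightarrow> real" where
  "stadium_stretch x = 4/9 * (3/2 + max \<bar>x\<bar> (1/2)) / (1/2 + max \<bar>x\<bar> (1/2)) + (1/9 - 4/9 * (min \<bar>x\<bar> (1/2))\<^sup>2)"

lemma stadium_stretch_pos: "0 < stadium_stretch x"
proof -
  have "0 < 4/9 * (3/2 + max \<bar>x\<bar> (1/2)) / (1/2 + max \<bar>x\<bar> (1/2))" by (intro divide_pos_pos) auto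
  moreover have "(min \<bar>x\<bar> (1/2))\<^sup>2 \<le> (1/2)\<^sup>2" by (intro power_mono) auto
  then have "0 \<le> 1/9 - 4/9 * (min \<bar>x\<bar> (1/2))\<^sup>2" by (simp add: power2_eq_square)
  ultimately show ?thesis unfolding stadium_stretch_def by (rule add_pos_nonneg)
qed

lemma continuous_on_stadium_stretch: "continuous_on UNIV stadium_stretch"
proof -
  have "1/2 + max \<bar>x\<bar> (1/2) \<noteq> (0::real)" for x
    using max.cobounded2[of "1/2 :: real" "\<bar>x\<bar>"] by linarith
  then show ?thesis unfolding stadium_stretch_def[abs_def] by (intro continuous_intros) auto
qed

lemma stadium_stretch_profile: "stadium_stretch x * (1 - (max 0 (\<bar>x\<bar> - 1/2))\<^sup>2) = 1 - 4/9 * x\<^sup>2"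
proof (cases "\<bar>x\<bar> \<le> 1/2")
  case True
  then show ?thesis by (simp add: stadium_stretch_def max_def min_def)
next
  case False
  define u where "u = \<bar>x\<bar>"
  have u: "1/2 < u" "x\<^sup>2 = u\<^sup>2" using False by (auto simp: u_def)
  have r: "stadium_stretch x = 4/9 * (3/2 + u) / (1/2 + u)" using u(1) by (simp add: stadium_stretch_def u_def max_def min_def power2_eq_square)
  have m: "1 - (max 0 (\<bar>x\<bar> - 1/2))\<^sup>2 = (3/2 - u) * (1/2 + u)"
    using u(1) by (simp add: u_def[symmetric] power2_eq_square algebra_simps)
  have cancel: "k / d * (e * d) = k * e" if "d \<noteq> 0" for k d e :: real using that by simp
  have "1/2 + u \<noteq> 0" using u(1) by linarith
  then have "stadium_stretch x * (1 - (max 0 (\<bar>x\<bar> - 1/2))\<^sup>2) = 4/9 * (3/2 + u) * (3/2 - u)"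
    unfolding r m by (rule cancel)
  also have "\<dots> = 1 - 4/9 * x\<^sup>2" unfolding u(2) by (simp add: power2_eq_square field_simps)
  finally show ?thesis .
qed

context peanut begin

text \<open>
  The stadium is stretched in its plane to an ellipse. Seen from above, the peanut is a segment
  inside this ellipse, so a vertical shear lifts the ellipse over the peanut and leaves the peanut in
  place. Once one component is above the other, they are rounded and shifted apart; then the circle
  made from the stadium is lowered to the plane, and the other circle is turned into the plane by
  two shears.
\<close>

lemma unlinking_isotopy:
  "\<exists>f. isotopic_to_id f \<and> f ` stadium = planar_circle 0 \<and> f ` carrier = planar_circle 1"
proof -
  define c where "c = 4/9 * R\<^sup>2"
  have c: "c < 1"
  proof -
    have "R\<^sup>2 < (3/2)\<^sup>2" using R by (intro power_strict_mono) auto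
    then show ?thesis by (simp add: c_def power2_eq_square)
  qed
  \<comment> \<open>\<open>g\<close> is one on the ellipse and vanishes on the shadow of the peanut\<close>
  define g where "g v = max 0 ((4/9 * (v $ 1)\<^sup>2 + (v $ 2)\<^sup>2 - c) / (1 - c))" for v :: "real^3"
  define F1 where "F1 = fibre_map 2 (\<lambda>v. sqrt (stadium_stretch (v $ 1))) (\<lambda>v. 0)"
  define F2 where "F2 = fibre_map 3 (\<lambda>v. 1) (\<lambda>v. (half_height + 1) * g v)"
  define F3 where "F3 = fibre_map 1 (\<lambda>v. (1 - clamp01 (v $ 3 - half_height)) * sqrt (stretch (v $ 3)) + clamp01 (v $ 3 - half_height) * (2/3))
     (\<lambda>v. 3 * (1 - clamp01 (v $ 3 - half_height)))"
  define F4 where "F4 = fibre_map 3 (\<lambda>v. (1 - clamp01 (v $ 1 - 1)) + clamp01 (v $ 1 - 1) / half_height) (\<lambda>v. - (half_height + 1) * (1 - clamp01 (v $ 1 - 1)))"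
  define F5 where "F5 = fibre_map 2 (\<lambda>v. 1) (\<lambda>v. clamp01 (v $ 1 - 1) * v $ 3)"
  define F6 where "F6 = fibre_map 3 (\<lambda>v. 1) (\<lambda>v. - clamp01 (v $ 1 - 1) * v $ 2)"
  note F = F1_def F2_def F3_def F4_def F5_def F6_def
  note Sp = half_height_pos(1)
  have conv: "0 < (1 - t) * x + t * y" if "0 \<le> t" "t \<le> 1" "0 < x" "0 < y" for t x y :: real
  proof (cases "t = 0")
    case False
    then have "0 < t * y" using that by simp
    moreover have "0 \<le> (1 - t) * x" using that by simp
    ultimately show ?thesis by linarith
  qed (use that in simp)
  have i1: "isotopic_to_id F1" unfolding F
    by (rule fibre_map_isotopic_to_id)
       (auto intro!: continuous_intros continuous_on_compose2[OF continuous_on_stadium_stretch] stadium_stretch_pos)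
  have i2: "isotopic_to_id F2" unfolding F g_def
    by (rule fibre_map_isotopic_to_id) (use c in \<open>auto intro!: continuous_intros\<close>)
  have i3: "isotopic_to_id F3" unfolding F
  proof (rule fibre_map_isotopic_to_id)
    show "0 < (1 - clamp01 (v $ 3 - half_height)) * sqrt (stretch (v $ 3)) + clamp01 (v $ 3 - half_height) * (2/3)" for v :: "real^3"
      by (rule conv[OF clamp01(3,4)]) (use stretch_pos in auto)
  qed (auto intro!: continuous_intros continuous_on_clamp01 continuous_on_compose2[OF continuous_on_stretch])
  have i4: "isotopic_to_id F4" unfolding F
  proof (rule fibre_map_isotopic_to_id)
    show "0 < 1 - clamp01 (v $ 1 - 1) + clamp01 (v $ 1 - 1) / half_height" for v :: "real^3"
      using conv[OF clamp01(3,4), of 1 "1 / half_height" "v $ 1 - 1"] Sp by simp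
  qed (use Sp in \<open>auto intro!: continuous_intros continuous_on_clamp01\<close>)
  have i5: "isotopic_to_id F5" unfolding F
    by (rule fibre_map_isotopic_to_id) (auto intro!: continuous_intros continuous_on_clamp01)
  have i6: "isotopic_to_id F6" unfolding F
    by (rule fibre_map_isotopic_to_id) (auto intro!: continuous_intros continuous_on_clamp01)
  \<comment> \<open>the successive images of the stadium and of the peanut\<close>
  define A1 A2 A3 where "A1 = {v::real^3. v $ 3 = 0 \<and> 4/9 * (v $ 1)\<^sup>2 + (v $ 2)\<^sup>2 = 1}"
    and "A2 = {v::real^3. v $ 3 = half_height + 1 \<and> 4/9 * (v $ 1)\<^sup>2 + (v $ 2)\<^sup>2 = 1}"
    and "A3 = {v::real^3. v $ 3 = half_height + 1 \<and> (v $ 1)\<^sup>2 + (v $ 2)\<^sup>2 = 1}"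
  define B3 B4 B5 where "B3 = {v::real^3. v $ 2 = 0 \<and> (v $ 1 - 3)\<^sup>2 + (v $ 3 / half_height)\<^sup>2 = 1}"
    and "B4 = {v::real^3. v $ 2 = 0 \<and> (v $ 1 - 3)\<^sup>2 + (v $ 3)\<^sup>2 = 1}"
    and "B5 = {v::real^3. v $ 2 = v $ 3 \<and> (v $ 1 - 3)\<^sup>2 + (v $ 3)\<^sup>2 = 1}"
  have le1: "\<bar>x\<bar> \<le> 1" if "x\<^sup>2 + y\<^sup>2 = 1" for x y :: real
    using that by (metis abs_square_le_1 le_add_same_cancel1 zero_le_power2)
  have A1: "F1 ` stadium = A1"
  proof (rule isotopic_to_id_image[OF i1])
    fix v :: "real^3"
    define P where "P = 1 - (max 0 (\<bar>v $ 1\<bar> - 1/2))\<^sup>2"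
    have rp: "stadium_stretch (v $ 1) * P = 1 - 4/9 * (v $ 1)\<^sup>2" unfolding P_def by (rule stadium_stretch_profile)
    have sq: "(sqrt (stadium_stretch (v $ 1)))\<^sup>2 = stadium_stretch (v $ 1)" using stadium_stretch_pos[of "v $ 1"] by simp
    have "F1 v \<in> A1 \<longleftrightarrow> v $ 3 = 0 \<and> stadium_stretch (v $ 1) * (v $ 2)\<^sup>2 = stadium_stretch (v $ 1) * P"
      unfolding A1_def F1_def mem_Collect_eq fibre_map_nth rp by (simp add: power_mult_distrib sq) linarith
    also have "\<dots> \<longleftrightarrow> v \<in> stadium" using stadium_stretch_pos[of "v $ 1"] by (auto simp: stadium_def P_def)
    finally show "F1 v \<in> A1 \<longleftrightarrow> v \<in> stadium" .
  qed
  have B1: "F1 ` carrier = carrier"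
  proof (rule isotopic_to_id_image[OF i1])
    show "F1 v \<in> carrier \<longleftrightarrow> v \<in> carrier" for v
      using stadium_stretch_pos[of "v $ 1"] by (simp add: carrier_iff_profile F1_def fibre_map_nth)
  qed
  have A2: "F2 ` A1 = A2"
  proof (rule isotopic_to_id_image[OF i2])
    fix v :: "real^3"
    have "g v = 1" if "4/9 * (v $ 1)\<^sup>2 + (v $ 2)\<^sup>2 = 1" using that c by (simp add: g_def)
    then show "F2 v \<in> A2 \<longleftrightarrow> v \<in> A1" by (auto simp: A1_def A2_def F2_def fibre_map_nth)
  qed
  have B2: "F2 ` carrier = carrier"
  proof (rule isotopic_to_id_image[OF i2])
    fix v :: "real^3"
    have g0: "g v = 0" if "v $ 2 = 0" "(v $ 1)\<^sup>2 = profile z" for z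
    proof -
      have "(v $ 1)\<^sup>2 \<le> R\<^sup>2" using profile_bounds(1)[of z] that(2) by (metis zero_le_power2)
      then have "4/9 * (v $ 1)\<^sup>2 + (v $ 2)\<^sup>2 - c \<le> 0" using that(1) by (simp add: c_def)
      then have "(4/9 * (v $ 1)\<^sup>2 + (v $ 2)\<^sup>2 - c) / (1 - c) \<le> 0" using c by (simp add: divide_nonpos_pos)
      then show ?thesis by (simp add: g_def)
    qed
    show "F2 v \<in> carrier \<longleftrightarrow> v \<in> carrier"
    proof (cases "g v = 0")
      case True
      then show ?thesis by (simp add: carrier_iff_profile F2_def fibre_map_nth)
    next
      case False
      then have "v \<notin> carrier" "F2 v \<notin> carrier"
        using g0[of "v $ 3"] g0[of "F2 v $ 3"] by (auto simp: carrier_iff_profile F2_def fibre_map_nth)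
      then show ?thesis by simp
    qed
  qed
  have A3: "F3 ` A2 = A3"
  proof (rule isotopic_to_id_image[OF i3])
    show "F3 v \<in> A3 \<longleftrightarrow> v \<in> A2" for v :: "real^3"
      by (auto simp: A2_def A3_def F3_def fibre_map_nth clamp01 power_mult_distrib power_divide)
  qed
  have B3: "F3 ` carrier = B3"
  proof (rule isotopic_to_id_image[OF i3])
    fix v :: "real^3"
    have sp: "stretch (v $ 3) * profile (v $ 3) = 1 - (v $ 3 / half_height)\<^sup>2" by (rule stretch_profile)
    show "F3 v \<in> B3 \<longleftrightarrow> v \<in> carrier"
    proof (cases "\<bar>v $ 3\<bar> \<le> half_height")
      case True
      then have "clamp01 (v $ 3 - half_height) = 0" by (intro clamp01) auto
      then have "F3 v \<in> B3 \<longleftrightarrow> v $ 2 = 0 \<and> stretch (v $ 3) * (v $ 1)\<^sup>2 = stretch (v $ 3) * profile (v $ 3)"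
        unfolding sp B3_def F3_def mem_Collect_eq fibre_map_nth
        using stretch_pos[of "v $ 3"] by (simp add: power_mult_distrib) linarith
      also have "\<dots> \<longleftrightarrow> v \<in> carrier" using stretch_pos[of "v $ 3"] by (simp add: carrier_iff_profile)
      finally show ?thesis .
    next
      case False
      have "v \<notin> carrier" using profile_bounds(2)[of "v $ 3"] False by (metis carrier_iff_profile zero_le_power2)
      moreover have "F3 v \<notin> B3"
      proof
        assume "F3 v \<in> B3"
        then have "(F3 v $ 1 - 3)\<^sup>2 + (v $ 3 / half_height)\<^sup>2 = 1" by (simp add: B3_def F3_def fibre_map_nth)
        then have "\<bar>v $ 3 / half_height\<bar> \<le> 1" using le1[of "v $ 3 / half_height" "F3 v $ 1 - 3"] by (simp add: add.commute)
        then show False using False Sp by (simp add: abs_divide divide_le_eq_1)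
      qed
      ultimately show ?thesis by simp
    qed
  qed
  have small: "clamp01 (x - 1) = 0" if "x\<^sup>2 + y\<^sup>2 = 1" for x y
    using le1[OF that] by (intro clamp01) auto
  have large: "clamp01 (x - 1) = 1" if "(x - 3)\<^sup>2 + y\<^sup>2 = 1" for x y
    using le1[OF that] by (intro clamp01) auto
  have A4: "F4 ` A3 = planar_circle 0"
  proof (rule isotopic_to_id_image[OF i4])
    show "F4 v \<in> planar_circle 0 \<longleftrightarrow> v \<in> A3" for v :: "real^3"
    proof (cases "clamp01 (v $ 1 - 1) = 0")
      case True
      then show ?thesis by (auto simp: A3_def planar_circle_iff F4_def fibre_map_nth)
    next
      case False
      then have "(v $ 1)\<^sup>2 + (v $ 2)\<^sup>2 \<noteq> 1" using small by blast
      then show ?thesis by (simp add: A3_def planar_circle_iff F4_def fibre_map_nth)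
    qed
  qed
  have B4: "F4 ` B3 = B4"
  proof (rule isotopic_to_id_image[OF i4])
    show "F4 v \<in> B4 \<longleftrightarrow> v \<in> B3" for v :: "real^3"
    proof (cases "clamp01 (v $ 1 - 1) = 1")
      case True
      then show ?thesis by (simp add: B3_def B4_def F4_def fibre_map_nth)
    next
      case False
      then have "(v $ 1 - 3)\<^sup>2 + y\<^sup>2 \<noteq> 1" for y using large by blast
      then show ?thesis by (simp add: B3_def B4_def F4_def fibre_map_nth)
    qed
  qed
  have A5: "F5 ` planar_circle 0 = planar_circle 0"
  proof (rule isotopic_to_id_image[OF i5])
    show "F5 v \<in> planar_circle 0 \<longleftrightarrow> v \<in> planar_circle 0" for v :: "real^3"
    proof (cases "v $ 3 = 0")
      case True
      then show ?thesis by (simp add: planar_circle_iff F5_def fibre_map_nth)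
    next
      case False
      then show ?thesis by (simp add: planar_circle_iff F5_def fibre_map_nth)
    qed
  qed
  have B5: "F5 ` B4 = B5"
  proof (rule isotopic_to_id_image[OF i5])
    show "F5 v \<in> B5 \<longleftrightarrow> v \<in> B4" for v :: "real^3"
    proof (cases "clamp01 (v $ 1 - 1) = 1")
      case True
      then show ?thesis by (simp add: B4_def B5_def F5_def fibre_map_nth)
    next
      case False
      then have "(v $ 1 - 3)\<^sup>2 + y\<^sup>2 \<noteq> 1" for y using large by blast
      then show ?thesis by (simp add: B4_def B5_def F5_def fibre_map_nth)
    qed
  qed
  have A6: "F6 ` planar_circle 0 = planar_circle 0"
  proof (rule isotopic_to_id_image[OF i6])
    show "F6 v \<in> planar_circle 0 \<longleftrightarrow> v \<in> planar_circle 0" for v :: "real^3"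
    proof (cases "clamp01 (v $ 1 - 1) = 0")
      case True
      then show ?thesis by (simp add: planar_circle_iff F6_def fibre_map_nth)
    next
      case False
      then have "(v $ 1)\<^sup>2 + (v $ 2)\<^sup>2 \<noteq> 1" using small by blast
      then show ?thesis by (simp add: planar_circle_iff F6_def fibre_map_nth)
    qed
  qed
  have B6: "F6 ` B5 = planar_circle 1"
  proof (rule isotopic_to_id_image[OF i6])
    show "F6 v \<in> planar_circle 1 \<longleftrightarrow> v \<in> B5" for v :: "real^3"
    proof (cases "clamp01 (v $ 1 - 1) = 1")
      case True
      then show ?thesis by (auto simp: planar_circle_iff B5_def F6_def fibre_map_nth)
    next
      case False
      then have "(v $ 1 - 3)\<^sup>2 + y\<^sup>2 \<noteq> 1" for y using large by blast
      then show ?thesis by (auto simp: planar_circle_iff B5_def F6_def fibre_map_nth)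
    qed
  qed
  let ?f = "F6 \<circ> (F5 \<circ> (F4 \<circ> (F3 \<circ> (F2 \<circ> F1))))"
  have "isotopic_to_id ?f" by (intro isotopic_to_id_compose i1 i2 i3 i4 i5 i6)
  moreover have "?f ` stadium = planar_circle 0" "?f ` carrier = planar_circle 1"
    by (simp_all only: image_comp[symmetric] A1 A2 A3 A4 A5 A6 B1 B2 B3 B4 B5 B6)
  ultimately show ?thesis by blast
qed

end

lemma ambient_isotopicI:
  assumes "isotopic_to_id f" "(`) f ` L = L'" shows "ambient_isotopic L L'"
  using assms unfolding ambient_isotopic_def isotopic_to_id_def by blast

lemma unlink_pair:
  assumes f: "isotopic_to_id f" "f ` A = planar_circle 0" "f ` B = planar_circle 1"
  shows "unlink {A, B}" "unknot A" "unknot B" "A \<noteq> B"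
proof -
  show ne: "A \<noteq> B" using f(2,3) planar_circle_0_ne_1 by metis
  have "trivial_link 2 = {planar_circle 0, planar_circle 1}"
    by (auto simp: trivial_link_def numeral_2_eq_2 lessThan_Suc)
  moreover have "card {A, B} = 2" using ne by simp
  ultimately have "trivial_link (card {A, B}) = {planar_circle 0, planar_circle 1}" by (simp only:)
  then show "unlink {A, B}" unfolding unlink_def using f by (intro ambient_isotopicI[OF f(1)]) simp
  have t1: "trivial_link 1 = {planar_circle 0}" by (simp add: trivial_link_def lessThan_Suc)
  show "unknot A" unfolding unknot_def t1 using f by (intro ambient_isotopicI[OF f(1)]) simp
  define G where "G = fibre_map 1 (\<lambda>v. 1) (\<lambda>v. - 3)"
  have G: "isotopic_to_id G" unfolding G_def by (rule fibre_map_isotopic_to_id) auto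
  have "G ` planar_circle 1 = planar_circle 0"
    by (rule isotopic_to_id_image[OF G]) (simp add: planar_circle_iff G_def fibre_map_nth)
  then have "(G \<circ> f) ` B = planar_circle 0" by (simp only: image_comp[symmetric] f(3))
  then show "unknot B" unfolding unknot_def t1 by (intro ambient_isotopicI[OF isotopic_to_id_compose[OF f(1) G]]) simp
qed

section \<open>Infinitely many gordian unlinks\<close>

lemma thin_link_pair:
  assumes K: "thick_knot (1/2) A" "thick_knot (1/2) B" and far: "\<And>a b. a \<in> A \<Longrightarrow> b \<in> B \<Longrightarrow> 1 \<le> norm (a - b)"
  shows "thin_link 1 {A, B}"
proof -
  have "disjnt A B" using far by (fastforce simp: disjnt_def)
  moreover have "disjnt (tube (1/2) A) (tube (1/2) B)"
  proof -
    have False if "a \<in> A" "b \<in> B" "x \<in> ball a (1/2)" "x \<in> ball b (1/2)" for a b x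
    proof -
      have "dist a b < 1" using that(3,4) dist_triangle[of a b x] by (simp add: dist_commute)
      then show False using far[OF that(1,2)] by (simp add: dist_norm)
    qed
    then show ?thesis unfolding tube_def disjnt_def by blast
  qed
  ultimately show ?thesis
    using K unfolding thin_link_def disjoint_tubes_def by (auto simp: pairwise_insert disjnt_sym)
qed

context peanut begin

lemma apart: "a \<in> stadium \<Longrightarrow> b \<in> carrier \<Longrightarrow> 1 \<le> norm (a - b)"
  using stadium_far[of a b] outside_neck_discs[of b] by (simp add: carrier_def)

text \<open>
  The stadium grips the neck of the peanut: its foci are the two middle points of the neck. An arbitrary
  arc-length parametrisation has the same length, and its tangent at the tips is found from the point
  set alone.
\<close>

lemma initially_gripped:
  assumes A: "constrained_loop 1 l \<alpha>" "\<alpha> ` {0..l} = stadium"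
    and B: "constrained_loop 1 m \<beta>'" "\<beta>' ` {0..m} = carrier"
  shows "l \<le> 2 * pi + 2 \<and> gripped (periodic_ext l \<alpha>) (periodic_ext l (tangent l \<alpha>)) (periodic_ext m \<beta>')"
proof
  have "l = 2 * (pi + 1)"
    by (rule constrained_loop_length_unique[OF A(1) stadium.constrained]) (simp only: A(2) stadium_range)
  then show "l \<le> 2 * pi + 2" by simp
  define P T Q where "P = periodic_ext l \<alpha>" "T = periodic_ext l (tangent l \<alpha>)" "Q = periodic_ext m \<beta>'"
  note d = P_T_Q_def
  interpret unit_speed_loop l P T unfolding d by (rule unit_speed_loop_periodic_ext[OF A(1)])
  have rP: "range P = stadium" unfolding d A(2)[symmetric]
    by (rule periodic_ext_range) (use A(1) in \<open>auto simp: constrained_loop_def\<close>)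
  have rQ: "range Q = carrier" unfolding d B(2)[symmetric]
    by (rule periodic_ext_range) (use B(1) in \<open>auto simp: constrained_loop_def\<close>)
  have on: "P t \<in> stadium" for t using rP by auto
  have P1: "\<bar>P t $ 1\<bar> \<le> 3/2" "P t $ 3 = 0" for t
  proof -
    have "(max 0 (\<bar>P t $ 1\<bar> - 1/2))\<^sup>2 \<le> 1\<^sup>2" using on[of t] by (simp add: stadium_def) (smt (verit) zero_le_power2)
    then have "max 0 (\<bar>P t $ 1\<bar> - 1/2) \<le> 1" by (rule power2_le_imp_le) simp
    then show "\<bar>P t $ 1\<bar> \<le> 3/2" by simp
    show "P t $ 3 = 0" using on[of t] by (simp add: stadium_def)
  qed
  have dc: "((\<lambda>t. P t $ i) has_real_derivative T t $ i) (at t)" for i t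
    using bounded_linear.has_vector_derivative[OF bounded_linear_vec_nth der]
    by (simp add: has_real_derivative_iff_has_vector_derivative)
  \<comment> \<open>at the two tips, where the first coordinate is extremal, the tangent is parallel to the second axis\<close>
  have tip: "T t $ 1 = 0 \<and> T t $ 3 = 0 \<and> (T t $ 2)\<^sup>2 = 1" if "\<bar>P t $ 1\<bar> = 3/2" for t
  proof -
    have "T t $ 3 = 0"
      by (rule DERIV_local_const[OF dc, of 1]) (use P1 in auto)
    moreover have "T t $ 1 = 0"
    proof (cases "P t $ 1 = 3/2")
      case True
      have "P y $ 1 \<le> P t $ 1" for y using P1(1)[of y] True by linarith
      then show ?thesis by (intro DERIV_local_max[OF dc, of 1]) auto
    next
      case False
      then have "P t $ 1 = - (3/2)" using that by auto
      then have "P t $ 1 \<le> P y $ 1" for y using P1(1)[of y] by (simp add: abs_le_iff)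
      then show ?thesis by (intro DERIV_local_min[OF dc, of 1]) auto
    qed
    ultimately show ?thesis using unit[of t] by (simp add: norm_vec3_eq_1)
  qed
  have pt: "\<exists>t. P t = v" if "v \<in> stadium" for v using that rP by (metis imageE)
  obtain t0 where t0: "P t0 = vec3 (3/2) 0 0" using pt[of "vec3 (3/2) 0 0"] by (auto simp: stadium_def)
  obtain t1 where t1: "P t1 = vec3 (-3/2) 0 0" using pt[of "vec3 (-3/2) 0 0"] by (auto simp: stadium_def)
  have f: "T t0 $ 1 = 0" "T t0 $ 3 = 0" "(T t0 $ 2)\<^sup>2 = 1" using tip[of t0] t0 by auto
  have f1: "T t1 $ 1 = 0" "T t1 $ 3 = 0" "(T t1 $ 2)\<^sup>2 = 1" using tip[of t1] t1 by auto
  obtain t2 where t2: "P t2 = vec3 (1/2) (T t0 $ 2) 0" using pt[of "vec3 (1/2) (T t0 $ 2) 0"] f by (auto simp: stadium_def)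
  obtain t3 where t3: "P t3 = vec3 (-1/2) (T t0 $ 2) 0" using pt[of "vec3 (-1/2) (T t0 $ 2) 0"] f by (auto simp: stadium_def)
  have "\<exists>s. Q s = v" if "v \<in> carrier" for v using that rQ by (metis imageE)
  moreover have "vec3 (1/2) 0 0 \<in> carrier" "vec3 (-1/2) 0 0 \<in> carrier"
    using R sin_\<beta> by (auto simp: carrier_def)
  ultimately obtain s1 s2 where s: "Q s1 = vec3 (-1/2) 0 0" "Q s2 = vec3 (1/2) 0 0" by metis
  have "norm (Q s2 - Q s1) = 1" by (simp add: s norm_vec3_eq_1)
  moreover have "P t0 = Q s2 + (Q s2 - Q s1)" "P t1 = Q s1 - (Q s2 - Q s1)" "P t2 = Q s2 + T t0" "P t3 = Q s1 + T t0"
    using t0 t1 t2 t3 f by (simp_all add: s vec3_eq_iff)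
  moreover have "(T t1 \<bullet> T t0)\<^sup>2 = 1" using f f1 by (simp add: inner_vec3 power_mult_distrib)
  ultimately show "gripped (periodic_ext l \<alpha>) (periodic_ext l (tangent l \<alpha>)) (periodic_ext m \<beta>')"
    unfolding gripped_def d[symmetric] by blast
qed

lemma gordian: "gordian_unlink {stadium, carrier}"
proof -
  obtain f where "isotopic_to_id f" "f ` stadium = planar_circle 0" "f ` carrier = planar_circle 1"
    using unlinking_isotopy by blast
  note u = unlink_pair[OF this]
  have "thin_link 1 {stadium, carrier}" by (rule thin_link_pair[OF stadium_thick thick apart])
  moreover have "\<not> thinly_disentangled 1 {stadium, carrier}"
    by (rule gripped_not_disentangled[OF u(4)]) (rule initially_gripped)
  moreover have "2 \<le> card {stadium, carrier}" using u(4) by simp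
  ultimately show ?thesis unfolding gordian_unlink_def using u by (intro exI[of _ 1]) simp
qed

end

definition peanut_angle :: "real \<Rightarrow> real" where
  "peanut_angle R = arccos ((R + 1/2) / (2 * R))"

lemma peanut_ratio:
  fixes R :: real
  assumes "1 \<le> R" shows "(R + 1/2) / (2 * R) = 1/2 + 1 / (4 * R)"
  using assms by (simp add: field_simps)

lemma peanut_peanut_angle:
  assumes "1 \<le> R" "R < 3/2" shows "peanut R (peanut_angle R)"
proof
  have r: "0 < (R + 1/2) / (2 * R)" "(R + 1/2) / (2 * R) < 1" using assms by simp_all
  show "0 < peanut_angle R" "peanut_angle R < pi / 2"
    using arccos_less_arccos[of "(R + 1/2) / (2 * R)" 1] arccos_less_arccos[of 0 "(R + 1/2) / (2 * R)"] r
    by (simp_all add: peanut_angle_def)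
  have "cos (peanut_angle R) = (R + 1/2) / (2 * R)" using r unfolding peanut_angle_def by (intro cos_arccos) linarith+
  then show "2 * R * cos (peanut_angle R) = R + 1/2" using assms by simp
qed (use assms in auto)

abbreviation peanut_knot :: "real \<Rightarrow> (real^3) set" where
  "peanut_knot R \<equiv> peanut.carrier R (peanut_angle R)"

definition peanut_length :: "real \<Rightarrow> real" where
  "peanut_length R = 2 * (R * (pi + 4 * peanut_angle R))"

text \<open>
  Both the radius and the angle of contact grow with \<open>R\<close>. As length is preserved, peanuts of
  different radius belong to different classes of thin links.
\<close>

lemma peanut_length_strict_mono:
  assumes "1 \<le> R" "R < R'" "R' < 3/2" shows "peanut_length R < peanut_length R'"
proof -
  have r: "0 < (R' + 1/2) / (2 * R')" "(R + 1/2) / (2 * R) < 1" using assms by simp_all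
  have "(R' + 1/2) / (2 * R') < (R + 1/2) / (2 * R)"
    unfolding peanut_ratio[OF assms(1)] using assms by (subst peanut_ratio) (auto simp: frac_less2)
  then have "peanut_angle R < peanut_angle R'"
    unfolding peanut_angle_def using r by (intro arccos_less_arccos) linarith+
  moreover have "0 < peanut_angle R" using peanut_peanut_angle[of R] assms by (auto simp: peanut_def)
  ultimately have "R * (pi + 4 * peanut_angle R) < R' * (pi + 4 * peanut_angle R')"
    using assms pi_gt_zero by (intro mult_strict_mono) auto
  then show ?thesis by (simp add: peanut_length_def)
qed

lemma peanut_knot_length:
  assumes R: "1 \<le> R" "R < 3/2" and C: "constrained_loop 1 s \<gamma>" "\<gamma> ` {0..s} = peanut_knot R"
  shows "s = peanut_length R"
proof -
  interpret peanut R "peanut_angle R" by (rule peanut_peanut_angle[OF R])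
  show ?thesis
    unfolding peanut_length_def
    by (rule constrained_loop_length_unique[OF C(1) constrained]) (simp only: C(2) range_carrier)
qed

lemma stadium_length:
  assumes C: "constrained_loop 1 s \<gamma>" "\<gamma> ` {0..s} = stadium"
  shows "s = 2 * (pi + 1)"
  by (rule constrained_loop_length_unique[OF C(1) stadium.constrained]) (simp only: C(2) stadium_range)

text \<open>
  Without this comparison an isotopy might move the peanut to the stadium of the other link.
\<close>

lemma peanut_longer_than_stadium:
  assumes R: "1 \<le> R" "R < 3/2" shows "2 * (pi + 1) < peanut_length R"
proof -
  have r: "0 \<le> (R + 1/2) / (2 * R)" "(R + 1/2) / (2 * R) \<le> 3/4" "(R + 1/2) / (2 * R) < 1" using R by (simp_all add: field_simps)
  \<comment> \<open>\<open>cos (1/4) \<ge> 1 - 1/32\<close> exceeds the cosine of the angle, which is at most \<open>3/4\<close>\<close>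
  have "3/4 < cos (1/4 :: real)"
  proof -
    have "cos (1/4 :: real) = 1 - 2 * (sin (1/8))\<^sup>2" using cos_double_sin[of "1/8 :: real"] by simp
    moreover have "(sin (1/8 :: real))\<^sup>2 \<le> (1/8)\<^sup>2" using abs_sin_x_le_abs_x[of "1/8"] by (intro abs_le_square_iff[THEN iffD1]) auto
    ultimately show ?thesis by (simp add: power2_eq_square)
  qed
  then have "arccos (cos (1/4)) < peanut_angle R"
    unfolding peanut_angle_def using r cos_le_one[of "1/4"] by (intro arccos_less_arccos; linarith)
  moreover have "arccos (cos (1/4)) = (1/4 :: real)" using pi_ge_two by (intro arccos_cos) auto
  ultimately have "1 < 4 * peanut_angle R" by simp
  then have "1 * (pi + 1) < R * (pi + 4 * peanut_angle R)" using R pi_gt_zero by (intro mult_le_less_imp_less) auto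
  then show ?thesis by (simp add: peanut_length_def)
qed

lemma not_thinly_isotopic:
  assumes R: "1 \<le> R" "R < 3/2" and R': "1 \<le> R'" "R' < 3/2" and ne: "R \<noteq> R'"
  shows "\<not> thinly_isotopic {stadium, peanut_knot R} {stadium, peanut_knot R'}"
proof
  assume iso: "thinly_isotopic {stadium, peanut_knot R} {stadium, peanut_knot R'}"
  have "peanut_knot R \<in> {stadium, peanut_knot R}" by simp
  from thinly_isotopic_lengths[OF iso this]
  obtain s \<gamma> \<gamma>' where C: "constrained_loop 1 s \<gamma>" "constrained_loop 1 s \<gamma>'" "\<gamma> ` {0..s} = peanut_knot R"
    and im: "\<gamma>' ` {0..s} \<in> {stadium, peanut_knot R'}"
    by (elim exE conjE) (rule that)
  have s: "s = peanut_length R" by (rule peanut_knot_length[OF R C(1,3)])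
  from im consider "\<gamma>' ` {0..s} = stadium" | "\<gamma>' ` {0..s} = peanut_knot R'" by blast
  then show False
  proof cases
    case 1
    then show False using stadium_length[OF C(2)] peanut_longer_than_stadium[OF R] s by simp
  next
    case 2
    then have "peanut_length R = peanut_length R'" using peanut_knot_length[OF R' C(2)] s by simp
    then show False
      using peanut_length_strict_mono[of R R'] peanut_length_strict_mono[of R' R] R R' ne by (cases "R < R'") auto
  qed
qed

theorem theorem4p9:
  "\<exists>\<L> :: (real^3) set set set.
     infinite \<L> \<and> (\<forall>L\<in>\<L>. gordian_unlink L) \<and>
     pairwise (\<lambda>L L'. \<not> thinly_isotopic L L') \<L>"
proof (intro exI conjI ballI)
  let ?L = "\<lambda>R. {stadium, peanut_knot R}"
  have ge: "gordian_unlink (?L R)" if "R \<in> {1..<3/2}" for R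
    using peanut.gordian[OF peanut_peanut_angle[of R]] that by auto
  show "gordian_unlink L" if "L \<in> ?L ` {1..<3/2}" for L using that ge by blast
  have ne: "stadium \<noteq> peanut_knot R" if "R \<in> {1..<3/2}" for R
    using ge[OF that] by (auto simp: gordian_unlink_def)
  have "inj_on ?L {1..<3/2}"
  proof (rule inj_onI)
    fix R R' assume r: "R \<in> {1..<3/2::real}" "R' \<in> {1..<3/2}" "?L R = ?L R'"
    then have eq: "peanut_knot R = peanut_knot R'" using ne by (metis doubleton_eq_iff)
    interpret peanut R "peanut_angle R" using peanut_peanut_angle[of R] r by auto
    have "2 * (R * (pi + 4 * peanut_angle R)) = peanut_length R'"
      by (rule peanut_knot_length[OF _ _ constrained]) (use r eq range_carrier in auto)
    then have "peanut_length R = peanut_length R'" by (simp add: peanut_length_def)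
    then show "R = R'"
      using peanut_length_strict_mono[of R R'] peanut_length_strict_mono[of R' R] r by (cases R R' rule: linorder_cases) auto
  qed
  then show "infinite (?L ` {1..<3/2})" by (simp add: finite_image_iff)
  show "pairwise (\<lambda>L L'. \<not> thinly_isotopic L L') (?L ` {1..<3/2})"
  proof (rule pairwiseI)
    fix L L' assume "L \<in> ?L ` {1..<3/2}" "L' \<in> ?L ` {1..<3/2}" "L \<noteq> L'"
    then obtain R R' where "R \<in> {1..<3/2}" "R' \<in> {1..<3/2}" "L = ?L R" "L' = ?L R'" "R \<noteq> R'" by blast
    then show "\<not> thinly_isotopic L L'" using not_thinly_isotopic[of R R'] by simp
  qed
qed

end
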